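(* Let $X$ be a compact and topologically transitive Polish foliated space. Then $X$ is either sensitive to initial conditions or almost equicontinuous. Moreover, if $X$ is minimal (every leaf is dense in $X$), then it is either sensitive to initial conditions or equicontinuous.
   Context: Metrics may take the value $\infty$; a metric is compatible if its open balls generate the topology. Foliated space: a Polish space $X$ with a partition $\mathcal F$ is a foliated space of dimension $n$ and leafwise class $C^k$ ($k\in\mathbb N\cup\{\infty\}$) if $X$ has an atlas of charts $\phi_i\colon U_i\to\mathbb R^n\times Z_i$ (homeomorphisms, $\{U_i\}$ an open cover, $Z_i$ Polish) with coordinate changes $\phi_i\phi_j^{-1}(x_j,z_j)=(x_i(x_j,z_j),z_i(z_j))$, where $z_i$ is continuous and depends only on $z_j$, and $x_i$ is of class $C^k$ on every plaque; the plaques are the sets $\phi_i^{-1}(\mathbb R^n\times\{z\})$, and the equivalence relation given by $\mathcal F$ is the transitive closure of "being in the same plaque". The elements of $\mathcal F$ are the leaves. Pseudogroups: $\mathrm{Ph}(Z)$ is the set of homeomorphisms $f\colon\mathrm{dom} f\to\mathrm{im} f$ between open subsets of $Z$; the composition $gf$ has domain $f^{-1}(\mathrm{dom}\,g)$. A pseudo$*$group on $Z$ is a subset of $\mathrm{Ph}(Z)$ containing $\mathrm{id}_Z$ and closed under inversion, composition and restriction to open subsets of domains. A pseudogroup is a pseudo$*$group $\mathcal G$ such that if $f\in\mathrm{Ph}(Z)$ and every $x\in\mathrm{dom} f$ has an open neighborhood $V$ with $f|_V\in\mathcal G$, then $f\in\mathcal G$. $S\subset\mathcal G$ generates $\mathcal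 G$ if $\mathcal G$ is the smallest pseudogroup containing $S$; $S^*$ is the smallest pseudo$*$group containing $S$. Holonomy pseudogroup: for a locally finite atlas $\{(U_i,\phi_i)\}$ of the foliated space $X$, consisting of homeomorphisms $\phi_i\colon U_i\to\mathbb R^n\times Z_i$ ($\{U_i\}$ a locally finite open cover of $X$, $Z_i$ Polish) with coordinate changes $\phi_i\phi_j^{-1}(x_j,z_j)=(x_i(x_j,z_j),z_i(z_j))$, where $z_i$ is continuous and depends only on $z_j$, and $x_i$ is of class $C^k$ on every plaque, and such that the equivalence relation given by $\mathcal F$ is the transitive closure of "being in the same plaque", let $p_i$ be $\phi_i$ followed by the projection $\mathbb R^n\times Z_i\to Z_i$ and $Z=\coprod_i Z_i$; the holonomy pseudogroup of $X$ is the pseudogroup on $Z$ generated by the maps $h_{i,j}\colon p_j(U_i\cap U_j)\to p_i(U_i\cap U_j)$, $h_{i,j}(z_j)=z_i(z_j)$. It is well defined up to equivalence of pseudogroups, and the properties below do not depend on the atlas. For a pseudogroup $\mathcal G$ on $Z$: it is topologically transitive if for all non-empty open $U,V\subset Z$ some $g\in\mathcal G$ satisfies $g(U\cap\mathrm{dom}\,g)\cap V\ne\emptyset$. It is sensitive to initial conditions if for every compatible metric $d$ on $Z$ and every pseudo$*$group $\mathcal S\subset\mathcal G$ generating $\mathcal G$ there is $c>0$ such that for every $x\in Z$ and $r>0$ there are $s\in\mathcal S$ and $y$ with $x,y\in\mathrm{dom}\,s$, $d(x,y)<r$ and $d(sx,sy)\ge c$. A point $x$ is $(S,d)$-equicontinuous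 ($S$ a generating set, $d$ a compatible metric) if for every $\epsilon>0$ there is $\delta>0$ such that $d(x,y)<\delta$ implies $d(sx,sy)<\epsilon$ for all $s\in S^*$ and $y$ with $x,y\in\mathrm{dom}\,s$; $\mathcal G$ is almost equicontinuous if for some generating set $S$ and compatible metric $d$ the $(S,d)$-equicontinuous points are dense in $Z$. $\mathcal G$ is equicontinuous if there are a generating pseudo$*$group $\mathcal S$, a compatible metric $d$ and an assignment $\epsilon\mapsto\delta(\epsilon)>0$ such that $d(x,y)<\delta(\epsilon)$ implies $d(sx,sy)<\epsilon$ for all $\epsilon>0$, $s\in\mathcal S$ and $x,y\in\mathrm{dom}\,s$. A foliated space is topologically transitive (equivalently, has a dense leaf), sensitive to initial conditions, almost equicontinuous, or equicontinuous if its holonomy pseudogroup is. *)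

theory Defs
  imports "HOL-Analysis.Analysis" "HOL-Library.Disjoint_Sets" "HOL-Library.Extended_Nat"
begin

section \<open>Extended metrics\<close>

text \<open>Metrics may take the value \<open>\<infinity>\<close>, hence the type \<open>ennreal\<close>.\<close>

definition ext_metric_on :: "'z set \<Rightarrow> ('z \<Rightarrow> 'z \<Rightarrow> ennreal) \<Rightarrow> bool" where
  "ext_metric_on M d \<longleftrightarrow>
     (\<forall>x\<in>M. \<forall>y\<in>M. d x y = 0 \<longleftrightarrow> x = y) \<and>
     (\<forall>x\<in>M. \<forall>y\<in>M. d x y = d y x) \<and>
     (\<forall>x\<in>M. \<forall>y\<in>M. \<forall>z\<in>M. d x z \<le> d x y + d y z)"

definition compatible_metric :: "'z topology \<Rightarrow> ('z \<Rightarrow> 'z \<Rightarrow> ennreal) \<Rightarrow> bool" where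
  "compatible_metric T d \<longleftrightarrow>
     ext_metric_on (topspace T) d \<and>
     T = topology_generated_by
           {{y \<in> topspace T. d x y < ennreal r} | x r. x \<in> topspace T \<and> 0 < r}"


section \<open>Pseudogroups\<close>

text \<open>Partial maps of \<open>T\<close> are maps \<open>'z \<rightharpoonup> 'z\<close>, so that \<open>g \<circ>\<^sub>m f\<close> has
  domain the preimage under \<open>f\<close> of \<open>dom g\<close>, and \<open>f |` V\<close> is restriction.\<close>

definition Ph :: "'z topology \<Rightarrow> ('z \<rightharpoonup> 'z) set" where
  "Ph T = {f. openin T (dom f) \<and> openin T (ran f) \<and>
     homeomorphic_map (subtopology T (dom f)) (subtopology T (ran f)) (\<lambda>x. the (f x))}"

definition id_Ph :: "'z topology \<Rightarrow> ('z \<rightharpoonup> 'z)" where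
  "id_Ph T = Some |` topspace T"

text \<open>Only meaningful for partial maps that are injective on their domain.\<close>

definition inv_Ph :: "('z \<rightharpoonup> 'z) \<Rightarrow> ('z \<rightharpoonup> 'z)" where
  "inv_Ph f = (\<lambda>y. if y \<in> ran f then Some (THE x. f x = Some y) else None)"

definition pseudo_star_group :: "'z topology \<Rightarrow> ('z \<rightharpoonup> 'z) set \<Rightarrow> bool" where
  "pseudo_star_group T S \<longleftrightarrow>
     S \<subseteq> Ph T \<and>
     id_Ph T \<in> S \<and>
     (\<forall>f\<in>S. inv_Ph f \<in> S) \<and>
     (\<forall>f\<in>S. \<forall>g\<in>S. g \<circ>\<^sub>m f \<in> S) \<and>
     (\<forall>f\<in>S. \<forall>V. openin T V \<and> V \<subseteq> dom f \<longrightarrow> f |` V \<in> S)"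

definition pseudogroup :: "'z topology \<Rightarrow> ('z \<rightharpoonup> 'z) set \<Rightarrow> bool" where
  "pseudogroup T G \<longleftrightarrow>
     pseudo_star_group T G \<and>
     (\<forall>f\<in>Ph T. (\<forall>x\<in>dom f. \<exists>V. openin T V \<and> x \<in> V \<and> V \<subseteq> dom f \<and> f |` V \<in> G) \<longrightarrow> f \<in> G)"

text \<open>The smallest pseudogroup and the smallest pseudo-*-group containing a set of partial
  homeomorphisms. (Such a set is contained in \<open>Ph T\<close>, which is itself a pseudogroup, so the
  intersections below range over nonempty families.)\<close>

definition generated_pseudogroup :: "'z topology \<Rightarrow> ('z \<rightharpoonup> 'z) set \<Rightarrow> ('z \<rightharpoonup> 'z) set" where
  "generated_pseudogroup T S = pseudogroup T hull S"

definition star :: "'z topology \<Rightarrow> ('z \<rightharpoonup> 'z) set \<Rightarrow> ('z \<rightharpoonup> 'z) set" where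
  "star T S = pseudo_star_group T hull S"

definition generates :: "'z topology \<Rightarrow> ('z \<rightharpoonup> 'z) set \<Rightarrow> ('z \<rightharpoonup> 'z) set \<Rightarrow> bool" where
  "generates T S G \<longleftrightarrow> S \<subseteq> G \<and> generated_pseudogroup T S = G"


section \<open>Dynamical properties of a pseudogroup\<close>

definition topologically_transitive :: "'z topology \<Rightarrow> ('z \<rightharpoonup> 'z) set \<Rightarrow> bool" where
  "topologically_transitive T G \<longleftrightarrow>
     (\<forall>U V. openin T U \<and> openin T V \<and> U \<noteq> {} \<and> V \<noteq> {} \<longrightarrow>
        (\<exists>g\<in>G. (\<lambda>x. the (g x)) ` (U \<inter> dom g) \<inter> V \<noteq> {}))"

definition sensitive :: "'z topology \<Rightarrow> ('z \<rightharpoonup> 'z) set \<Rightarrow> bool" where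
  "sensitive T G \<longleftrightarrow>
     (\<forall>d S. compatible_metric T d \<and> pseudo_star_group T S \<and> generates T S G \<longrightarrow>
        (\<exists>c::real. c > 0 \<and>
           (\<forall>x\<in>topspace T. \<forall>r::real. r > 0 \<longrightarrow>
              (\<exists>s\<in>S. \<exists>y. x \<in> dom s \<and> y \<in> dom s \<and> d x y < ennreal r \<and>
                 d (the (s x)) (the (s y)) \<ge> ennreal c))))"

definition equicontinuous_point ::
    "'z topology \<Rightarrow> ('z \<rightharpoonup> 'z) set \<Rightarrow> ('z \<Rightarrow> 'z \<Rightarrow> ennreal) \<Rightarrow> 'z \<Rightarrow> bool" where
  "equicontinuous_point T S d x \<longleftrightarrow>
     (\<forall>\<epsilon>::real. \<epsilon> > 0 \<longrightarrow> (\<exists>\<delta>::real. \<delta> > 0 \<and>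
        (\<forall>s\<in>star T S. \<forall>y. x \<in> dom s \<and> y \<in> dom s \<and> d x y < ennreal \<delta> \<longrightarrow>
           d (the (s x)) (the (s y)) < ennreal \<epsilon>)))"

definition almost_equicontinuous :: "'z topology \<Rightarrow> ('z \<rightharpoonup> 'z) set \<Rightarrow> bool" where
  "almost_equicontinuous T G \<longleftrightarrow>
     (\<exists>S d. generates T S G \<and> compatible_metric T d \<and>
        T closure_of {x \<in> topspace T. equicontinuous_point T S d x} = topspace T)"

definition equicontinuous :: "'z topology \<Rightarrow> ('z \<rightharpoonup> 'z) set \<Rightarrow> bool" where
  "equicontinuous T G \<longleftrightarrow>
     (\<exists>S d. \<exists>\<delta> :: real \<Rightarrow> real.
        pseudo_star_group T S \<and> generates T S G \<and> compatible_metric T d \<and>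
        (\<forall>\<epsilon>>0. \<delta> \<epsilon> > 0) \<and>
        (\<forall>\<epsilon>>0. \<forall>s\<in>S. \<forall>x\<in>dom s. \<forall>y\<in>dom s.
           d x y < ennreal (\<delta> \<epsilon>) \<longrightarrow> d (the (s x)) (the (s y)) < ennreal \<epsilon>))"


section \<open>Foliated spaces\<close>

definition polish :: "'a topology \<Rightarrow> bool" where
  "polish X \<longleftrightarrow> completely_metrizable_space X \<and> second_countable X"

text \<open>\<open>\<real>\<^sup>n\<close> is \<open>Euclidean_space n\<close>, so that \<open>n = 0\<close> is allowed. The sets \<open>W\<close> below are meant
  to be open in it; the derivative of \<open>t \<mapsto> f (x(i := t))\<close> at \<open>x i\<close> is the \<open>i\<close>-th partial
  derivative of \<open>f\<close> at \<open>x\<close>.\<close>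

primrec C_nat_on :: "nat \<Rightarrow> nat \<Rightarrow> (nat \<Rightarrow> real) set \<Rightarrow> ((nat \<Rightarrow> real) \<Rightarrow> real) \<Rightarrow> bool" where
  "C_nat_on n 0 W f \<longleftrightarrow> continuous_map (subtopology (Euclidean_space n) W) euclideanreal f"
| "C_nat_on n (Suc k) W f \<longleftrightarrow>
     continuous_map (subtopology (Euclidean_space n) W) euclideanreal f \<and>
     (\<exists>f'. \<forall>i<n.
        (\<forall>x\<in>W. ((\<lambda>t. f (x(i := t))) has_real_derivative f' i x) (at (x i))) \<and>
        C_nat_on n k W (f' i))"

definition C_on ::
    "nat \<Rightarrow> enat \<Rightarrow> (nat \<Rightarrow> real) set \<Rightarrow> ((nat \<Rightarrow> real) \<Rightarrow> (nat \<Rightarrow> real)) \<Rightarrow> bool" where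
  "C_on n k W f \<longleftrightarrow> (\<forall>m. enat m \<le> k \<longrightarrow> (\<forall>l<n. C_nat_on n m W (\<lambda>x. f x l)))"

text \<open>An atlas consists of charts \<open>\<phi> i : U i \<rightarrow> \<real>\<^sup>n \<times> Z i\<close> for \<open>i \<in> I\<close>. The plaques of the
  chart \<open>i\<close> are the fibres of \<open>snd \<circ> \<phi> i\<close> on \<open>U i\<close>.\<close>

definition same_plaque ::
    "'i set \<Rightarrow> ('i \<Rightarrow> 'a set) \<Rightarrow> ('i \<Rightarrow> 'a \<Rightarrow> (nat \<Rightarrow> real) \<times> 'z) \<Rightarrow> ('a \<times> 'a) set" where
  "same_plaque I U \<phi> =
     {(x, y). \<exists>i\<in>I. x \<in> U i \<and> y \<in> U i \<and> snd (\<phi> i x) = snd (\<phi> i y)}"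

text \<open>\<open>\<phi>\<^sub>i \<phi>\<^sub>j\<^sup>-\<^sup>1 (x, z) = (\<xi> (x, z), \<zeta> z)\<close> on \<open>\<phi>\<^sub>j (U\<^sub>i \<inter> U\<^sub>j)\<close>.\<close>

definition foliated_coordinate_change ::
    "nat \<Rightarrow> enat \<Rightarrow> ('i \<Rightarrow> 'a set) \<Rightarrow> ('i \<Rightarrow> 'a \<Rightarrow> (nat \<Rightarrow> real) \<times> 'z) \<Rightarrow>
     ('i \<Rightarrow> 'z topology) \<Rightarrow> 'i \<Rightarrow> 'i \<Rightarrow> bool" where
  "foliated_coordinate_change n k U \<phi> Z i j \<longleftrightarrow>
     (\<exists>(\<xi> :: (nat \<Rightarrow> real) \<times> 'z \<Rightarrow> (nat \<Rightarrow> real)) (\<zeta> :: 'z \<Rightarrow> 'z).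
        (\<forall>u \<in> U i \<inter> U j. \<phi> i u = (\<xi> (\<phi> j u), \<zeta> (snd (\<phi> j u)))) \<and>
        continuous_map (subtopology (Z j) ((snd \<circ> \<phi> j) ` (U i \<inter> U j))) (Z i) \<zeta> \<and>
        (\<forall>z \<in> topspace (Z j).
           C_on n k {x. (x, z) \<in> \<phi> j ` (U i \<inter> U j)} (\<lambda>x. \<xi> (x, z))))"

text \<open>\<open>X\<close> with the partition \<open>F\<close> into leaves is a foliated space of dimension \<open>n\<close> and leafwise
  class \<open>C\<^sup>k\<close>, as witnessed by the given atlas.\<close>

definition foliated_space_atlas ::
    "nat \<Rightarrow> enat \<Rightarrow> 'a topology \<Rightarrow> 'a set set \<Rightarrow> 'i set \<Rightarrow> ('i \<Rightarrow> 'a set) \<Rightarrow>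
     ('i \<Rightarrow> 'a \<Rightarrow> (nat \<Rightarrow> real) \<times> 'z) \<Rightarrow> ('i \<Rightarrow> 'z topology) \<Rightarrow> bool" where
  "foliated_space_atlas n k X F I U \<phi> Z \<longleftrightarrow>
     polish X \<and>
     partition_on (topspace X) F \<and>
     (\<forall>i\<in>I. openin X (U i)) \<and> (\<Union>i\<in>I. U i) = topspace X \<and>
     (\<forall>i\<in>I. polish (Z i)) \<and>
     (\<forall>i\<in>I. homeomorphic_map (subtopology X (U i))
               (prod_topology (Euclidean_space n) (Z i)) (\<phi> i)) \<and>
     (\<forall>i\<in>I. \<forall>j\<in>I. foliated_coordinate_change n k U \<phi> Z i j) \<and>
     {(x, y). \<exists>L\<in>F. x \<in> L \<and> y \<in> L} = (same_plaque I U \<phi>)\<^sup>+"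

text \<open>Local finiteness of the family \<open>U\<close> as an indexed family (repetitions are counted).\<close>

definition locally_finite_family :: "'a topology \<Rightarrow> 'i set \<Rightarrow> ('i \<Rightarrow> 'a set) \<Rightarrow> bool" where
  "locally_finite_family X I U \<longleftrightarrow>
     (\<forall>x\<in>topspace X. \<exists>V. openin X V \<and> x \<in> V \<and> finite {i\<in>I. U i \<inter> V \<noteq> {}})"

text \<open>The partial map \<open>h\<^sub>i\<^sub>j\<close> of the disjoint union \<open>sum_topology Z I\<close>; the value is well defined
  because the transverse coordinate in chart \<open>i\<close> is a function of the one in chart \<open>j\<close>.\<close>

definition holonomy_map ::
    "('i \<Rightarrow> 'a set) \<Rightarrow> ('i \<Rightarrow> 'a \<Rightarrow> (nat \<Rightarrow> real) \<times> 'z) \<Rightarrow> 'i \<Rightarrow> 'i \<Rightarrow> ('i \<times> 'z \<rightharpoonup> 'i \<times> 'z)" where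
  "holonomy_map U \<phi> i j = (\<lambda>(j', z).
     if j' = j \<and> z \<in> (snd \<circ> \<phi> j) ` (U i \<inter> U j)
     then Some (i, THE w. \<exists>u \<in> U i \<inter> U j. snd (\<phi> j u) = z \<and> snd (\<phi> i u) = w)
     else None)"

definition holonomy_pseudogroup ::
    "'i set \<Rightarrow> ('i \<Rightarrow> 'a set) \<Rightarrow> ('i \<Rightarrow> 'a \<Rightarrow> (nat \<Rightarrow> real) \<times> 'z) \<Rightarrow> ('i \<Rightarrow> 'z topology) \<Rightarrow>
     ('i \<times> 'z \<rightharpoonup> 'i \<times> 'z) set" where
  "holonomy_pseudogroup I U \<phi> Z =
     generated_pseudogroup (sum_topology Z I) {holonomy_map U \<phi> i j | i j. i \<in> I \<and> j \<in> I}"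

definition minimal_foliation :: "'a topology \<Rightarrow> 'a set set \<Rightarrow> bool" where
  "minimal_foliation X F \<longleftrightarrow> (\<forall>L\<in>F. X closure_of L = topspace X)"

text \<open>The dynamical properties of a foliated space are those of its holonomy pseudogroup,
  computed in a locally finite atlas (they do not depend on the choice of atlas).\<close>

definition fol_transitive where
  "fol_transitive I U \<phi> Z \<longleftrightarrow>
     topologically_transitive (sum_topology Z I) (holonomy_pseudogroup I U \<phi> Z)"

definition fol_sensitive where
  "fol_sensitive I U \<phi> Z \<longleftrightarrow>
     sensitive (sum_topology Z I) (holonomy_pseudogroup I U \<phi> Z)"

definition fol_almost_equicontinuous where
  "fol_almost_equicontinuous I U \<phi> Z \<longleftrightarrow>
     almost_equicontinuous (sum_topology Z I) (holonomy_pseudogroup I U \<phi> Z)"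

definition fol_equicontinuous where
  "fol_equicontinuous I U \<phi> Z \<longleftrightarrow>
     equicontinuous (sum_topology Z I) (holonomy_pseudogroup I U \<phi> Z)"

end

theory Submission
  imports Defs
begin

text \<open>
Let \<open>G\<close> be the holonomy pseudogroup on the transversal \<open>Z\<close>, and suppose that it is not
sensitive. Then a metric \<open>d\<close> and a generating pseudo-*-group \<open>S\<close> are such that for each \<open>c > 0\<close>
some point \<open>x\<close> is stable: the maps of \<open>S\<close> that are defined at \<open>x\<close> move a fixed ball around \<open>x\<close>
into the \<open>c\<close>-ball around the image of \<open>x\<close>. This says nothing about maps that are defined at
points near \<open>x\<close> but not at \<open>x\<close>, and it only concerns \<open>S\<close> and a single \<open>c\<close>. Compactness of \<open>X\<close>
closes this gap.

Shrink the charts \<open>U\<^sub>i\<close> to open sets \<open>W\<^sub>i\<close> that still cover \<open>X\<close> and lie in compact sets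
\<open>K\<^sub>i \<subseteq> U\<^sub>i\<close>. The letters are the finitely many holonomy maps \<open>h\<^sub>i\<^sub>j\<close> cut down to the
transverse projection of \<open>W\<^sub>i \<inter> W\<^sub>j\<close>. As \<open>h\<^sub>i\<^sub>j\<close> is defined on the compact projection of
\<open>K\<^sub>i \<inter> K\<^sub>j\<close>, there is a Lebesgue number \<open>c\<^sub>0\<close>: at every point of its domain a letter extends to
a map of \<open>S\<close> on the \<open>c\<^sub>0\<close>-ball. If \<open>2 c \<le> c\<^sub>0\<close>, a word in the letters that is defined at one point of
the ball \<open>N\<close> around a stable point extends to a map of \<open>S\<close> on all of \<open>N\<close>, because the image of \<open>N\<close>
has stayed so small that each next letter extends to it
(\<open>word_extends_near_stable_point\<close>). Hence \<open>N\<close> stays small under all words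
(\<open>not_sensitive_imp_calm\<close>).

The transversal need not be compact, so its points are first brought to the region of the letters.
A return map sends \<open>z\<close> in \<open>Z\<^sub>i\<close> to the transverse coordinate in some \<open>W\<^sub>j\<close> of the point
\<open>\<phi>\<^sub>i\<^sup>-\<^sup>1 (0, z)\<close> of \<open>X\<close>. Two return maps differ by a letter, since they look at the same point of
\<open>X\<close>. Therefore the maps of the form \<open>\<gamma>'\<^sup>-\<^sup>1 b \<gamma>\<close>, with a word \<open>b\<close> and return maps \<open>\<gamma>\<close> and \<open>\<gamma>'\<close>, make up a
pseudo-*-group. It generates \<open>G\<close> because plaques are connected: the holonomy at a transverse point
can be followed along its plaque through the sets \<open>W\<^sub>k\<close> (\<open>holonomy_into_W_factored\<close>).

The points that return into a set which is \<open>\<epsilon>\<close>-small under all words form an open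
\<open>G\<close>-invariant set, nonempty for every \<open>\<epsilon>\<close>. If \<open>G\<close> is topologically transitive this set is dense,
and by Baire's theorem so is the intersection over all \<open>\<epsilon>\<close>; if \<open>X\<close> is minimal it is everything.

It remains to pass through the return maps and their inverses, which are not uniformly continuous.
As \<open>Z\<close> is \<open>\<sigma>\<close>-compact, the return maps can be cut into countably many pieces, finitely many
at each level \<open>m\<close>, such that the pieces of level \<open>m\<close> are of size at most \<open>1/(m+1)\<close>. For a given
\<open>\<epsilon>\<close> only finitely many pieces need a modulus of continuity, and each has one by compactness
(\<open>exists_uniform_refinement\<close>). So the same metric \<open>d\<close>, with the pseudo-*-group built from these
pieces, exhibits \<open>G\<close> as almost equicontinuous, or as equicontinuous in the minimal case. The
two alternatives exclude each other since sensitivity, applied to the metric and the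
pseudo-*-group of an equicontinuous point, contradicts that point.
\<close>

section \<open>Partial homeomorphisms\<close>

definition preim :: "('z \<rightharpoonup> 'z) \<Rightarrow> 'z set \<Rightarrow> 'z set" where
  "preim f V = {x. \<exists>y\<in>V. f x = Some y}"

definition img :: "('z \<rightharpoonup> 'z) \<Rightarrow> 'z set \<Rightarrow> 'z set" where
  "img f V = {y. \<exists>x\<in>V. f x = Some y}"

text \<open>Partial homeomorphisms are the injective partial maps under which preimages and images of open
sets are open. In this form closure under inversion, composition and restriction is a calculation
with \<open>preim\<close> and \<open>img\<close>.\<close>

lemma Ph_iff:
  "f \<in> Ph T \<longleftrightarrow> dom f \<subseteq> topspace T \<and> ran f \<subseteq> topspace T \<and>
     (\<forall>x x' y. f x = Some y \<and> f x' = Some y \<longrightarrow> x = x') \<and>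
     (\<forall>V. openin T V \<longrightarrow> openin T (preim f V)) \<and> (\<forall>V. openin T V \<longrightarrow> openin T (img f V))"
    (is "?L \<longleftrightarrow> ?R")
proof
  assume ?L
  then have d: "openin T (dom f)" and r: "openin T (ran f)"
    and h: "homeomorphic_map (subtopology T (dom f)) (subtopology T (ran f)) (\<lambda>x. the (f x))"
    by (auto simp: Ph_def)
  have dt: "topspace (subtopology T (dom f)) = dom f" and rt: "topspace (subtopology T (ran f)) = ran f"
    using d r openin_subset by fastforce+
  have inj: "inj_on (\<lambda>x. the (f x)) (dom f)"
    and cont: "continuous_map (subtopology T (dom f)) (subtopology T (ran f)) (\<lambda>x. the (f x))"
    and opn: "open_map (subtopology T (dom f)) (subtopology T (ran f)) (\<lambda>x. the (f x))"
    using h dt by (auto simp: homeomorphic_eq_everything_map)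
  have "openin T (preim f V)" if "openin T V" for V
  proof -
    have "openin (subtopology T (ran f)) (ran f \<inter> V)"
      using that openin_subtopology_Int2 by blast
    then have "openin (subtopology T (dom f)) {x \<in> topspace (subtopology T (dom f)). the (f x) \<in> ran f \<inter> V}"
      using cont openin_continuous_map_preimage by blast
    moreover have "{x \<in> topspace (subtopology T (dom f)). the (f x) \<in> ran f \<inter> V} = preim f V"
      unfolding dt by (auto simp: preim_def dom_def ran_def)
    ultimately show ?thesis using d openin_trans_full by metis
  qed
  moreover have "openin T (img f V)" if "openin T V" for V
  proof -
    have "openin (subtopology T (dom f)) (dom f \<inter> V)"
      using that openin_subtopology_Int2 by blast
    then have "openin (subtopology T (ran f)) ((\<lambda>x. the (f x)) ` (dom f \<inter> V))"
      using opn by (auto simp: open_map_def)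
    moreover have "(\<lambda>x. the (f x)) ` (dom f \<inter> V) = img f V"
      by (force simp: img_def dom_def)
    ultimately show ?thesis using r openin_trans_full by metis
  qed
  moreover have "x = x'" if "f x = Some y" "f x' = Some y" for x x' y
    using inj_onD[OF inj, of x x'] that by auto
  ultimately show ?R using openin_subset[OF d] openin_subset[OF r] by blast
next
  assume R: ?R
  have "preim f (topspace T) = dom f" "img f (topspace T) = ran f"
    using R by (auto simp: preim_def img_def dom_def ran_def)
  then have d: "openin T (dom f)" and r: "openin T (ran f)"
    using R openin_topspace by metis+
  have dt: "topspace (subtopology T (dom f)) = dom f" and rt: "topspace (subtopology T (ran f)) = ran f"
    using d r openin_subset by fastforce+
  have "homeomorphic_map (subtopology T (dom f)) (subtopology T (ran f)) (\<lambda>x. the (f x))"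
  proof (rule bijective_open_imp_homeomorphic_map)
    show "continuous_map (subtopology T (dom f)) (subtopology T (ran f)) (\<lambda>x. the (f x))"
    proof (rule continuous_map_into_subtopology)
      show "continuous_map (subtopology T (dom f)) T (\<lambda>x. the (f x))"
      proof (subst continuous_map, intro conjI allI impI)
        show "(\<lambda>x. the (f x)) ` topspace (subtopology T (dom f)) \<subseteq> topspace T"
          unfolding dt using R by (auto simp: ran_def)
        fix V assume "openin T V"
        moreover have "{x \<in> topspace (subtopology T (dom f)). the (f x) \<in> V} = preim f V"
          unfolding dt by (auto simp: preim_def dom_def)
        moreover have "preim f V \<subseteq> dom f" by (auto simp: preim_def)
        ultimately show "openin (subtopology T (dom f)) {x \<in> topspace (subtopology T (dom f)). the (f x) \<in> V}"
          using R d openin_open_subtopology by metis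
      qed
      show "(\<lambda>x. the (f x)) \<in> topspace (subtopology T (dom f)) \<rightarrow> ran f"
        unfolding dt by (auto simp: ran_def)
    qed
    show "open_map (subtopology T (dom f)) (subtopology T (ran f)) (\<lambda>x. the (f x))"
      unfolding open_map_def
    proof (intro allI impI)
      fix V assume "openin (subtopology T (dom f)) V"
      then have V: "openin T V" "V \<subseteq> dom f"
        using d openin_open_subtopology by blast+
      have "(\<lambda>x. the (f x)) ` V = img f V" using V(2) by (force simp: img_def dom_def)
      moreover have "img f V \<subseteq> ran f" by (auto simp: img_def ran_def)
      ultimately show "openin (subtopology T (ran f)) ((\<lambda>x. the (f x)) ` V)"
        using R V(1) r openin_open_subtopology by metis
    qed
    show "(\<lambda>x. the (f x)) ` topspace (subtopology T (dom f)) = topspace (subtopology T (ran f))"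
      unfolding dt rt by (force simp: dom_def ran_def)
    show "inj_on (\<lambda>x. the (f x)) (topspace (subtopology T (dom f)))"
      unfolding dt using R by (auto simp: inj_on_def)
  qed
  then show ?L using d r by (auto simp: Ph_def)
qed

lemma Ph_inj: "f \<in> Ph T \<Longrightarrow> f x = Some y \<Longrightarrow> f x' = Some y \<Longrightarrow> x = x'"
  by (simp add: Ph_iff)

lemma Ph_preim: "f \<in> Ph T \<Longrightarrow> openin T V \<Longrightarrow> openin T (preim f V)"
  by (simp add: Ph_iff)

lemma Ph_img: "f \<in> Ph T \<Longrightarrow> openin T V \<Longrightarrow> openin T (img f V)"
  by (simp add: Ph_iff)

lemma Ph_dom: "f \<in> Ph T \<Longrightarrow> openin T (dom f)"
  by (simp add: Ph_def)

lemma Ph_topspace: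
  assumes "f \<in> Ph T" "f x = Some y" shows "x \<in> topspace T" "y \<in> topspace T"
  using assms by (auto simp: Ph_iff dom_def ran_def)

lemma inv_Ph_iff:
  assumes "f \<in> Ph T" shows "inv_Ph f y = Some x \<longleftrightarrow> f x = Some y"
proof
  assume "inv_Ph f y = Some x"
  then obtain x' where "f x' = Some y" "(THE x. f x = Some y) = x"
    by (auto simp: inv_Ph_def ran_def split: if_splits)
  moreover have "(THE x. f x = Some y) = x'"
    using \<open>f x' = Some y\<close> Ph_inj[OF assms] by blast
  ultimately show "f x = Some y" by simp
next
  assume "f x = Some y"
  moreover have "(THE x. f x = Some y) = x"
    using \<open>f x = Some y\<close> Ph_inj[OF assms] by blast
  ultimately show "inv_Ph f y = Some x" by (auto simp: inv_Ph_def ran_def)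
qed

lemma inv_Ph_in_Ph:
  assumes "f \<in> Ph T" shows "inv_Ph f \<in> Ph T"
proof -
  note i = inv_Ph_iff[OF assms]
  have "preim (inv_Ph f) V = img f V" "img (inv_Ph f) V = preim f V" for V
    by (auto simp: preim_def img_def i)
  moreover have "dom (inv_Ph f) \<subseteq> topspace T" "ran (inv_Ph f) \<subseteq> topspace T"
    using Ph_topspace[OF assms] by (auto simp: dom_def ran_def i)
  ultimately show ?thesis unfolding Ph_iff using Ph_preim[OF assms] Ph_img[OF assms]
    by (auto simp: i)
qed

lemma comp_in_Ph:
  assumes "f \<in> Ph T" "g \<in> Ph T" shows "g \<circ>\<^sub>m f \<in> Ph T"
proof -
  have "preim (g \<circ>\<^sub>m f) V = preim f (preim g V)" "img (g \<circ>\<^sub>m f) V = img g (img f V)" for V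
    by (auto simp: preim_def img_def map_comp_Some_iff)
  moreover have "dom (g \<circ>\<^sub>m f) \<subseteq> topspace T" "ran (g \<circ>\<^sub>m f) \<subseteq> topspace T"
    using Ph_topspace[OF assms(1)] Ph_topspace[OF assms(2)]
    by (auto simp: dom_def ran_def map_comp_Some_iff)
  moreover have "x = x'" if "(g \<circ>\<^sub>m f) x = Some y" "(g \<circ>\<^sub>m f) x' = Some y" for x x' y
    using that Ph_inj[OF assms(1)] Ph_inj[OF assms(2)] unfolding map_comp_Some_iff by metis
  ultimately show ?thesis unfolding Ph_iff
    using Ph_preim[OF assms(1)] Ph_img[OF assms(1)] Ph_preim[OF assms(2)] Ph_img[OF assms(2)]
    by auto
qed

lemma restrict_map_Some_iff: "(f |` V) x = Some y \<longleftrightarrow> x \<in> V \<and> f x = Some y"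
  by (simp add: restrict_map_def)

lemma id_Ph_iff: "id_Ph T x = Some y \<longleftrightarrow> x \<in> topspace T \<and> y = x"
  by (auto simp: id_Ph_def restrict_map_Some_iff)

lemma restrict_in_Ph:
  assumes "f \<in> Ph T" "openin T W" shows "f |` W \<in> Ph T"
proof -
  have "preim (f |` W) V = W \<inter> preim f V" "img (f |` W) V = img f (W \<inter> V)" for V
    by (auto simp: preim_def img_def restrict_map_Some_iff)
  moreover have "dom (f |` W) \<subseteq> topspace T" "ran (f |` W) \<subseteq> topspace T"
    using Ph_topspace[OF assms(1)] by (auto simp: dom_def ran_def restrict_map_Some_iff)
  ultimately show ?thesis unfolding Ph_iff
    using Ph_preim[OF assms(1)] Ph_img[OF assms(1)] Ph_inj[OF assms(1)] assms(2)
    by (auto simp: restrict_map_Some_iff openin_Int)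
qed

lemma id_in_Ph: "id_Ph T \<in> Ph T"
proof -
  have "preim (id_Ph T) V = topspace T \<inter> V" "img (id_Ph T) V = topspace T \<inter> V" for V
    by (auto simp: preim_def img_def id_Ph_iff)
  then show ?thesis unfolding Ph_iff by (auto simp: dom_def ran_def id_Ph_iff openin_Int)
qed

lemma compactin_img:
  assumes f: "f \<in> Ph T" and C: "compactin T C" "C \<subseteq> dom f"
  shows "compactin T (img f C)"
proof -
  have h: "homeomorphic_map (subtopology T (dom f)) (subtopology T (ran f)) (\<lambda>x. the (f x))"
    using f by (simp add: Ph_def)
  have "compactin (subtopology T (dom f)) C" using C by (simp add: compactin_subtopology)
  then have "compactin (subtopology T (ran f)) ((\<lambda>x. the (f x)) ` C)"
    using homeomorphic_imp_continuous_map[OF h] image_compactin by blast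
  moreover have "(\<lambda>x. the (f x)) ` C = img f C"
    using C(2) by (force simp: img_def dom_def)
  ultimately show ?thesis by (simp add: compactin_subtopology)
qed

section \<open>Pseudogroups and generating sets\<close>

lemma pseudogroup_Ph: "pseudogroup T (Ph T)"
  by (simp add: pseudogroup_def pseudo_star_group_def id_in_Ph inv_Ph_in_Ph comp_in_Ph restrict_in_Ph)

lemma pseudo_star_groupD:
  assumes "pseudo_star_group T S"
  shows "S \<subseteq> Ph T" "id_Ph T \<in> S" "f \<in> S \<Longrightarrow> inv_Ph f \<in> S"
    "f \<in> S \<Longrightarrow> g \<in> S \<Longrightarrow> g \<circ>\<^sub>m f \<in> S"
  using assms by (auto simp: pseudo_star_group_def)

lemma restrict_map_Int_dom: "f |` (V \<inter> dom f) = f |` V"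
  by (auto simp: restrict_map_def fun_eq_iff)

lemma pseudo_star_group_restrict:
  assumes "pseudo_star_group T S" "f \<in> S" "openin T V" shows "f |` V \<in> S"
proof -
  have "f \<in> Ph T" using assms by (auto simp: pseudo_star_group_def)
  then have "openin T (V \<inter> dom f)" using assms(3) by (simp add: Ph_def openin_Int)
  then have "f |` (V \<inter> dom f) \<in> S" using assms by (auto simp: pseudo_star_group_def)
  then show ?thesis by (simp add: restrict_map_Int_dom)
qed

lemma pseudo_star_group_hull:
  assumes "S \<subseteq> Ph T" shows "pseudo_star_group T (star T S)"
proof -
  have "pseudo_star_group T (Ph T)" using pseudogroup_Ph[of T] by (simp add: pseudogroup_def)
  then show ?thesis using assms
    unfolding star_def hull_def
    apply (subst pseudo_star_group_def)
    apply (intro conjI ballI allI impI)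
    subgoal by blast
    by (auto simp: pseudo_star_group_def)
qed

lemma pseudogroup_hull:
  assumes "S \<subseteq> Ph T" shows "pseudogroup T (generated_pseudogroup T S)"
  unfolding pseudogroup_def
proof (intro conjI ballI impI)
  have "pseudogroup T (Ph T)" by (rule pseudogroup_Ph)
  then show "pseudo_star_group T (generated_pseudogroup T S)" using assms
    unfolding generated_pseudogroup_def hull_def
    apply (subst pseudo_star_group_def)
    apply (intro conjI ballI allI impI)
    subgoal by blast
    by (auto simp: pseudo_star_group_def pseudogroup_def)
next
  fix f assume f: "f \<in> Ph T" and
    loc: "\<forall>x\<in>dom f. \<exists>V. openin T V \<and> x \<in> V \<and> V \<subseteq> dom f \<and> f |` V \<in> generated_pseudogroup T S"
  show "f \<in> generated_pseudogroup T S"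
    unfolding generated_pseudogroup_def hull_def
  proof (intro InterI, clarify)
    fix P assume P: "pseudogroup T P" "S \<subseteq> P"
    then have "generated_pseudogroup T S \<subseteq> P"
      by (auto simp: generated_pseudogroup_def hull_def)
    then have "\<forall>x\<in>dom f. \<exists>V. openin T V \<and> x \<in> V \<and> V \<subseteq> dom f \<and> f |` V \<in> P"
      using loc subsetD by meson
    then show "f \<in> P" using P f by (auto simp: pseudogroup_def)
  qed
qed

lemma restrict_in_domain:
  assumes f: "f \<in> Ph T" "x \<in> dom f" and V: "openin T V" "x \<in> V" "f |` V \<in> S"
  shows "\<exists>V. openin T V \<and> x \<in> V \<and> V \<subseteq> dom f \<and> f |` V \<in> S"
proof -
  have "f |` (V \<inter> dom f) \<in> S" using V(3) by (simp add: restrict_map_Int_dom)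
  moreover have "openin T (V \<inter> dom f)" using V(1) Ph_dom[OF f(1)] by blast
  ultimately show ?thesis using f(2) V(2) by blast
qed

lemma pseudogroup_localI:
  assumes "pseudogroup T G" "f \<in> Ph T"
    and "\<And>x y. f x = Some y \<Longrightarrow> \<exists>V. openin T V \<and> x \<in> V \<and> f |` V \<in> G"
  shows "f \<in> G"
proof -
  have "\<exists>V. openin T V \<and> x \<in> V \<and> V \<subseteq> dom f \<and> f |` V \<in> G" if "x \<in> dom f" for x
  proof -
    obtain V where V: "openin T V" "x \<in> V" "f |` V \<in> G"
      using assms(3) \<open>x \<in> dom f\<close> by blast
    then show ?thesis by (rule restrict_in_domain[OF assms(2) \<open>x \<in> dom f\<close>])
  qed
  then show ?thesis using assms(1,2) by (auto simp: pseudogroup_def)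
qed

text \<open>Being locally in a pseudo-*-group is again closed under all operations, so closing a
pseudo-*-group under gluing takes a single step. This gives the local description of a generated
pseudogroup that follows.\<close>

lemma pseudogroup_of_local:
  assumes S: "pseudo_star_group T S"
  defines "L \<equiv> {f \<in> Ph T. \<forall>x\<in>dom f. \<exists>V. openin T V \<and> x \<in> V \<and> V \<subseteq> dom f \<and> f |` V \<in> S}"
  shows "pseudogroup T L"
proof -
  note SP = pseudo_star_groupD(1)[OF S]
  have LI: "f \<in> L" if f: "f \<in> Ph T" and
     loc: "\<And>x y. f x = Some y \<Longrightarrow> \<exists>V. openin T V \<and> x \<in> V \<and> f |` V \<in> S" for f
  proof -
    have "\<exists>V. openin T V \<and> x \<in> V \<and> V \<subseteq> dom f \<and> f |` V \<in> S" if x: "x \<in> dom f" for x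
    proof -
      obtain V where V: "openin T V" "x \<in> V" "f |` V \<in> S" using loc x by blast
      then show ?thesis by (rule restrict_in_domain[OF f x])
    qed
    then show ?thesis by (simp add: L_def f)
  qed
  have LD: "\<exists>V. openin T V \<and> x \<in> V \<and> f |` V \<in> S" if "f \<in> L" "f x = Some y" for f x y
    using that unfolding L_def by blast
  have LP: "f \<in> Ph T" if "f \<in> L" for f using that by (simp add: L_def)
  have "f \<in> L" if "f \<in> S" for f
  proof (rule LI)
    show "f \<in> Ph T" using that SP by blast
    then show "\<exists>V. openin T V \<and> x \<in> V \<and> f |` V \<in> S" if "f x = Some y" for x y
      using that \<open>f \<in> S\<close> Ph_dom pseudo_star_group_restrict[OF S] by (metis domI)
  qed
  then have "S \<subseteq> L" by blast
  show ?thesis unfolding pseudogroup_def pseudo_star_group_def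
  proof (intro conjI ballI allI impI)
    show "L \<subseteq> Ph T" using LP by blast
    show "id_Ph T \<in> L" using \<open>S \<subseteq> L\<close> S by (auto simp: pseudo_star_group_def)
  next
    fix f assume f: "f \<in> L"
    note fP = LP[OF f]
    show "inv_Ph f \<in> L"
    proof (rule LI[OF inv_Ph_in_Ph[OF fP]])
      fix y x assume "inv_Ph f y = Some x"
      then have xy: "f x = Some y" by (simp add: inv_Ph_iff[OF fP])
      obtain V where V: "openin T V" "x \<in> V" "f |` V \<in> S" using LD[OF f xy] by blast
      have "(inv_Ph f |` img f V) b = Some a \<longleftrightarrow> inv_Ph (f |` V) b = Some a" for a b
        unfolding restrict_map_Some_iff inv_Ph_iff[OF fP] img_def
            inv_Ph_iff[OF restrict_in_Ph[OF fP V(1)]] mem_Collect_eq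
        using Ph_inj[OF fP] by metis
      then have "inv_Ph f |` img f V = inv_Ph (f |` V)"
        by (intro ext) (metis not_None_eq)
      moreover have "inv_Ph (f |` V) \<in> S" using V(3) S by (simp add: pseudo_star_groupD)
      moreover have "y \<in> img f V" using V xy by (auto simp: img_def)
      ultimately show "\<exists>V. openin T V \<and> y \<in> V \<and> inv_Ph f |` V \<in> S"
        using Ph_img[OF fP V(1)] by metis
    qed
  next
    fix f g assume f: "f \<in> L" and g: "g \<in> L"
    note fP = LP[OF f] and gP = LP[OF g]
    show "g \<circ>\<^sub>m f \<in> L"
    proof (rule LI[OF comp_in_Ph[OF fP gP]])
      fix x z assume "(g \<circ>\<^sub>m f) x = Some z"
      then obtain y where y: "f x = Some y" "g y = Some z" by (auto simp: map_comp_Some_iff)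
      obtain V where V: "openin T V" "x \<in> V" "f |` V \<in> S" using LD[OF f y(1)] by blast
      obtain W where W: "openin T W" "y \<in> W" "g |` W \<in> S" using LD[OF g y(2)] by blast
      have "((g \<circ>\<^sub>m f) |` (V \<inter> preim f W)) a = Some b \<longleftrightarrow> ((g |` W) \<circ>\<^sub>m (f |` V)) a = Some b" for a b
        by (auto simp: restrict_map_Some_iff map_comp_Some_iff preim_def)
      then have "(g \<circ>\<^sub>m f) |` (V \<inter> preim f W) = (g |` W) \<circ>\<^sub>m (f |` V)"
        by (intro ext) (metis not_None_eq)
      moreover have "(g |` W) \<circ>\<^sub>m (f |` V) \<in> S" using V(3) W(3) S by (simp add: pseudo_star_groupD)
      moreover have "x \<in> V \<inter> preim f W" using V W y by (auto simp: preim_def)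
      moreover have "openin T (V \<inter> preim f W)" using V W Ph_preim[OF fP] by blast
      ultimately show "\<exists>V. openin T V \<and> x \<in> V \<and> (g \<circ>\<^sub>m f) |` V \<in> S" by metis
    qed
  next
    fix f W assume f: "f \<in> L" and W: "openin T W \<and> W \<subseteq> dom f"
    note fP = LP[OF f]
    show "f |` W \<in> L"
    proof (rule LI)
      show "f |` W \<in> Ph T" using fP W restrict_in_Ph by blast
      fix x y assume "(f |` W) x = Some y"
      then have xy: "x \<in> W" "f x = Some y" by (auto simp: restrict_map_Some_iff)
      obtain V where V: "openin T V" "x \<in> V" "f |` V \<in> S" using LD[OF f xy(2)] by blast
      have "(f |` W) |` (W \<inter> V) = (f |` V) |` W" by (auto simp: restrict_map_def fun_eq_iff)
      moreover have "(f |` V) |` W \<in> S" using V W pseudo_star_group_restrict[OF S] by blast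
      ultimately show "\<exists>V. openin T V \<and> x \<in> V \<and> f |` W |` V \<in> S"
        using xy V W openin_Int by (metis IntI)
    qed
  next
    fix f assume f: "f \<in> Ph T" and loc: "\<forall>x\<in>dom f. \<exists>V. openin T V \<and> x \<in> V \<and> V \<subseteq> dom f \<and> f |` V \<in> L"
    show "f \<in> L"
    proof (rule LI[OF f])
      fix x y assume xy: "f x = Some y"
      then obtain V where V: "openin T V" "x \<in> V" "V \<subseteq> dom f" "f |` V \<in> L" using loc by blast
      have "(f |` V) x = Some y" using xy V by simp
      from LD[OF V(4) this] obtain W where W: "openin T W" "x \<in> W" "f |` V |` W \<in> S" by blast
      then show "\<exists>V. openin T V \<and> x \<in> V \<and> f |` V \<in> S"
        using V by (intro exI[of _ "V \<inter> W"]) auto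
    qed
  qed
qed

lemma locally_in_generating_set:
  assumes S: "pseudo_star_group T S" and gen: "generates T S G" and g: "g \<in> G" "g x = Some y"
  shows "\<exists>V. openin T V \<and> x \<in> V \<and> V \<subseteq> dom g \<and> g |` V \<in> S"
proof -
  let ?L = "{f \<in> Ph T. \<forall>x\<in>dom f. \<exists>V. openin T V \<and> x \<in> V \<and> V \<subseteq> dom f \<and> f |` V \<in> S}"
  have "S \<subseteq> ?L"
  proof
    fix f assume "f \<in> S"
    then have "f \<in> Ph T" using S by (auto simp: pseudo_star_group_def)
    moreover have "f |` dom f \<in> S" using \<open>f \<in> S\<close> S Ph_dom[OF \<open>f \<in> Ph T\<close>] pseudo_star_group_restrict by blast
    ultimately show "f \<in> ?L" using Ph_dom by blast
  qed
  then have "G \<subseteq> ?L"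
    using gen pseudogroup_of_local[OF S] hull_minimal[of S ?L "pseudogroup T"]
    by (auto simp: generates_def generated_pseudogroup_def)
  then show ?thesis using g by blast
qed

lemma star_eq: "pseudo_star_group T S \<Longrightarrow> star T S = S"
  by (simp add: star_def hull_same)

text \<open>A pseudogroup contains \<open>S\<close> if and only if it contains the pseudo-*-group generated by \<open>S\<close>.\<close>

lemma generates_star:
  assumes "generates T S G" "S \<subseteq> Ph T"
  shows "generates T (star T S) G"
proof -
  have G: "pseudogroup T G" using assms pseudogroup_hull by (auto simp: generates_def)
  have 1: "star T S \<subseteq> P" if "pseudogroup T P" "S \<subseteq> P" for P
    using that by (auto simp: star_def pseudogroup_def intro: hull_minimal[THEN subsetD])
  have 2: "S \<subseteq> star T S" by (simp add: star_def hull_subset)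
  have "generated_pseudogroup T (star T S) = generated_pseudogroup T S"
    unfolding generated_pseudogroup_def hull_def using 1 2 by (intro arg_cong[where f=Inter]) blast
  then show ?thesis using 1[OF G] assms by (auto simp: generates_def)
qed

section \<open>Compatible metrics and Lebesgue numbers\<close>

definition eball :: "'z topology \<Rightarrow> ('z \<Rightarrow> 'z \<Rightarrow> ennreal) \<Rightarrow> 'z \<Rightarrow> real \<Rightarrow> 'z set" where
  "eball T d x r = {y \<in> topspace T. d x y < ennreal r}"

lemma compatible_metricD:
  assumes "compatible_metric T d"
  shows "x \<in> topspace T \<Longrightarrow> d x x = 0"
    "x \<in> topspace T \<Longrightarrow> y \<in> topspace T \<Longrightarrow> d x y = d y x"
    "x \<in> topspace T \<Longrightarrow> y \<in> topspace T \<Longrightarrow> z \<in> topspace T \<Longrightarrow> d x z \<le> d x y + d y z"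
  using assms unfolding compatible_metric_def ext_metric_on_def by blast+

lemma compatible_metric_triangle_less:
  assumes "compatible_metric T d" "x \<in> topspace T" "y \<in> topspace T" "z \<in> topspace T"
    "d x y < ennreal a" "d y z < ennreal b"
  shows "d x z < ennreal (a + b)"
proof -
  have "a > 0" "b > 0" using assms(5,6) by (metis ennreal_eq_0_iff not_le not_less_zero)+
  have "d x z \<le> d x y + d y z" using compatible_metricD(3)[OF assms(1)] assms(2-4) by blast
  also have "\<dots> < ennreal a + ennreal b" using assms(5,6) by (rule add_strict_mono)
  also have "\<dots> = ennreal (a + b)" using \<open>a > 0\<close> \<open>b > 0\<close> by simp
  finally show ?thesis .
qed

lemma openin_eball:
  assumes "compatible_metric T d" "x \<in> topspace T" "r > 0"
  shows "openin T (eball T d x r)"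
proof -
  have T: "T = topology_generated_by
           {{y \<in> topspace T. d x y < ennreal r} | x r. x \<in> topspace T \<and> 0 < r}"
    using assms by (simp add: compatible_metric_def)
  have "eball T d x r \<in> {{y \<in> topspace T. d x y < ennreal r} | x r. x \<in> topspace T \<and> 0 < r}"
    unfolding eball_def using assms by blast
  from topology_generated_by_Basis[OF this] show ?thesis by (simp only: T[symmetric])
qed

lemma centre_in_eball: "compatible_metric T d \<Longrightarrow> x \<in> topspace T \<Longrightarrow> r > 0 \<Longrightarrow> x \<in> eball T d x r"
  by (simp add: eball_def compatible_metricD ennreal_less_zero_iff)

lemma eball_shrink:
  assumes d: "compatible_metric T d" and x: "x \<in> topspace T" and y: "y \<in> eball T d x r"
  shows "\<exists>\<rho>>0. eball T d y \<rho> \<subseteq> eball T d x r"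
proof -
  have yT: "y \<in> topspace T" and l: "d x y < ennreal r" using y by (auto simp: eball_def)
  obtain a where a: "d x y = ennreal a" "a \<ge> 0"
    using l that[of "enn2real (d x y)"] ennreal_enn2real[of "d x y"] less_trans[OF l ennreal_less_top] by simp
  then have "a < r" using l by (simp add: ennreal_less_iff)
  have "eball T d y (r - a) \<subseteq> eball T d x r"
  proof
    fix z assume "z \<in> eball T d y (r - a)"
    then have z: "z \<in> topspace T" "d y z < ennreal (r - a)" by (auto simp: eball_def)
    have "d x z \<le> ennreal a + d y z" using compatible_metricD(3)[OF d x yT z(1)] a by simp
    also have "\<dots> < ennreal a + ennreal (r - a)" using z(2) by (intro ennreal_add_left_cancel_less[THEN iffD2]) auto
    also have "\<dots> = ennreal r" using \<open>a < r\<close> a(2) by (simp flip: ennreal_plus)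
    finally show "z \<in> eball T d x r" using z by (simp add: eball_def)
  qed
  then show ?thesis using \<open>a < r\<close> by (intro exI[of _ "r - a"]) auto
qed

lemma eball_mono: "r \<le> r' \<Longrightarrow> eball T d x r \<subseteq> eball T d x r'"
  using ennreal_leI[of r r'] by (auto simp: eball_def)

lemma openin_contains_eball:
  assumes d: "compatible_metric T d" and V: "openin T V" and x: "x \<in> V"
  shows "\<exists>r>0. eball T d x r \<subseteq> V"
proof -
  let ?B = "{{y \<in> topspace T. d x y < ennreal r} | x r. x \<in> topspace T \<and> 0 < r}"
  have T: "T = topology_generated_by ?B"
    using d by (simp add: compatible_metric_def)
  have "openin (topology_generated_by ?B) V" using V by (simp only: T[symmetric])
  then have "generate_topology_on ?B V" by (rule openin_topology_generated_by)
  then have "\<forall>x\<in>V. \<exists>r>0. eball T d x r \<subseteq> V"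
  proof induction
    case Empty then show ?case by simp
  next
    case (Int a b)
    show ?case
    proof
      fix x assume "x \<in> a \<inter> b"
      then obtain r s where rs: "r > 0" "eball T d x r \<subseteq> a" "s > 0" "eball T d x s \<subseteq> b" using Int by blast
      have "eball T d x (min r s) \<subseteq> eball T d x r" "eball T d x (min r s) \<subseteq> eball T d x s"
        by (intro eball_mono; simp)+
      then show "\<exists>r>0. eball T d x r \<subseteq> a \<inter> b" using rs
        by (intro exI[of _ "min r s"]) auto
    qed
  next
    case (UN K)
    then show ?case by (meson Union_iff Union_upper order_trans)
  next
    case (Basis s)
    then obtain z r where s: "s = eball T d z r" "z \<in> topspace T" by (auto simp: eball_def)
    show ?case unfolding s(1) using eball_shrink[OF d s(2)] by blast
  qed
  then show ?thesis using x by blast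
qed

text \<open>The usual argument, for a metric with values in \<open>[0, \<infinity>]\<close>. Each point of \<open>K\<close> must lie in some open
member of \<open>\<V>\<close>, while other members may be arbitrary; this suits families described by a property.\<close>

lemma Lebesgue_number:
  assumes d: "compatible_metric T d" and K: "compactin T K"
    and cover: "\<And>y. y \<in> K \<Longrightarrow> \<exists>V\<in>\<V>. openin T V \<and> y \<in> V"
  shows "\<exists>\<delta>>0. \<forall>y\<in>K. \<exists>V\<in>\<V>. eball T d y \<delta> \<subseteq> V"
proof -
  have KT: "K \<subseteq> topspace T" using K compactin_subset_topspace by blast
  have "\<forall>y\<in>K. \<exists>r. r > 0 \<and> (\<exists>V\<in>\<V>. eball T d y (r + r) \<subseteq> V)"
  proof
    fix y assume "y \<in> K"
    then obtain V r where "V \<in> \<V>" "r > 0" "eball T d y r \<subseteq> V"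
      using cover openin_contains_eball[OF d] by meson
    then show "\<exists>r. r > 0 \<and> (\<exists>V\<in>\<V>. eball T d y (r + r) \<subseteq> V)"
      by (intro exI[of _ "r/2"]) auto
  qed
  then obtain r where r: "\<And>y. y \<in> K \<Longrightarrow> r y > 0" "\<And>y. y \<in> K \<Longrightarrow> \<exists>V\<in>\<V>. eball T d y (r y + r y) \<subseteq> V"
    by metis
  have "\<forall>B\<in>(\<lambda>y. eball T d y (r y)) ` K. openin T B" using openin_eball[OF d] r KT by blast
  moreover have "K \<subseteq> \<Union>((\<lambda>y. eball T d y (r y)) ` K)"
  proof
    fix y assume y: "y \<in> K"
    then have "y \<in> eball T d y (r y)" using KT by (intro centre_in_eball[OF d] r(1)) auto
    then show "y \<in> \<Union>((\<lambda>y. eball T d y (r y)) ` K)" using y by (rule UN_I[rotated])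
  qed
  ultimately obtain \<F> where \<F>: "finite \<F>" "\<F> \<subseteq> (\<lambda>y. eball T d y (r y)) ` K" "K \<subseteq> \<Union>\<F>"
    using K unfolding compactin_def by meson
  then obtain A where A: "A \<subseteq> K" "finite A" "\<F> = (\<lambda>y. eball T d y (r y)) ` A"
    by (meson finite_subset_image)
  \<comment> \<open>The 1 keeps the minimum defined when the finite set is empty.\<close>
  define \<delta> where "\<delta> = Min (insert 1 (r ` A))"
  have \<delta>: "\<delta> > 0" "\<And>a. a \<in> A \<Longrightarrow> \<delta> \<le> r a" using A r by (auto simp: \<delta>_def)
  have "\<exists>V\<in>\<V>. eball T d y \<delta> \<subseteq> V" if "y \<in> K" for y
  proof -
    have "y \<in> \<Union>((\<lambda>y. eball T d y (r y)) ` A)" using \<F>(3) A(3) that by auto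
    then obtain a where a: "a \<in> A" "y \<in> eball T d a (r a)" by blast
    obtain V where V: "V \<in> \<V>" "eball T d a (r a + r a) \<subseteq> V" using r(2) a A by blast
    have "eball T d y \<delta> \<subseteq> eball T d a (r a + r a)"
    proof
      fix z assume "z \<in> eball T d y \<delta>"
      then have "z \<in> eball T d y (r a)" by (rule subsetD[OF eball_mono[OF \<delta>(2)[OF a(1)]]])
      then show "z \<in> eball T d a (r a + r a)"
        using compatible_metric_triangle_less[OF d, of a y z "r a" "r a"] a A KT that
        by (auto simp: eball_def)
    qed
    then show ?thesis using V by blast
  qed
  then show ?thesis using \<delta>(1) by blast
qed

lemma compact_neighbourhood:
  assumes "locally_compact_space X" "Hausdorff_space X" "openin X V" "x \<in> V"
  obtains Y C where "openin X Y" "compactin X C" "x \<in> Y" "Y \<subseteq> C" "C \<subseteq> V"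
proof -
  have "neighbourhood_base_of (compactin X) X"
    using locally_compact_space_neighbourhood_base[of X] assms(1,2) by simp
  then have "\<exists>Y C. openin X Y \<and> compactin X C \<and> x \<in> Y \<and> Y \<subseteq> C \<and> C \<subseteq> V"
    using assms(3,4) unfolding neighbourhood_base_of by simp
  then show thesis using that by blast
qed

section \<open>Sensitivity excludes equicontinuity\<close>

lemma sensitive_not_almost_equicontinuous:
  assumes G: "G \<subseteq> Ph T" and ne: "topspace T \<noteq> {}" and sens: "sensitive T G"
  shows "\<not> almost_equicontinuous T G"
proof
  assume "almost_equicontinuous T G"
  then obtain S d where S: "generates T S G" and d: "compatible_metric T d"
    and cl: "T closure_of {x \<in> topspace T. equicontinuous_point T S d x} = topspace T"
    unfolding almost_equicontinuous_def by blast
  have "S \<subseteq> Ph T" using S G by (auto simp: generates_def)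
  then have star: "pseudo_star_group T (star T S)" "generates T (star T S) G"
    by (rule pseudo_star_group_hull, rule generates_star[OF S])
  from sens[unfolded sensitive_def, THEN spec, THEN spec, THEN mp, OF conjI[OF d conjI[OF star]]]
  obtain c :: real where c: "c > 0" and sc: "\<forall>x\<in>topspace T. \<forall>r::real. r > 0 \<longrightarrow>
              (\<exists>s\<in>star T S. \<exists>y. x \<in> dom s \<and> y \<in> dom s \<and> d x y < ennreal r \<and>
                 d (the (s x)) (the (s y)) \<ge> ennreal c)" by blast
  have "{x \<in> topspace T. equicontinuous_point T S d x} \<noteq> {}"
  proof
    assume "{x \<in> topspace T. equicontinuous_point T S d x} = {}"
    then show False using cl ne by (simp only: closure_of_empty)
  qed
  then obtain x where x: "x \<in> topspace T" "equicontinuous_point T S d x" by blast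
  obtain \<delta> :: real where \<delta>: "\<delta> > 0" "\<forall>s\<in>star T S. \<forall>y. x \<in> dom s \<and> y \<in> dom s \<and> d x y < ennreal \<delta> \<longrightarrow>
           d (the (s x)) (the (s y)) < ennreal c"
    using x(2) c unfolding equicontinuous_point_def by blast
  obtain s y where "s \<in> star T S" "x \<in> dom s" "y \<in> dom s" "d x y < ennreal \<delta>"
       "d (the (s x)) (the (s y)) \<ge> ennreal c"
    using sc x(1) \<delta>(1) by blast
  then show False using \<delta>(2) by (meson not_less)
qed

lemma equicontinuous_imp_almost_equicontinuous:
  assumes "equicontinuous T G" shows "almost_equicontinuous T G"
proof -
  obtain S d and \<delta> :: "real \<Rightarrow> real" where S: "pseudo_star_group T S" "generates T S G" and d: "compatible_metric T d"
    and \<delta>: "\<forall>\<epsilon>>0. \<delta> \<epsilon> > 0" "\<forall>\<epsilon>>0. \<forall>s\<in>S. \<forall>x\<in>dom s. \<forall>y\<in>dom s.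
           d x y < ennreal (\<delta> \<epsilon>) \<longrightarrow> d (the (s x)) (the (s y)) < ennreal \<epsilon>"
    using assms unfolding equicontinuous_def by blast
  have "equicontinuous_point T S d x" for x
    unfolding equicontinuous_point_def star_eq[OF S(1)]
  proof (intro allI impI)
    fix \<epsilon> :: real assume "\<epsilon> > 0"
    then show "\<exists>\<delta>>0. \<forall>s\<in>S. \<forall>y. x \<in> dom s \<and> y \<in> dom s \<and> d x y < ennreal \<delta> \<longrightarrow>
           d (the (s x)) (the (s y)) < ennreal \<epsilon>"
      using \<delta> by (intro exI[of _ "\<delta> \<epsilon>"]) blast
  qed
  then have "T closure_of {x \<in> topspace T. equicontinuous_point T S d x} = topspace T" by simp
  then show ?thesis unfolding almost_equicontinuous_def using S(2) d by blast
qed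

section \<open>Words in a set of letters\<close>

inductive_set words :: "'z topology \<Rightarrow> ('z \<rightharpoonup> 'z) set \<Rightarrow> ('z \<rightharpoonup> 'z) set"
  for T L where
  empty_word: "id_Ph T \<in> words T L"
| letter_word: "b \<in> words T L \<Longrightarrow> l \<in> L \<Longrightarrow> l \<circ>\<^sub>m b \<in> words T L"

lemma words_subset:
  assumes "pseudo_star_group T S" "L \<subseteq> S" shows "words T L \<subseteq> S"
proof
  fix b assume "b \<in> words T L"
  then show "b \<in> S" using assms by induction (auto dest: pseudo_star_groupD)
qed

text \<open>A word that extends the composite serves as well as one that equals it, since words are only
applied where they are known to be defined.\<close>

lemma words_comp:
  assumes "L \<subseteq> Ph T" "b \<in> words T L" "c \<in> words T L"
  obtains e where "e \<in> words T L" "\<And>x y z. b x = Some y \<Longrightarrow> c y = Some z \<Longrightarrow> e x = Some z"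
proof -
  have "\<exists>e\<in>words T L. \<forall>x y z. b x = Some y \<longrightarrow> c y = Some z \<longrightarrow> e x = Some z"
    using assms(3)
  proof induction
    case empty_word
    then show ?case using assms(2) by (intro bexI[of _ b]) (auto simp: id_Ph_iff)
  next
    case (letter_word c l)
    then obtain e where e: "e \<in> words T L" "\<forall>x y z. b x = Some y \<longrightarrow> c y = Some z \<longrightarrow> e x = Some z"
      by blast
    then have "l \<circ>\<^sub>m e \<in> words T L" using letter_word words.letter_word by blast
    then show ?case using e(2) by (intro bexI[of _ "l \<circ>\<^sub>m e"]) (fastforce simp: map_comp_Some_iff)+
  qed
  then obtain e where "e \<in> words T L" "\<forall>x y z. b x = Some y \<longrightarrow> c y = Some z \<longrightarrow> e x = Some z" by blast
  then show thesis by (intro that[of e]) simp_all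
qed

lemma letter_in_words:
  assumes "L \<subseteq> Ph T" "l \<in> L"
  obtains b where "b \<in> words T L" "\<And>x y. l x = Some y \<Longrightarrow> b x = Some y"
proof (rule that)
  show "l \<circ>\<^sub>m id_Ph T \<in> words T L" using words.letter_word[OF words.empty_word assms(2)] .
  fix x y assume xy: "l x = Some y"
  have "x \<in> topspace T" using Ph_topspace(1)[OF subsetD[OF assms] xy] .
  then show "(l \<circ>\<^sub>m id_Ph T) x = Some y" using xy by (simp add: map_comp_Some_iff id_Ph_iff)
qed

lemma words_inverse:
  assumes L: "L \<subseteq> Ph T" "\<And>l. l \<in> L \<Longrightarrow> inv_Ph l \<in> L" and b: "b \<in> words T L"
  obtains b' where "b' \<in> words T L" "\<And>x y. b x = Some y \<Longrightarrow> b' y = Some x"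
proof -
  have "\<exists>b'\<in>words T L. \<forall>x y. b x = Some y \<longrightarrow> b' y = Some x"
    using b
  proof induction
    case empty_word
    then show ?case using words.empty_word by (intro bexI[of _ "id_Ph T"]) (auto simp: id_Ph_iff)
  next
    case (letter_word b l)
    then obtain b' where b': "b' \<in> words T L" "\<forall>x y. b x = Some y \<longrightarrow> b' y = Some x" by blast
    obtain a where a: "a \<in> words T L" "\<And>x y. inv_Ph l x = Some y \<Longrightarrow> a x = Some y"
      by (rule letter_in_words[OF L(1) L(2)[OF letter_word.hyps(2)]]) (rule that, assumption, simp)
    obtain e where e: "e \<in> words T L" "\<And>x y z. a x = Some y \<Longrightarrow> b' y = Some z \<Longrightarrow> e x = Some z"
      by (rule words_comp[OF L(1) a(1) b'(1)]) (rule that; blast)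
    have "e y = Some x" if lb: "(l \<circ>\<^sub>m b) x = Some y" for x y
    proof -
      obtain u where u: "b x = Some u" "l u = Some y" using lb by (auto simp: map_comp_Some_iff)
      have "inv_Ph l y = Some u" using u(2) inv_Ph_iff[OF subsetD[OF L(1) letter_word.hyps(2)]] by simp
      then show ?thesis using a(2) e(2) b'(2) u(1) by blast
    qed
    then show ?case using e(1) by blast
  qed
  then obtain b' where "b' \<in> words T L" "\<forall>x y. b x = Some y \<longrightarrow> b' y = Some x" by blast
  then show thesis by (intro that[of b']) simp_all
qed

section \<open>Pseudogroups generated through finitely many letters\<close>

text \<open>The data that compactness of \<open>X\<close> provides. The letters \<open>L\<close> are finitely many restrictions of maps
of \<open>G\<close>, each of which is defined on a compact set containing the domain of the letter. The return maps \<open>\<Gamma>\<close> cover the space, and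
changing from one to another is done by a word. Every generator in \<open>H\<close> is locally \<open>\<gamma>'\<^sup>-\<^sup>1 b \<gamma>\<close> with
return maps \<open>\<gamma>\<close> and \<open>\<gamma>'\<close> and a word \<open>b\<close>; this is the factorisation assumption, written
without inverses.\<close>

locale transversal_system =
  fixes T :: "'z topology" and G H L \<Gamma> :: "('z \<rightharpoonup> 'z) set"
  assumes locally_compact: "locally_compact_space T"
    and Hausdorff: "Hausdorff_space T"
    and sigma_compact: "\<exists>K::nat \<Rightarrow> 'z set. (\<forall>m. compactin T (K m)) \<and> topspace T \<subseteq> (\<Union>m. K m)"
    and H_Ph: "H \<subseteq> Ph T"
    and G_eq: "G = generated_pseudogroup T H"
    and finite_L: "finite L"
    and L_Ph: "L \<subseteq> Ph T"
    and L_inverse: "l \<in> L \<Longrightarrow> inv_Ph l \<in> L"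
    and L_extension: "l \<in> L \<Longrightarrow> \<exists>g\<in>G. \<exists>K. compactin T K \<and> dom l \<subseteq> K \<and> K \<subseteq> dom g \<and> l \<subseteq>\<^sub>m g"
    and \<Gamma>_G: "\<Gamma> \<subseteq> G"
    and \<Gamma>_cover: "x \<in> topspace T \<Longrightarrow> \<exists>\<gamma>\<in>\<Gamma>. x \<in> dom \<gamma>"
    and \<Gamma>_change: "\<gamma> \<in> \<Gamma> \<Longrightarrow> \<gamma>' \<in> \<Gamma> \<Longrightarrow>
       \<exists>b\<in>words T L. \<forall>x y y'. \<gamma> x = Some y \<longrightarrow> \<gamma>' x = Some y' \<longrightarrow> b y = Some y'"
    and factorisation: "h \<in> H \<Longrightarrow> x \<in> dom h \<Longrightarrow>
       \<exists>\<gamma>\<in>\<Gamma>. \<exists>\<gamma>'\<in>\<Gamma>. \<exists>b\<in>words T L. \<exists>V. openin T V \<and> x \<in> V \<and>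
         (\<forall>x'\<in>V. \<exists>y w w'. h x' = Some y \<and> \<gamma> x' = Some w \<and> b w = Some w' \<and> \<gamma>' y = Some w')"
begin

lemma pseudogroup_G: "pseudogroup T G"
  using pseudogroup_hull[OF H_Ph] G_eq by simp

lemma pseudo_star_group_G: "pseudo_star_group T G"
  using pseudogroup_G by (simp add: pseudogroup_def)

lemma G_Ph: "G \<subseteq> Ph T"
  by (rule pseudo_star_groupD(1)[OF pseudo_star_group_G])

lemma L_G: "L \<subseteq> G"
proof
  fix l assume l: "l \<in> L"
  then obtain g where g: "g \<in> G" "l \<subseteq>\<^sub>m g" using L_extension by blast
  have "l = g |` dom l"
  proof
    fix x show "l x = (g |` dom l) x"
      using g(2) by (cases "x \<in> dom l") (auto simp: map_le_def restrict_map_def)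
  qed
  moreover have "openin T (dom l)" using L_Ph l Ph_dom by blast
  ultimately show "l \<in> G" using pseudo_star_group_restrict[OF pseudo_star_group_G g(1)] by metis
qed

lemma words_G: "words T L \<subseteq> G"
  using words_subset[OF pseudo_star_group_G L_G] .

text \<open>The return maps will be cut into small pieces to gain uniform control, so the pseudo-*-groups below
are built from an arbitrary family of pieces that still covers.\<close>

definition refinement :: "('z \<rightharpoonup> 'z) set \<Rightarrow> bool" where
  "refinement \<Gamma>' \<longleftrightarrow> (\<forall>\<gamma>'\<in>\<Gamma>'. \<exists>\<gamma>\<in>\<Gamma>. \<exists>Y. openin T Y \<and> \<gamma>' = \<gamma> |` Y) \<and>
     (\<forall>x\<in>topspace T. \<exists>\<gamma>'\<in>\<Gamma>'. x \<in> dom \<gamma>')"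

lemma refinement_self: "refinement \<Gamma>"
proof -
  have "\<gamma> = \<gamma> |` dom \<gamma>" for \<gamma> :: "'z \<rightharpoonup> 'z" by (auto simp: restrict_map_def fun_eq_iff)
  moreover have "openin T (dom \<gamma>)" if "\<gamma> \<in> \<Gamma>" for \<gamma> using that \<Gamma>_G G_Ph Ph_dom by blast
  ultimately show ?thesis unfolding refinement_def using \<Gamma>_cover by metis
qed

lemma refinement_le:
  assumes "refinement \<Gamma>'" "\<gamma>' \<in> \<Gamma>'"
  obtains \<gamma> where "\<gamma> \<in> \<Gamma>" "\<And>x y. \<gamma>' x = Some y \<Longrightarrow> \<gamma> x = Some y"
proof -
  obtain \<gamma> Y where "\<gamma> \<in> \<Gamma>" "\<gamma>' = \<gamma> |` Y" using assms unfolding refinement_def by blast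
  then show thesis by (intro that[of \<gamma>]) (auto simp: restrict_map_Some_iff)
qed

lemma refinement_cover:
  assumes "refinement \<Gamma>'" "x \<in> topspace T" obtains \<gamma> where "\<gamma> \<in> \<Gamma>'" "x \<in> dom \<gamma>"
proof -
  have "\<exists>\<gamma>\<in>\<Gamma>'. x \<in> dom \<gamma>" using assms unfolding refinement_def by (elim conjE) (rule bspec)
  then show thesis using that by blast
qed

lemma refinement_G:
  assumes "refinement \<Gamma>'" shows "\<Gamma>' \<subseteq> G"
proof
  fix \<gamma>' assume "\<gamma>' \<in> \<Gamma>'"
  then obtain \<gamma> Y where Y: "\<gamma> \<in> \<Gamma>" "openin T Y" "\<gamma>' = \<gamma> |` Y"
    using assms unfolding refinement_def by blast
  then show "\<gamma>' \<in> G" using \<Gamma>_G pseudo_star_group_restrict[OF pseudo_star_group_G _ Y(2)] by auto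
qed

lemma refinement_change:
  assumes "refinement \<Gamma>'" "refinement \<Gamma>''" "\<gamma> \<in> \<Gamma>'" "\<gamma>' \<in> \<Gamma>''"
  obtains b where "b \<in> words T L" "\<And>x y y'. \<gamma> x = Some y \<Longrightarrow> \<gamma>' x = Some y' \<Longrightarrow> b y = Some y'"
proof -
  obtain \<gamma>1 where 1: "\<gamma>1 \<in> \<Gamma>" "\<And>x y. \<gamma> x = Some y \<Longrightarrow> \<gamma>1 x = Some y"
    by (rule refinement_le[OF assms(1,3)]) (rule that, assumption, simp)
  obtain \<gamma>2 where 2: "\<gamma>2 \<in> \<Gamma>" "\<And>x y. \<gamma>' x = Some y \<Longrightarrow> \<gamma>2 x = Some y"
    by (rule refinement_le[OF assms(2,4)]) (rule that, assumption, simp)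
  obtain b where b: "b \<in> words T L" "\<forall>x y y'. \<gamma>1 x = Some y \<longrightarrow> \<gamma>2 x = Some y' \<longrightarrow> b y = Some y'"
    using \<Gamma>_change[OF 1(1) 2(1)] by blast
  show thesis
  proof (rule that[OF b(1)])
    fix x y y' assume "\<gamma> x = Some y" "\<gamma>' x = Some y'"
    then show "b y = Some y'" using b(2) 1(2)[of x y] 2(2)[of x y'] by blast
  qed
qed

definition trivial_map :: "('z \<rightharpoonup> 'z) \<Rightarrow> bool" where
  "trivial_map t \<longleftrightarrow> (\<forall>x y. t x = Some y \<longrightarrow> y = x)"

definition factors :: "('z \<rightharpoonup> 'z) \<Rightarrow> ('z \<rightharpoonup> 'z) \<Rightarrow> ('z \<rightharpoonup> 'z) \<Rightarrow> ('z \<rightharpoonup> 'z) \<Rightarrow> bool" where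
  "factors t \<gamma> b \<gamma>' \<longleftrightarrow> (\<forall>x y. t x = Some y \<longrightarrow>
     (\<exists>w w'. \<gamma> x = Some w \<and> b w = Some w' \<and> \<gamma>' y = Some w'))"

text \<open>The restrictions of the identity are included separately: a point of the identity's domain lies in
the domain of some return map, but no single pair of return maps serves all points.\<close>

definition transit :: "('z \<rightharpoonup> 'z) set \<Rightarrow> ('z \<rightharpoonup> 'z) set" where
  "transit \<Gamma>' = {t \<in> Ph T. trivial_map t \<or>
     (\<exists>\<gamma>\<in>\<Gamma>'. \<exists>\<gamma>'\<in>\<Gamma>'. \<exists>b\<in>words T L. factors t \<gamma> b \<gamma>')}"

lemma transit_cases:
  assumes "t \<in> transit \<Gamma>'"
  obtains (trivial) "\<And>x y. t x = Some y \<Longrightarrow> y = x"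
  | (passage) \<gamma> \<gamma>' b where "\<gamma> \<in> \<Gamma>'" "\<gamma>' \<in> \<Gamma>'" "b \<in> words T L"
     "\<And>x y. t x = Some y \<Longrightarrow> \<exists>w w'. \<gamma> x = Some w \<and> b w = Some w' \<and> \<gamma>' y = Some w'"
proof -
  consider "trivial_map t"
    | \<gamma> \<gamma>' b where "\<gamma> \<in> \<Gamma>'" "\<gamma>' \<in> \<Gamma>'" "b \<in> words T L" "factors t \<gamma> b \<gamma>'"
    using assms unfolding transit_def by blast
  then show thesis
  proof cases
    case 1
    then show ?thesis by (intro trivial) (simp add: trivial_map_def)
  next
    case (2 \<gamma> \<gamma>' b)
    then show ?thesis by (intro passage[of \<gamma> \<gamma>' b]) (simp_all add: factors_def)
  qed
qed

lemma transitI: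
  assumes "t \<in> Ph T" "\<gamma> \<in> \<Gamma>'" "\<gamma>' \<in> \<Gamma>'" "b \<in> words T L"
     "\<And>x y. t x = Some y \<Longrightarrow> \<exists>w w'. \<gamma> x = Some w \<and> b w = Some w' \<and> \<gamma>' y = Some w'"
  shows "t \<in> transit \<Gamma>'"
proof -
  have "factors t \<gamma> b \<gamma>'" using assms(5) by (simp add: factors_def)
  then show ?thesis using assms unfolding transit_def by blast
qed

lemma transit_trivialI: "t \<in> Ph T \<Longrightarrow> (\<And>x y. t x = Some y \<Longrightarrow> y = x) \<Longrightarrow> t \<in> transit \<Gamma>'"
  by (simp add: transit_def trivial_map_def)

lemma transit_Ph: "transit \<Gamma>' \<subseteq> Ph T"
  unfolding transit_def by blast

text \<open>The composite of \<open>\<gamma>'\<^sup>-\<^sup>1 b \<gamma>\<close> and \<open>\<gamma>\<^sub>2'\<^sup>-\<^sup>1 b\<^sub>2 \<gamma>\<^sub>2\<close> is again of this form because \<open>\<gamma>\<^sub>2 \<gamma>'\<^sup>-\<^sup>1\<close> is contained in a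
word. So a long composition never leaves the region of the letters except at its two ends.\<close>

lemma transit_pseudo_star_group:
  assumes ref: "refinement \<Gamma>'"
  shows "pseudo_star_group T (transit \<Gamma>')"
  unfolding pseudo_star_group_def
proof (intro conjI ballI allI impI)
  show sub: "transit \<Gamma>' \<subseteq> Ph T" by (rule transit_Ph)
  show "id_Ph T \<in> transit \<Gamma>'"
    by (intro transit_trivialI id_in_Ph) (auto simp: id_Ph_iff)
  fix f assume f: "f \<in> transit \<Gamma>'"
  then have fP: "f \<in> Ph T" using sub by blast
  show "inv_Ph f \<in> transit \<Gamma>'"
    using f
  proof (cases rule: transit_cases)
    case trivial
    then show ?thesis by (intro transit_trivialI inv_Ph_in_Ph fP) (auto simp: inv_Ph_iff[OF fP])
  next
    case (passage \<gamma> \<gamma>' b)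
    obtain b' where b': "b' \<in> words T L" "\<And>x y. b x = Some y \<Longrightarrow> b' y = Some x"
      by (rule words_inverse[OF L_Ph _ passage(3)], erule L_inverse) (rule that, assumption, simp)
    show ?thesis
      by (rule transitI[OF inv_Ph_in_Ph[OF fP] passage(2,1) b'(1)])
         (use passage(4) b'(2) in \<open>unfold inv_Ph_iff[OF fP], blast\<close>)
  qed
  show "f |` V \<in> transit \<Gamma>'" if "openin T V \<and> V \<subseteq> dom f" for V
  proof -
    have fV: "f |` V \<in> Ph T" using fP that restrict_in_Ph by blast
    show ?thesis using f
    proof (cases rule: transit_cases)
      case trivial
      then show ?thesis by (intro transit_trivialI fV) (auto simp: restrict_map_Some_iff)
    next
      case (passage \<gamma> \<gamma>' b)
      then show ?thesis by (intro transitI[OF fV passage(1-3)]) (auto simp: restrict_map_Some_iff)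
    qed
  qed
  fix g assume g: "g \<in> transit \<Gamma>'"
  have gf: "g \<circ>\<^sub>m f \<in> Ph T" using fP g sub comp_in_Ph by blast
  show "g \<circ>\<^sub>m f \<in> transit \<Gamma>'"
    using f
  proof (cases rule: transit_cases)
    case trivial
    note f_triv = trivial
    show ?thesis using g
    proof (cases rule: transit_cases)
      case trivial
      then show ?thesis using f_triv by (intro transit_trivialI[OF gf]) (fastforce simp: map_comp_Some_iff)
    next
      case (passage \<gamma> \<gamma>' b)
      show ?thesis
      proof (rule transitI[OF gf passage(1-3)])
        fix x z assume "(g \<circ>\<^sub>m f) x = Some z"
        then obtain y where y: "f x = Some y" "g y = Some z" by (auto simp: map_comp_Some_iff)
        show "\<exists>w w'. \<gamma> x = Some w \<and> b w = Some w' \<and> \<gamma>' z = Some w'"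
          using passage(4)[OF y(2)] f_triv[OF y(1)] by simp
      qed
    qed
  next
    case (passage \<gamma> \<gamma>' b)
    note p = passage
    show ?thesis using g
    proof (cases rule: transit_cases)
      case trivial
      show ?thesis
      proof (rule transitI[OF gf p(1-3)])
        fix x z assume "(g \<circ>\<^sub>m f) x = Some z"
        then obtain y where y: "f x = Some y" "g y = Some z" by (auto simp: map_comp_Some_iff)
        show "\<exists>w w'. \<gamma> x = Some w \<and> b w = Some w' \<and> \<gamma>' z = Some w'"
          using p(4)[OF y(1)] trivial[OF y(2)] by simp
      qed
    next
      case (passage \<gamma>1 \<gamma>1' b1)
      obtain a where a: "a \<in> words T L" "\<And>x y y'. \<gamma>' x = Some y \<Longrightarrow> \<gamma>1 x = Some y' \<Longrightarrow> a y = Some y'"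
        by (rule refinement_change[OF ref ref p(2) passage(1)]) (rule that; blast)
      obtain e where e: "e \<in> words T L" "\<And>x y z. b x = Some y \<Longrightarrow> a y = Some z \<Longrightarrow> e x = Some z"
        by (rule words_comp[OF L_Ph p(3) a(1)]) (rule that; blast)
      obtain k where k: "k \<in> words T L" "\<And>x y z. e x = Some y \<Longrightarrow> b1 y = Some z \<Longrightarrow> k x = Some z"
        by (rule words_comp[OF L_Ph e(1) passage(3)]) (rule that; blast)
      show ?thesis
      proof (rule transitI[OF gf p(1) passage(2) k(1)])
        fix x z assume "(g \<circ>\<^sub>m f) x = Some z"
        then obtain y where y: "f x = Some y" "g y = Some z" by (auto simp: map_comp_Some_iff)
        obtain u u' where u: "\<gamma> x = Some u" "b u = Some u'" "\<gamma>' y = Some u'" using p(4)[OF y(1)] by blast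
        obtain v v' where v: "\<gamma>1 y = Some v" "b1 v = Some v'" "\<gamma>1' z = Some v'" using passage(4)[OF y(2)] by blast
        have "k u = Some v'" by (rule k(2)[OF e(2)[OF u(2) a(2)[OF u(3) v(1)]] v(2)])
        then show "\<exists>w w'. \<gamma> x = Some w \<and> k w = Some w' \<and> \<gamma>1' z = Some w'" using u v by blast
      qed
    qed
  qed
qed

lemma transit_G:
  assumes ref: "refinement \<Gamma>'"
  shows "transit \<Gamma>' \<subseteq> G"
proof
  fix t assume t: "t \<in> transit \<Gamma>'"
  then have tP: "t \<in> Ph T" using transit_Ph by blast
  have restr: "t \<in> G" if g: "g \<in> G" and le: "\<And>x y. t x = Some y \<Longrightarrow> g x = Some y" for g
  proof -
    have "t x = (g |` dom t) x" for x
      using le by (cases "t x") (auto simp: restrict_map_def dom_def)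
    then have "t = g |` dom t" by blast
    then show ?thesis using pseudo_star_group_restrict[OF pseudo_star_group_G g Ph_dom[OF tP]] by simp
  qed
  show "t \<in> G" using t
  proof (cases rule: transit_cases)
    case trivial
    then show ?thesis
      using restr[of "id_Ph T"] pseudo_star_groupD(2)[OF pseudo_star_group_G] Ph_topspace[OF tP]
      by (metis id_Ph_iff)
  next
    case (passage \<gamma> \<gamma>' b)
    have GG: "\<gamma> \<in> G" "\<gamma>' \<in> G" "b \<in> G" using passage(1-3) refinement_G[OF ref] words_G by auto
    then have "inv_Ph \<gamma>' \<circ>\<^sub>m (b \<circ>\<^sub>m \<gamma>) \<in> G"
      by (intro pseudo_star_groupD(3,4)[OF pseudo_star_group_G])
    moreover have "(inv_Ph \<gamma>' \<circ>\<^sub>m (b \<circ>\<^sub>m \<gamma>)) x = Some y" if xy: "t x = Some y" for x y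
    proof -
      obtain w w' where w: "\<gamma> x = Some w" "b w = Some w'" "\<gamma>' y = Some w'"
        using passage(4)[OF xy] by blast
      then have "inv_Ph \<gamma>' w' = Some y" using inv_Ph_iff[OF subsetD[OF G_Ph GG(2)]] by simp
      then show ?thesis using w by (auto simp: map_comp_Some_iff)
    qed
    ultimately show ?thesis by (rule restr)
  qed
qed

text \<open>Cutting the return maps into pieces does not affect generation: near a point, a generator factors
through the original return maps, and these differ from the pieces by words.\<close>

lemma transit_generates:
  assumes ref: "refinement \<Gamma>'"
  shows "generates T (transit \<Gamma>') G"
proof -
  let ?S = "transit \<Gamma>'"
  have SP: "?S \<subseteq> Ph T" by (rule transit_Ph)
  have pg: "pseudogroup T (generated_pseudogroup T ?S)" by (rule pseudogroup_hull[OF SP])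
  have SS: "?S \<subseteq> generated_pseudogroup T ?S"
    by (simp add: generated_pseudogroup_def hull_subset)
  have "H \<subseteq> generated_pseudogroup T ?S"
  proof
    fix h assume h: "h \<in> H"
    then have hP: "h \<in> Ph T" using H_Ph by blast
    show "h \<in> generated_pseudogroup T ?S"
    proof (rule pseudogroup_localI[OF pg hP])
      fix x y assume xy: "h x = Some y"
      then have "x \<in> dom h" by blast
      from factorisation[OF h this]
      obtain \<gamma> \<gamma>' b V where V: "\<gamma> \<in> \<Gamma>" "\<gamma>' \<in> \<Gamma>" "b \<in> words T L" "openin T V" "x \<in> V"
         "\<forall>x'\<in>V. \<exists>y w w'. h x' = Some y \<and> \<gamma> x' = Some w \<and> b w = Some w' \<and> \<gamma>' y = Some w'"
        by (elim bexE exE conjE)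
      obtain \<gamma>1 where \<gamma>1: "\<gamma>1 \<in> \<Gamma>'" "x \<in> dom \<gamma>1"
        using refinement_cover[OF ref Ph_topspace(1)[OF hP xy]] .
      obtain \<gamma>2 where \<gamma>2: "\<gamma>2 \<in> \<Gamma>'" "y \<in> dom \<gamma>2"
        using refinement_cover[OF ref Ph_topspace(2)[OF hP xy]] .
      obtain a1 where a1: "a1 \<in> words T L" "\<And>x y y'. \<gamma>1 x = Some y \<Longrightarrow> \<gamma> x = Some y' \<Longrightarrow> a1 y = Some y'"
        by (rule refinement_change[OF ref refinement_self \<gamma>1(1) V(1)]) (rule that; blast)
      obtain a2 where a2: "a2 \<in> words T L" "\<And>x y y'. \<gamma>' x = Some y \<Longrightarrow> \<gamma>2 x = Some y' \<Longrightarrow> a2 y = Some y'"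
        by (rule refinement_change[OF refinement_self ref V(2) \<gamma>2(1)]) (rule that; blast)
      obtain e where e: "e \<in> words T L" "\<And>x y z. a1 x = Some y \<Longrightarrow> b y = Some z \<Longrightarrow> e x = Some z"
        by (rule words_comp[OF L_Ph a1(1) V(3)]) (rule that; blast)
      obtain k where k: "k \<in> words T L" "\<And>x y z. e x = Some y \<Longrightarrow> a2 y = Some z \<Longrightarrow> k x = Some z"
        by (rule words_comp[OF L_Ph e(1) a2(1)]) (rule that; blast)
      have P: "\<gamma>1 \<in> Ph T" "\<gamma>2 \<in> Ph T" using \<gamma>1 \<gamma>2 refinement_G[OF ref] G_Ph by auto
      let ?V = "V \<inter> dom \<gamma>1 \<inter> preim h (dom \<gamma>2)"
      have oV: "openin T ?V" using V(4) P Ph_dom Ph_preim[OF hP] by blast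
      have "x \<in> ?V" using V(5) \<gamma>1(2) \<gamma>2(2) xy by (auto simp: preim_def)
      moreover have "h |` ?V \<in> ?S"
      proof (rule transitI[OF restrict_in_Ph[OF hP oV] \<gamma>1(1) \<gamma>2(1) k(1)])
        fix x' y' assume "(h |` ?V) x' = Some y'"
        then have x': "x' \<in> V" "x' \<in> dom \<gamma>1" "y' \<in> dom \<gamma>2" "h x' = Some y'"
          by (auto simp: restrict_map_Some_iff preim_def)
        obtain w w' where w: "\<gamma> x' = Some w" "b w = Some w'" "\<gamma>' y' = Some w'"
          using V(6)[rule_format, OF x'(1)] x'(4) by auto
        obtain u u' where u: "\<gamma>1 x' = Some u" "\<gamma>2 y' = Some u'" using x' by blast
        have "k u = Some u'" by (rule k(2)[OF e(2)[OF a1(2)[OF u(1) w(1)] w(2)] a2(2)[OF w(3) u(2)]])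
        then show "\<exists>w w'. \<gamma>1 x' = Some w \<and> k w = Some w' \<and> \<gamma>2 y' = Some w'" using u by blast
      qed
      ultimately show "\<exists>V. openin T V \<and> x \<in> V \<and> h |` V \<in> generated_pseudogroup T ?S"
        using oV SS by blast
    qed
  qed
  then have "G \<subseteq> generated_pseudogroup T ?S"
    unfolding G_eq using pg by (simp add: generated_pseudogroup_def hull_minimal)
  moreover have "generated_pseudogroup T ?S \<subseteq> G"
    using hull_minimal[of ?S G "pseudogroup T"] transit_G[OF ref] pseudogroup_G by (simp add: generated_pseudogroup_def)
  ultimately show ?thesis using transit_G[OF ref] by (simp add: generates_def)
qed

section \<open>Sets that stay small under all words\<close>

definition small :: "('z \<Rightarrow> 'z \<Rightarrow> ennreal) \<Rightarrow> real \<Rightarrow> 'z set \<Rightarrow> bool" where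
  "small d \<epsilon> N \<longleftrightarrow> openin T N \<and> (\<forall>b\<in>words T L. \<forall>y\<in>N. \<forall>y'\<in>N. \<forall>z z'.
      b y = Some z \<longrightarrow> b y' = Some z' \<longrightarrow> d z z' < ennreal \<epsilon>)"

text \<open>The return map comes first because the words act only on the region of the letters: at a point
outside their domains smallness under all words would say nothing about the orbit.\<close>

definition calm :: "('z \<Rightarrow> 'z \<Rightarrow> ennreal) \<Rightarrow> real \<Rightarrow> 'z set" where
  "calm d \<epsilon> = {x. \<exists>\<gamma>\<in>\<Gamma>. \<exists>z N. \<gamma> x = Some z \<and> z \<in> N \<and> small d \<epsilon> N}"

lemma smallD:
  "small d \<epsilon> N \<Longrightarrow> b \<in> words T L \<Longrightarrow> y \<in> N \<Longrightarrow> y' \<in> N \<Longrightarrow> b y = Some z \<Longrightarrow> b y' = Some z' \<Longrightarrow> d z z' < ennreal \<epsilon>"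
  unfolding small_def by blast

lemma small_img:
  assumes N: "small d \<epsilon> N" and b: "b \<in> words T L" shows "small d \<epsilon> (img b N)"
proof -
  have "openin T (img b N)" using N b words_G G_Ph Ph_img by (metis small_def subsetD)
  moreover have "d w w' < ennreal \<epsilon>"
    if c: "c \<in> words T L" "y \<in> img b N" "y' \<in> img b N" "c y = Some w" "c y' = Some w'" for c y y' w w'
  proof -
    obtain e where e: "e \<in> words T L" "\<And>x y z. b x = Some y \<Longrightarrow> c y = Some z \<Longrightarrow> e x = Some z"
      by (rule words_comp[OF L_Ph b c(1)]) (rule that; blast)
    obtain v v' where v: "v \<in> N" "v' \<in> N" "b v = Some y" "b v' = Some y'" using c(2,3) by (auto simp: img_def)
    then show ?thesis by (intro smallD[OF N e(1) v(1,2) e(2)[OF v(3) c(4)] e(2)[OF v(4) c(5)]])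
  qed
  ultimately show ?thesis unfolding small_def by blast
qed

lemma calm_mono: "\<epsilon> \<le> \<epsilon>' \<Longrightarrow> calm d \<epsilon> \<subseteq> calm d \<epsilon>'"
proof -
  assume "\<epsilon> \<le> \<epsilon>'"
  then have "small d \<epsilon> N \<Longrightarrow> small d \<epsilon>' N" for N
    using ennreal_leI less_le_trans unfolding small_def by metis
  then show ?thesis unfolding calm_def by blast
qed

lemma openin_calm: "openin T (calm d \<epsilon>)"
proof -
  have "calm d \<epsilon> = \<Union>{preim \<gamma> N |\<gamma> N. \<gamma> \<in> \<Gamma> \<and> small d \<epsilon> N}"
    by (auto simp: calm_def preim_def)
  moreover have "openin T (preim \<gamma> N)" if "\<gamma> \<in> \<Gamma>" "small d \<epsilon> N" for \<gamma> N
    using that \<Gamma>_G G_Ph by (intro Ph_preim) (auto simp: small_def)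
  ultimately show ?thesis by (auto intro!: openin_Union)
qed

lemma calm_return:
  assumes ref: "refinement \<Gamma>'" and x: "x \<in> calm d \<epsilon>" and \<gamma>: "\<gamma> \<in> \<Gamma>'" "\<gamma> x = Some z"
  shows "\<exists>N. small d \<epsilon> N \<and> z \<in> N"
proof -
  obtain \<gamma>1 z1 N where 1: "\<gamma>1 \<in> \<Gamma>" "\<gamma>1 x = Some z1" "z1 \<in> N" "small d \<epsilon> N"
    using x by (auto simp: calm_def)
  obtain b where b: "b \<in> words T L" "\<And>x y y'. \<gamma>1 x = Some y \<Longrightarrow> \<gamma> x = Some y' \<Longrightarrow> b y = Some y'"
    by (rule refinement_change[OF refinement_self ref 1(1) \<gamma>(1)]) (rule that; blast)
  have "z \<in> img b N" using b(2)[OF 1(2) \<gamma>(2)] 1(3) by (auto simp: img_def)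
  then show ?thesis using small_img[OF 1(4) b(1)] by blast
qed

text \<open>It suffices to move \<open>x\<close> by a map of the form \<open>\<gamma>'\<^sup>-\<^sup>1 b \<gamma>\<close>, and small sets are carried to small sets by
words.\<close>

lemma calm_invariant:
  assumes g: "g \<in> G" "g x = Some y" and x: "x \<in> calm d \<epsilon>"
  shows "y \<in> calm d \<epsilon>"
proof -
  obtain V where V: "x \<in> V" "g |` V \<in> transit \<Gamma>"
    using locally_in_generating_set[OF transit_pseudo_star_group[OF refinement_self]
        transit_generates[OF refinement_self] g] by blast
  have gV: "(g |` V) x = Some y" using V g by simp
  from V(2) show ?thesis
  proof (cases rule: transit_cases)
    case trivial
    then show ?thesis using gV x by blast
  next
    case (passage \<gamma> \<gamma>' b)
    obtain w w' where w: "\<gamma> x = Some w" "b w = Some w'" "\<gamma>' y = Some w'" using passage(4)[OF gV] by blast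
    obtain N where N: "small d \<epsilon> N" "w \<in> N" using calm_return[OF refinement_self x passage(1) w(1)] by blast
    have "w' \<in> img b N" using N w by (auto simp: img_def)
    then show ?thesis using small_img[OF N(1) passage(3)] passage(2) w(3) unfolding calm_def by blast
  qed
qed

text \<open>Letters are restrictions of maps of \<open>G\<close> that are defined on a compact set containing the
domain of the letter, and maps of \<open>G\<close> lie locally in \<open>S\<close>. The constant is the Lebesgue number of
the resulting covers, minimised over the finitely many letters.\<close>

lemma letters_extend_uniformly:
  assumes d: "compatible_metric T d" and S: "pseudo_star_group T S" "generates T S G"
  shows "\<exists>c>0. \<forall>l\<in>L. \<forall>y\<in>dom l. \<exists>e\<in>S. eball T d y c \<subseteq> dom e \<and> (\<forall>z\<in>dom l \<inter> dom e. e z = l z)"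
proof -
  have "\<exists>c>0. \<forall>y\<in>dom l. \<exists>e\<in>S. eball T d y c \<subseteq> dom e \<and> (\<forall>z\<in>dom l \<inter> dom e. e z = l z)" if l: "l \<in> L" for l
  proof -
    obtain g K where g: "g \<in> G" "compactin T K" "dom l \<subseteq> K" "K \<subseteq> dom g" "l \<subseteq>\<^sub>m g"
      using L_extension[OF l] by blast
    let ?\<V> = "{V. V \<subseteq> dom g \<and> g |` V \<in> S}"
    have "\<exists>V\<in>?\<V>. openin T V \<and> y \<in> V" if y: "y \<in> K" for y
    proof -
      obtain v where "g y = Some v" using y g(4) by blast
      from locally_in_generating_set[OF S g(1) this] show ?thesis by blast
    qed
    from Lebesgue_number[OF d g(2) this]
    obtain c where c: "c > 0" "\<And>y. y \<in> K \<Longrightarrow> \<exists>V\<in>?\<V>. eball T d y c \<subseteq> V" by metis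
    have "\<exists>e\<in>S. eball T d y c \<subseteq> dom e \<and> (\<forall>z\<in>dom l \<inter> dom e. e z = l z)" if y: "y \<in> dom l" for y
    proof -
      obtain V where V: "V \<subseteq> dom g" "g |` V \<in> S" "eball T d y c \<subseteq> V"
        using c(2)[of y] g(3) y by blast
      then have "eball T d y c \<subseteq> dom (g |` V)" by auto
      moreover have "(g |` V) z = l z" if "z \<in> dom l \<inter> dom (g |` V)" for z
        using that g(5) by (auto simp: map_le_def restrict_map_def)
      ultimately show ?thesis using V(2) by blast
    qed
    then show ?thesis using c(1) by blast
  qed
  then obtain c where c: "\<And>l. l \<in> L \<Longrightarrow> c l > 0"
    "\<And>l y. l \<in> L \<Longrightarrow> y \<in> dom l \<Longrightarrow> \<exists>e\<in>S. eball T d y (c l) \<subseteq> dom e \<and> (\<forall>z\<in>dom l \<inter> dom e. e z = l z)"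
    by metis
  define c0 where "c0 = Min (insert 1 (c ` L))"
  have c0: "c0 > 0" "\<And>l. l \<in> L \<Longrightarrow> c0 \<le> c l" using c(1) finite_L by (auto simp: c0_def)
  have "\<exists>e\<in>S. eball T d y c0 \<subseteq> dom e \<and> (\<forall>z\<in>dom l \<inter> dom e. e z = l z)" if l: "l \<in> L" "y \<in> dom l" for l y
  proof -
    obtain e where e: "e \<in> S" "eball T d y (c l) \<subseteq> dom e" "\<forall>z\<in>dom l \<inter> dom e. e z = l z"
      using c(2)[OF l] by blast
    moreover have "eball T d y c0 \<subseteq> dom e"
      using eball_mono[OF c0(2)[OF l(1)]] e(2) by (rule subset_trans)
    ultimately show ?thesis by blast
  qed
  then show ?thesis using c0(1) by blast
qed

text \<open>This is where \<open>2 c \<le> c\<^sub>0\<close> is used. The word is known to be defined at \<open>x'\<close> only, perhaps not at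
the stable point \<open>x\<close>. Inductively a part of the word extends to some \<open>s\<close> in \<open>S\<close> on all of \<open>N\<close>. By
stability \<open>s\<close> maps \<open>N\<close> into the \<open>c\<close>-ball around \<open>s x\<close>, hence into the \<open>c\<^sub>0\<close>-ball around \<open>s x'\<close>,
where the next letter extends to a map of \<open>S\<close>.\<close>

lemma word_extends_near_stable_point:
  assumes d: "compatible_metric T d" and S: "pseudo_star_group T S"
    and ext: "\<And>l y. l \<in> L \<Longrightarrow> y \<in> dom l \<Longrightarrow>
      \<exists>e\<in>S. eball T d y c0 \<subseteq> dom e \<and> (\<forall>z\<in>dom l \<inter> dom e. e z = l z)"
    and N: "N \<subseteq> topspace T" "x \<in> N"
    and stable: "\<And>s y. s \<in> S \<Longrightarrow> N \<subseteq> dom s \<Longrightarrow> y \<in> N \<Longrightarrow> d (the (s x)) (the (s y)) < ennreal c"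
    and c: "c + c \<le> c0"
    and b: "b \<in> words T L" and x': "x' \<in> N" "b x' = Some z"
  shows "\<exists>s\<in>S. N \<subseteq> dom s \<and> (\<forall>y\<in>N. \<forall>w. b y = Some w \<longrightarrow> s y = Some w)"
  using b x'(2)
proof (induction arbitrary: z)
  case empty_word
  have "dom (id_Ph T) = topspace T" by (auto simp: dom_def id_Ph_iff)
  then show ?case using N pseudo_star_groupD(2)[OF S] by (intro bexI[of _ "id_Ph T"]) auto
next
  case (letter_word b l)
  obtain u where u: "b x' = Some u" "l u = Some z" using letter_word.prems by (auto simp: map_comp_Some_iff)
  obtain s where s: "s \<in> S" "N \<subseteq> dom s" "\<And>y w. y \<in> N \<Longrightarrow> b y = Some w \<Longrightarrow> s y = Some w"
    using letter_word.IH[OF u(1)] by metis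
  have sP: "s \<in> Ph T" using S s(1) pseudo_star_groupD(1) by blast
  obtain e where e: "e \<in> S" "eball T d u c0 \<subseteq> dom e" "\<And>z. z \<in> dom l \<Longrightarrow> z \<in> dom e \<Longrightarrow> e z = l z"
    using ext[OF letter_word.hyps(2), of u] u(2) by (metis IntI domI)
  have su: "s x' = Some u" using s(3) x'(1) u(1) by blast
  have near: "v \<in> dom e" if y: "y \<in> N" "s y = Some v" for y v
  proof -
    obtain t where t: "s x = Some t" using s(2) N(2) by blast
    have T: "u \<in> topspace T" "t \<in> topspace T" "v \<in> topspace T" using Ph_topspace[OF sP] su t y by blast+
    have "d t u < ennreal c" "d t v < ennreal c"
      using stable[OF s(1,2) x'(1)] stable[OF s(1,2) y(1)] t su y by auto
    then have "d u v < ennreal (c + c)"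
      by (intro compatible_metric_triangle_less[OF d T]) (simp_all add: compatible_metricD(2)[OF d T(1,2)])
    then have "v \<in> eball T d u (c + c)" using T by (simp add: eball_def)
    then show ?thesis using e(2) eball_mono[OF c, of T d u] by blast
  qed
  have "N \<subseteq> dom (e \<circ>\<^sub>m s)"
  proof
    fix y assume y: "y \<in> N"
    then obtain v where "s y = Some v" using s(2) by blast
    moreover obtain w where "e v = Some w" using near[OF y \<open>s y = Some v\<close>] by blast
    ultimately show "y \<in> dom (e \<circ>\<^sub>m s)" by (auto simp: dom_def map_comp_Some_iff)
  qed
  moreover have "(e \<circ>\<^sub>m s) y = Some w" if y: "y \<in> N" "(l \<circ>\<^sub>m b) y = Some w" for y w
  proof -
    obtain v where v: "b y = Some v" "l v = Some w" using y(2) by (auto simp: map_comp_Some_iff)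
    then have "s y = Some v" using s(3) y(1) by blast
    moreover have "e v = l v" using e(3) near[OF y(1) \<open>s y = Some v\<close>] v(2) by blast
    ultimately show ?thesis using v by (auto simp: map_comp_Some_iff)
  qed
  moreover have "e \<circ>\<^sub>m s \<in> S" using e(1) s(1) pseudo_star_groupD(4)[OF S] by blast
  ultimately show ?case by blast
qed

text \<open>The stable point need not lie in the region of the letters, so stability is carried over to its
image under a return map, which lies locally in \<open>S\<close>.\<close>

lemma not_sensitive_imp_calm:
  assumes "\<not> sensitive T G"
  shows "\<exists>d. compatible_metric T d \<and> (\<forall>\<epsilon>>0. calm d \<epsilon> \<noteq> {})"
proof -
  obtain d S where dS: "compatible_metric T d \<and> pseudo_star_group T S \<and> generates T S G"
    and ns': "\<not> (\<exists>c::real. c > 0 \<and> (\<forall>x\<in>topspace T. \<forall>r::real. r > 0 \<longrightarrow>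
              (\<exists>s\<in>S. \<exists>y. x \<in> dom s \<and> y \<in> dom s \<and> d x y < ennreal r \<and>
                 d (the (s x)) (the (s y)) \<ge> ennreal c)))"
    using assms unfolding sensitive_def not_all not_imp by (elim exE conjE) blast
  then have d: "compatible_metric T d" and S: "pseudo_star_group T S" "generates T S G" by simp_all
  define bad where "bad c x r \<longleftrightarrow> (\<exists>s\<in>S. \<exists>y. x \<in> dom s \<and> y \<in> dom s \<and> d x y < ennreal r \<and>
                 d (the (s x)) (the (s y)) \<ge> ennreal c)" for c r :: real and x
  have ns: "\<exists>x\<in>topspace T. \<exists>r>0. \<not> bad c x r" if c: "c > 0" for c :: real
    using ns' c unfolding bad_def[symmetric] by blast
  obtain c0 where c0: "c0 > 0" and ext: "\<And>l y. l \<in> L \<Longrightarrow> y \<in> dom l \<Longrightarrow>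
      \<exists>e\<in>S. eball T d y c0 \<subseteq> dom e \<and> (\<forall>z\<in>dom l \<inter> dom e. e z = l z)"
    using letters_extend_uniformly[OF d S] by metis
  have "calm d \<epsilon> \<noteq> {}" if "\<epsilon> > 0" for \<epsilon>
  proof -
    \<comment> \<open>A word moves two points of the neighbourhood to distance less than twice the stability constant.\<close>
    define c where "c = min c0 \<epsilon> / 2"
    have c: "c > 0" "c + c \<le> c0" "c + c \<le> \<epsilon>" using that c0 by (auto simp: c_def)
    obtain x r where x: "x \<in> topspace T" "r > 0" and nb: "\<not> bad c x r" using ns[OF c(1)] by blast
    have st: "d (the (s x)) (the (s y)) < ennreal c"
      if "s \<in> S" "x \<in> dom s" "y \<in> dom s" "d x y < ennreal r" for s y
      using nb that unfolding bad_def not_less[symmetric] by blast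
    obtain \<gamma> z where \<gamma>: "\<gamma> \<in> \<Gamma>" "\<gamma> x = Some z" using \<Gamma>_cover[OF x(1)] by blast
    have "\<gamma> \<in> G" using \<gamma> \<Gamma>_G by blast
    from locally_in_generating_set[OF S this \<gamma>(2)]
    obtain V where V: "openin T V" "x \<in> V" "\<gamma> |` V \<in> S" by blast
    have VP: "\<gamma> |` V \<in> Ph T" using V(3) S pseudo_star_groupD(1) by blast
    let ?N = "img (\<gamma> |` V) (eball T d x r)"
    have oN: "openin T ?N" using Ph_img[OF VP openin_eball[OF d x]] .
    then have NT: "?N \<subseteq> topspace T" by (rule openin_subset)
    have zN: "z \<in> ?N" using centre_in_eball[OF d x] V(2) \<gamma>(2) by (auto simp: img_def restrict_map_Some_iff)
    have stable: "d (the (s z)) (the (s y)) < ennreal c" if s: "s \<in> S" "?N \<subseteq> dom s" "y \<in> ?N" for s y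
    proof -
      obtain v where v: "v \<in> eball T d x r" "(\<gamma> |` V) v = Some y" using s(3) by (auto simp: img_def)
      have xz: "(\<gamma> |` V) x = Some z" using \<gamma>(2) V(2) by simp
      obtain a b where ab: "s z = Some a" "s y = Some b" using s zN by blast
      have "(s \<circ>\<^sub>m (\<gamma> |` V)) x = Some a" "(s \<circ>\<^sub>m (\<gamma> |` V)) v = Some b"
        using ab v xz by (auto simp: map_comp_Some_iff)
      moreover have "s \<circ>\<^sub>m (\<gamma> |` V) \<in> S" using s(1) V(3) pseudo_star_groupD(4)[OF S(1)] by blast
      ultimately show ?thesis using st[of "s \<circ>\<^sub>m (\<gamma> |` V)" v] v(1) ab by (auto simp: eball_def dom_def)
    qed
    have "small d \<epsilon> ?N" unfolding small_def
    proof (intro conjI oN ballI allI impI)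
      fix b y y' w w' assume b: "b \<in> words T L" "y \<in> ?N" "y' \<in> ?N" "b y = Some w" "b y' = Some w'"
      have "\<exists>s\<in>S. ?N \<subseteq> dom s \<and> (\<forall>y\<in>?N. \<forall>w. b y = Some w \<longrightarrow> s y = Some w)"
        by (rule word_extends_near_stable_point[OF d S(1) _ NT zN _ c(2) b(1,2,4)])
           ((rule ext stable; assumption)+)
      then obtain s where s: "s \<in> S" "?N \<subseteq> dom s" "\<forall>y\<in>?N. \<forall>w. b y = Some w \<longrightarrow> s y = Some w"
        by blast
      have sP: "s \<in> Ph T" using S s(1) pseudo_star_groupD(1) by blast
      obtain t where t: "s z = Some t" using s(2) zN by blast
      have sw: "s y = Some w" "s y' = Some w'" using s(3) b by blast+
      have T: "w \<in> topspace T" "t \<in> topspace T" "w' \<in> topspace T" using Ph_topspace[OF sP] sw t by blast+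
      have "d t w < ennreal c" "d t w' < ennreal c"
        using stable[OF s(1,2) b(2)] stable[OF s(1,2) b(3)] t sw by auto
      then have "d w w' < ennreal (c + c)"
        by (intro compatible_metric_triangle_less[OF d T]) (simp_all add: compatible_metricD(2)[OF d T(1,2)])
      also have "\<dots> \<le> ennreal \<epsilon>" using c(3) by (rule ennreal_leI)
      finally show "d w w' < ennreal \<epsilon>" .
    qed
    then have "x \<in> calm d \<epsilon>" using \<gamma> zN unfolding calm_def by blast
    then show ?thesis by blast
  qed
  then show ?thesis using d by blast
qed

section \<open>Refinements of the return maps with uniform moduli\<close>

text \<open>In \<open>P \<epsilon> \<delta> g\<close> the number \<open>\<delta>\<close> is a modulus of \<open>g\<close> for \<open>\<epsilon>\<close>. At level \<open>m\<close> the map \<open>g\<close> is so small that the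
modulus 1 serves for every \<open>\<epsilon> \<ge> 1/(m+1)\<close>, and it has some modulus for every smaller \<open>\<epsilon>\<close>.\<close>

definition level_admissible :: "(real \<Rightarrow> real \<Rightarrow> ('z \<rightharpoonup> 'z) \<Rightarrow> bool) \<Rightarrow> nat \<Rightarrow> ('z \<rightharpoonup> 'z) \<Rightarrow> bool" where
  "level_admissible P m g \<longleftrightarrow> (\<forall>\<epsilon>\<ge>1 / real (Suc m). P \<epsilon> 1 g) \<and> (\<forall>\<epsilon>>0. \<exists>\<delta>>0. P \<epsilon> \<delta> g)"

definition controllable :: "(real \<Rightarrow> real \<Rightarrow> ('z \<rightharpoonup> 'z) \<Rightarrow> bool) \<Rightarrow> bool" where
  "controllable P \<longleftrightarrow> (\<forall>\<epsilon> \<delta> \<delta>' g. P \<epsilon> \<delta> g \<longrightarrow> \<delta>' \<le> \<delta> \<longrightarrow> P \<epsilon> \<delta>' g) \<and>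
     (\<forall>\<gamma>\<in>\<Gamma>. \<forall>x\<in>dom \<gamma>. \<forall>m. \<exists>W. openin T W \<and> x \<in> W \<and>
        (\<forall>C Y. compactin T C \<longrightarrow> C \<subseteq> W \<inter> dom \<gamma> \<longrightarrow> Y \<subseteq> C \<longrightarrow> level_admissible P m (\<gamma> |` Y)))"

lemma controllable_conj:
  assumes P: "controllable P" and Q: "controllable Q"
  shows "controllable (\<lambda>\<epsilon> \<delta> g. P \<epsilon> \<delta> g \<and> Q \<epsilon> \<delta> g)"
  unfolding controllable_def
proof (intro conjI ballI allI)
  have aP: "P \<epsilon> \<delta>' g" if "P \<epsilon> \<delta> g" "\<delta>' \<le> \<delta>" for \<epsilon> \<delta> \<delta>' g
    using P that unfolding controllable_def by blast
  have aQ: "Q \<epsilon> \<delta>' g" if "Q \<epsilon> \<delta> g" "\<delta>' \<le> \<delta>" for \<epsilon> \<delta> \<delta>' g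
    using Q that unfolding controllable_def by blast
  show "P \<epsilon> \<delta> g \<and> Q \<epsilon> \<delta> g \<longrightarrow> \<delta>' \<le> \<delta> \<longrightarrow> P \<epsilon> \<delta>' g \<and> Q \<epsilon> \<delta>' g" for \<epsilon> \<delta> \<delta>' g
    using aP aQ by blast
  have both: "level_admissible (\<lambda>\<epsilon> \<delta> g. P \<epsilon> \<delta> g \<and> Q \<epsilon> \<delta> g) m g" if m: "level_admissible P m g" "level_admissible Q m g" for m g
    unfolding level_admissible_def
  proof (intro conjI allI impI)
    show "P \<epsilon> 1 g" "Q \<epsilon> 1 g" if "1 / real (Suc m) \<le> \<epsilon>" for \<epsilon>
      using m that unfolding level_admissible_def by blast+
    fix \<epsilon> :: real assume "\<epsilon> > 0"
    then obtain \<delta>1 \<delta>2 where \<delta>: "\<delta>1 > 0" "P \<epsilon> \<delta>1 g" "\<delta>2 > 0" "Q \<epsilon> \<delta>2 g"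
      using m unfolding level_admissible_def by blast
    show "\<exists>\<delta>>0. P \<epsilon> \<delta> g \<and> Q \<epsilon> \<delta> g"
      using \<delta> aP[OF \<delta>(2), of "min \<delta>1 \<delta>2"] aQ[OF \<delta>(4), of "min \<delta>1 \<delta>2"]
      by (intro exI[of _ "min \<delta>1 \<delta>2"]) simp
  qed
  fix \<gamma> x and m :: nat assume \<gamma>: "\<gamma> \<in> \<Gamma>" "x \<in> dom \<gamma>"
  obtain W1 where W1: "openin T W1" "x \<in> W1"
    "\<forall>C Y. compactin T C \<longrightarrow> C \<subseteq> W1 \<inter> dom \<gamma> \<longrightarrow> Y \<subseteq> C \<longrightarrow> level_admissible P m (\<gamma> |` Y)"
    using P \<gamma> unfolding controllable_def by blast
  obtain W2 where W2: "openin T W2" "x \<in> W2"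
    "\<forall>C Y. compactin T C \<longrightarrow> C \<subseteq> W2 \<inter> dom \<gamma> \<longrightarrow> Y \<subseteq> C \<longrightarrow> level_admissible Q m (\<gamma> |` Y)"
    using Q \<gamma> unfolding controllable_def by blast
  have "openin T (W1 \<inter> W2)" "x \<in> W1 \<inter> W2" using W1 W2 by blast+
  moreover have "level_admissible (\<lambda>\<epsilon> \<delta> g. P \<epsilon> \<delta> g \<and> Q \<epsilon> \<delta> g) m (\<gamma> |` Y)"
    if C: "compactin T C" "C \<subseteq> W1 \<inter> W2 \<inter> dom \<gamma>" "Y \<subseteq> C" for C Y
  proof (rule both)
    show "level_admissible P m (\<gamma> |` Y)" using W1(3)[rule_format, OF C(1) _ C(3)] C(2) by blast
    show "level_admissible Q m (\<gamma> |` Y)" using W2(3)[rule_format, OF C(1) _ C(3)] C(2) by blast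
  qed
  ultimately show "\<exists>W. openin T W \<and> x \<in> W \<and> (\<forall>C Y. compactin T C \<longrightarrow> C \<subseteq> W \<inter> dom \<gamma> \<longrightarrow> Y \<subseteq> C \<longrightarrow>
      level_admissible (\<lambda>\<epsilon> \<delta> g. P \<epsilon> \<delta> g \<and> Q \<epsilon> \<delta> g) m (\<gamma> |` Y))"
    by blast
qed

text \<open>The space is a union of compact sets \<open>K m\<close>. Cover \<open>K m\<close> by finitely many pieces of level \<open>m\<close>.
Given \<open>\<epsilon>\<close>, the pieces of all levels \<open>m\<close> with \<open>1/(m+1) \<le> \<epsilon>\<close> share the modulus 1, and only
finitely many pieces remain.\<close>

lemma exists_uniform_refinement:
  assumes P: "controllable P"
  shows "\<exists>\<Gamma>'. refinement \<Gamma>' \<and> (\<forall>\<epsilon>>0. \<exists>\<delta>>0. \<forall>g\<in>\<Gamma>'. P \<epsilon> \<delta> g)"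
proof -
  have aP: "P \<epsilon> \<delta>' g" if "P \<epsilon> \<delta> g" "\<delta>' \<le> \<delta>" for \<epsilon> \<delta> \<delta>' g
    using P that unfolding controllable_def by blast
  define A where "A m = {(\<gamma>, Y). \<gamma> \<in> \<Gamma> \<and> openin T Y \<and> Y \<subseteq> dom \<gamma> \<and> level_admissible P m (\<gamma> |` Y)}" for m
  have A_cover: "\<exists>p\<in>A m. x \<in> snd p" if x: "x \<in> topspace T" for x m
  proof -
    obtain \<gamma> where \<gamma>: "\<gamma> \<in> \<Gamma>" "x \<in> dom \<gamma>" using \<Gamma>_cover[OF x] by blast
    obtain W where W: "openin T W" "x \<in> W" "\<forall>C Y. compactin T C \<longrightarrow> C \<subseteq> W \<inter> dom \<gamma> \<longrightarrow> Y \<subseteq> C \<longrightarrow> level_admissible P m (\<gamma> |` Y)"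
      using P \<gamma> unfolding controllable_def by blast
    have "openin T (dom \<gamma>)" using \<gamma>(1) \<Gamma>_G G_Ph Ph_dom by blast
    then have "openin T (W \<inter> dom \<gamma>)" using W(1) by blast
    then obtain Y C where Y: "openin T Y" "compactin T C" "x \<in> Y" "Y \<subseteq> C" "C \<subseteq> W \<inter> dom \<gamma>"
      using compact_neighbourhood[OF locally_compact Hausdorff, of "W \<inter> dom \<gamma>" x] W(2) \<gamma>(2) by (metis IntI)
    then have "level_admissible P m (\<gamma> |` Y)" using W(3) by blast
    then have "(\<gamma>, Y) \<in> A m" using Y \<gamma> unfolding A_def by blast
    then show ?thesis using Y(3) by (intro bexI[of _ "(\<gamma>, Y)"]) simp_all
  qed
  obtain K :: "nat \<Rightarrow> 'z set" where K: "\<And>m. compactin T (K m)" "topspace T \<subseteq> (\<Union>m. K m)"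
    using sigma_compact by blast
  have "\<exists>F. finite F \<and> F \<subseteq> A m \<and> K m \<subseteq> \<Union>(snd ` F)" for m
  proof -
    have "\<forall>V\<in>snd ` A m. openin T V" by (auto simp: A_def)
    moreover have "K m \<subseteq> \<Union>(snd ` A m)"
    proof
      fix x assume "x \<in> K m"
      then have "x \<in> topspace T" using compactin_subset_topspace[OF K(1)] by blast
      then show "x \<in> \<Union>(snd ` A m)" using A_cover[of x m] by blast
    qed
    ultimately obtain \<F> where "finite \<F>" "\<F> \<subseteq> snd ` A m" "K m \<subseteq> \<Union>\<F>"
      using K(1)[of m] unfolding compactin_def by meson
    then show ?thesis by (metis finite_subset_image)
  qed
  then obtain F where F: "\<And>m. finite (F m)" "\<And>m. F m \<subseteq> A m" "\<And>m. K m \<subseteq> \<Union>(snd ` F m)" by metis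
  define level where "level m = (\<lambda>(\<gamma>, Y). \<gamma> |` Y) ` F m" for m
  have level_fine: "level_admissible P m g" if "g \<in> level m" for g m
    using that F(2) by (auto simp: level_def A_def)
  have ref: "refinement (\<Union>m. level m)"
    unfolding refinement_def
  proof (intro conjI ballI)
    fix g assume "g \<in> (\<Union>m. level m)"
    then show "\<exists>\<gamma>\<in>\<Gamma>. \<exists>Y. openin T Y \<and> g = \<gamma> |` Y" using F(2) by (fastforce simp: level_def A_def)
  next
    fix x assume "x \<in> topspace T"
    then obtain m where "x \<in> K m" using K(2) by blast
    then obtain p where p: "p \<in> F m" "x \<in> snd p" using F(3) by blast
    then have "p \<in> A m" using F(2) by blast
    then have "x \<in> dom (fst p |` snd p)" using p(2) by (auto simp: A_def)
    moreover have "fst p |` snd p \<in> level m" using p(1) by (force simp: level_def)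
    ultimately show "\<exists>g\<in>\<Union>m. level m. x \<in> dom g" by blast
  qed
  have "\<exists>\<delta>>0. \<forall>g\<in>\<Union>m. level m. P \<epsilon> \<delta> g" if \<epsilon>: "\<epsilon> > 0" for \<epsilon>
  proof -
    obtain n :: nat where n: "1 / real (Suc n) < \<epsilon>" using reals_Archimedean[OF \<epsilon>] by (auto simp: inverse_eq_divide)
    define E where "E = (\<Union>m<n. level m)"
    have finE: "finite E" using F(1) by (simp add: E_def level_def)
    have "\<forall>g\<in>E. \<exists>\<delta>>0. P \<epsilon> \<delta> g" using level_fine \<epsilon> unfolding E_def level_admissible_def by blast
    then obtain D where D: "\<And>g. g \<in> E \<Longrightarrow> D g > 0" "\<And>g. g \<in> E \<Longrightarrow> P \<epsilon> (D g) g" by metis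
    define \<delta> where "\<delta> = Min (insert 1 (D ` E))"
    have \<delta>: "\<delta> > 0" "\<delta> \<le> 1" "\<And>g. g \<in> E \<Longrightarrow> \<delta> \<le> D g" using D(1) finE by (auto simp: \<delta>_def)
    have "P \<epsilon> \<delta> g" if g: "g \<in> level m" for g m
    proof (cases "m < n")
      case True
      then have "g \<in> E" using g by (auto simp: E_def)
      then show ?thesis using aP[OF D(2) \<delta>(3)] by blast
    next
      case False
      then have "1 / real (Suc m) \<le> 1 / real (Suc n)" by (intro divide_left_mono) auto
      then have "P \<epsilon> 1 g" using level_fine[OF g] n unfolding level_admissible_def by simp
      then show ?thesis using aP \<delta>(2) by blast
    qed
    then show ?thesis using \<delta>(1) by blast
  qed
  then show ?thesis using ref by blast
qed

text \<open>A modulus of continuity for the inverse of the return map, and one for the return map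
followed by any word.\<close>

definition inverse_control :: "('z \<Rightarrow> 'z \<Rightarrow> ennreal) \<Rightarrow> real \<Rightarrow> real \<Rightarrow> ('z \<rightharpoonup> 'z) \<Rightarrow> bool" where
  "inverse_control d \<epsilon> \<delta> g \<longleftrightarrow> (\<forall>x y u v. g x = Some u \<longrightarrow> g y = Some v \<longrightarrow>
      d u v < ennreal \<delta> \<longrightarrow> d x y < ennreal \<epsilon>)"

definition word_control :: "('z \<Rightarrow> 'z \<Rightarrow> ennreal) \<Rightarrow> real \<Rightarrow> real \<Rightarrow> ('z \<rightharpoonup> 'z) \<Rightarrow> bool" where
  "word_control d \<epsilon> \<delta> g \<longleftrightarrow> (\<forall>b\<in>words T L. \<forall>x y u v w w'. g x = Some u \<longrightarrow> g y = Some v \<longrightarrow>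
      d x y < ennreal \<delta> \<longrightarrow> b u = Some w \<longrightarrow> b v = Some w' \<longrightarrow> d w w' < ennreal \<epsilon>)"

text \<open>Smallness at level \<open>m\<close> comes from cutting down to a ball of diameter \<open>1/(m+1)\<close>. The modulus for
other \<open>\<epsilon>\<close> is a Lebesgue number on the compact image of the piece.\<close>

lemma inverse_controllable:
  assumes d: "compatible_metric T d"
  shows "controllable (inverse_control d)"
  unfolding controllable_def
proof (intro conjI ballI allI)
  show "inverse_control d \<epsilon> \<delta> g \<longrightarrow> \<delta>' \<le> \<delta> \<longrightarrow> inverse_control d \<epsilon> \<delta>' g" for \<epsilon> \<delta> \<delta>' g
    unfolding inverse_control_def using ennreal_leI less_le_trans by meson
  fix \<gamma> x and m :: nat assume \<gamma>: "\<gamma> \<in> \<Gamma>" "x \<in> dom \<gamma>"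
  have \<gamma>P: "\<gamma> \<in> Ph T" using \<gamma>(1) \<Gamma>_G G_Ph by blast
  have xT: "x \<in> topspace T" using \<gamma>(2) Ph_topspace(1)[OF \<gamma>P] by blast
  have half: "d a b < ennreal \<epsilon>" if "a \<in> eball T d p (\<epsilon>/2)" "b \<in> eball T d p (\<epsilon>/2)" "p \<in> topspace T" for a b p \<epsilon>
  proof -
    have T: "a \<in> topspace T" "p \<in> topspace T" "b \<in> topspace T" using that by (auto simp: eball_def)
    have "d a p < ennreal (\<epsilon>/2)" "d p b < ennreal (\<epsilon>/2)"
      using that compatible_metricD(2)[OF d T(1,2)] by (auto simp: eball_def)
    from compatible_metric_triangle_less[OF d T this] show ?thesis by simp
  qed
  define W where "W = eball T d x (1 / real (Suc m) / 2)"
  have W: "openin T W" "x \<in> W" unfolding W_def using xT by (auto intro: openin_eball[OF d] centre_in_eball[OF d])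
  have "level_admissible (inverse_control d) m (\<gamma> |` Y)"
    if C: "compactin T C" "C \<subseteq> W \<inter> dom \<gamma>" "Y \<subseteq> C" for C Y
    unfolding level_admissible_def
  proof (intro conjI allI impI)
    fix \<epsilon> :: real assume \<epsilon>: "1 / real (Suc m) \<le> \<epsilon>"
    have "d a b < ennreal \<epsilon>" if "a \<in> Y" "b \<in> Y" for a b
    proof -
      have "d a b < ennreal (1 / real (Suc m))" using half[of a x _ b] that C(2,3) xT unfolding W_def by blast
      also have "\<dots> \<le> ennreal \<epsilon>" using \<epsilon> by (rule ennreal_leI)
      finally show ?thesis .
    qed
    then show "inverse_control d \<epsilon> 1 (\<gamma> |` Y)" unfolding inverse_control_def by (simp add: restrict_map_Some_iff)
  next
    fix \<epsilon> :: real assume \<epsilon>: "\<epsilon> > 0"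
    let ?\<V> = "{V. \<forall>a\<in>preim \<gamma> V. \<forall>b\<in>preim \<gamma> V. d a b < ennreal \<epsilon>}"
    have "\<exists>V\<in>?\<V>. openin T V \<and> z \<in> V" if z: "z \<in> img \<gamma> C" for z
    proof -
      obtain a where a: "a \<in> C" "\<gamma> a = Some z" using z by (auto simp: img_def)
      have aT: "a \<in> topspace T" using Ph_topspace(1)[OF \<gamma>P a(2)] .
      let ?E = "eball T d a (\<epsilon>/2)"
      have "openin T (img \<gamma> ?E)" using \<epsilon> by (intro Ph_img[OF \<gamma>P] openin_eball[OF d aT]) simp
      moreover have "z \<in> img \<gamma> ?E" using centre_in_eball[OF d aT, of "\<epsilon>/2"] \<epsilon> a(2) by (auto simp: img_def)
      moreover have "preim \<gamma> (img \<gamma> ?E) \<subseteq> ?E"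
        using Ph_inj[OF \<gamma>P] unfolding preim_def img_def by blast
      then have "img \<gamma> ?E \<in> ?\<V>" using half[OF _ _ aT] by blast
      ultimately show ?thesis by blast
    qed
    from Lebesgue_number[OF d compactin_img[OF \<gamma>P C(1)] this] C(2)
    obtain \<delta> where \<delta>: "\<delta> > 0" "\<forall>z\<in>img \<gamma> C. \<exists>V\<in>?\<V>. eball T d z \<delta> \<subseteq> V" by blast
    have "d a b < ennreal \<epsilon>" if ab: "a \<in> Y" "\<gamma> a = Some u" "\<gamma> b = Some v" "d u v < ennreal \<delta>" for a b u v
    proof -
      have "u \<in> img \<gamma> C" using ab(1,2) C(3) by (auto simp: img_def)
      then obtain V where V: "V \<in> ?\<V>" "eball T d u \<delta> \<subseteq> V" using \<delta>(2) by blast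
      have "u \<in> V" using centre_in_eball[OF d Ph_topspace(2)[OF \<gamma>P ab(2)] \<delta>(1)] V(2) by blast
      moreover have "v \<in> V" using ab(4) Ph_topspace(2)[OF \<gamma>P ab(3)] V(2) by (auto simp: eball_def)
      ultimately have "a \<in> preim \<gamma> V" "b \<in> preim \<gamma> V" using ab(2,3) by (auto simp: preim_def)
      then show ?thesis using V(1) by blast
    qed
    then have "inverse_control d \<epsilon> \<delta> (\<gamma> |` Y)"
      unfolding inverse_control_def restrict_map_Some_iff by blast
    then show "\<exists>\<delta>>0. inverse_control d \<epsilon> \<delta> (\<gamma> |` Y)" using \<delta>(1) by blast
  qed
  then show "\<exists>W. openin T W \<and> x \<in> W \<and> (\<forall>C Y. compactin T C \<longrightarrow> C \<subseteq> W \<inter> dom \<gamma> \<longrightarrow> Y \<subseteq> C \<longrightarrow>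
      level_admissible (inverse_control d) m (\<gamma> |` Y))"
    using W by blast
qed

text \<open>Both requirements come from preimages under the return map of sets that are small under all words:
one for \<open>1/(m+1)\<close> contains the piece, and those for \<open>\<epsilon>\<close> cover the compact set around the piece, so
that a Lebesgue number of this cover is a modulus.\<close>

lemma word_controllable:
  assumes d: "compatible_metric T d" and calm: "\<And>\<epsilon>. \<epsilon> > 0 \<Longrightarrow> calm d \<epsilon> = topspace T"
  shows "controllable (word_control d)"
  unfolding controllable_def
proof (intro conjI ballI allI)
  show "word_control d \<epsilon> \<delta> g \<longrightarrow> \<delta>' \<le> \<delta> \<longrightarrow> word_control d \<epsilon> \<delta>' g" for \<epsilon> \<delta> \<delta>' g
    unfolding word_control_def using ennreal_leI less_le_trans by meson
  fix \<gamma> x and m :: nat assume \<gamma>: "\<gamma> \<in> \<Gamma>" "x \<in> dom \<gamma>"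
  have \<gamma>P: "\<gamma> \<in> Ph T" using \<gamma>(1) \<Gamma>_G G_Ph by blast
  have near: "\<exists>N. small d \<epsilon> N \<and> a \<in> preim \<gamma> N" if \<epsilon>: "\<epsilon> > 0" and a: "\<gamma> a = Some u" for \<epsilon> a u
  proof -
    have "a \<in> calm d \<epsilon>" using calm[OF \<epsilon>] Ph_topspace(1)[OF \<gamma>P a] by simp
    from calm_return[OF refinement_self this \<gamma>(1) a] show ?thesis using a by (auto simp: preim_def)
  qed
  obtain u where "\<gamma> x = Some u" using \<gamma>(2) by blast
  from near[OF _ this, of "1 / real (Suc m)"]
  obtain N where N: "small d (1 / real (Suc m)) N" "x \<in> preim \<gamma> N" by auto
  define W where "W = preim \<gamma> N"
  have W: "openin T W" "x \<in> W" unfolding W_def using N by (auto intro!: Ph_preim[OF \<gamma>P] simp: small_def)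
  have "level_admissible (word_control d) m (\<gamma> |` Y)"
    if C: "compactin T C" "C \<subseteq> W \<inter> dom \<gamma>" "Y \<subseteq> C" for C Y
    unfolding level_admissible_def
  proof (intro conjI allI impI)
    fix \<epsilon> :: real assume \<epsilon>: "1 / real (Suc m) \<le> \<epsilon>"
    show "word_control d \<epsilon> 1 (\<gamma> |` Y)"
      unfolding word_control_def restrict_map_Some_iff
    proof (intro ballI allI impI)
      fix b a a' u v w w'
      assume h: "b \<in> words T L" "a \<in> Y \<and> \<gamma> a = Some u" "a' \<in> Y \<and> \<gamma> a' = Some v" "b u = Some w" "b v = Some w'"
      have "u \<in> N" "v \<in> N" using h(2,3) C(2,3) by (auto simp: W_def preim_def)
      then have "d w w' < ennreal (1 / real (Suc m))" using smallD[OF N(1) h(1) _ _ h(4,5)] by blast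
      also have "\<dots> \<le> ennreal \<epsilon>" using \<epsilon> by (rule ennreal_leI)
      finally show "d w w' < ennreal \<epsilon>" .
    qed
  next
    fix \<epsilon> :: real assume \<epsilon>: "\<epsilon> > 0"
    let ?\<V> = "{V. \<exists>N. small d \<epsilon> N \<and> V = preim \<gamma> N}"
    have "\<exists>V\<in>?\<V>. openin T V \<and> a \<in> V" if a: "a \<in> C" for a
    proof -
      obtain u where u: "\<gamma> a = Some u" using a C(2) by blast
      obtain N where N: "small d \<epsilon> N" "a \<in> preim \<gamma> N" using near[OF \<epsilon> u] by blast
      then have "openin T (preim \<gamma> N)" by (intro Ph_preim[OF \<gamma>P]) (simp add: small_def)
      then show ?thesis using N by blast
    qed
    from Lebesgue_number[OF d C(1) this]
    obtain \<delta> where \<delta>: "\<delta> > 0" "\<forall>a\<in>C. \<exists>V\<in>?\<V>. eball T d a \<delta> \<subseteq> V" by blast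
    have "word_control d \<epsilon> \<delta> (\<gamma> |` Y)"
      unfolding word_control_def restrict_map_Some_iff
    proof (intro ballI allI impI)
      fix b a a' u v w w'
      assume h: "b \<in> words T L" "a \<in> Y \<and> \<gamma> a = Some u" "a' \<in> Y \<and> \<gamma> a' = Some v" "d a a' < ennreal \<delta>"
         "b u = Some w" "b v = Some w'"
      then obtain N where N: "small d \<epsilon> N" "eball T d a \<delta> \<subseteq> preim \<gamma> N" using \<delta>(2) C(3) by blast
      have T: "a \<in> topspace T" "a' \<in> topspace T" using Ph_topspace(1)[OF \<gamma>P] h(2,3) by blast+
      have "a \<in> preim \<gamma> N" using centre_in_eball[OF d T(1) \<delta>(1)] N(2) by blast
      moreover have "a' \<in> preim \<gamma> N" using h(4) T(2) N(2) by (auto simp: eball_def)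
      ultimately have "u \<in> N" "v \<in> N" using h(2,3) by (auto simp: preim_def)
      then show "d w w' < ennreal \<epsilon>" using smallD[OF N(1) h(1) _ _ h(5,6)] by blast
    qed
    then show "\<exists>\<delta>>0. word_control d \<epsilon> \<delta> (\<gamma> |` Y)" using \<delta>(1) by blast
  qed
  then show "\<exists>W. openin T W \<and> x \<in> W \<and> (\<forall>C Y. compactin T C \<longrightarrow> C \<subseteq> W \<inter> dom \<gamma> \<longrightarrow> Y \<subseteq> C \<longrightarrow>
      level_admissible (word_control d) m (\<gamma> |` Y))"
    using W by blast
qed

section \<open>The two dichotomies for pseudogroups\<close>

text \<open>The calm sets are open and invariant, so transitivity makes them dense, and Baire's theorem
applies to their intersection \<open>R\<close>. At a point of \<open>R\<close> one return map \<open>\<gamma>\<close> is fixed to choose \<open>\<delta>\<close>; a map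
\<open>\<gamma>\<^sub>2\<^sup>-\<^sup>1 b \<gamma>\<^sub>1\<close> is then compared with it by writing \<open>\<gamma>\<^sub>1\<close> as a word after \<open>\<gamma>\<close>. This matters because infinitely
many \<open>\<gamma>\<^sub>1\<close> can be defined near the point.\<close>

theorem sensitive_or_almost_equicontinuous:
  assumes trans: "topologically_transitive T G" and ns: "\<not> sensitive T G"
  shows "almost_equicontinuous T G"
proof -
  obtain d where d: "compatible_metric T d" and ne: "\<And>\<epsilon>. \<epsilon> > 0 \<Longrightarrow> calm d \<epsilon> \<noteq> {}"
    using not_sensitive_imp_calm[OF ns] by blast
  have dense: "T closure_of (calm d \<epsilon>) = topspace T" if \<epsilon>: "\<epsilon> > 0" for \<epsilon>
    unfolding dense_intersects_open
  proof (intro allI impI)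
    fix V assume V: "openin T V \<and> V \<noteq> {}"
    obtain g where g: "g \<in> G" "(\<lambda>x. the (g x)) ` (V \<inter> dom g) \<inter> calm d \<epsilon> \<noteq> {}"
      using trans V ne[OF \<epsilon>] openin_calm[of d \<epsilon>] unfolding topologically_transitive_def by meson
    then obtain x y where x: "x \<in> V" "g x = Some y" "y \<in> calm d \<epsilon>" by auto
    have "inv_Ph g y = Some x" using inv_Ph_iff[OF subsetD[OF G_Ph g(1)]] x(2) by simp
    then have "x \<in> calm d \<epsilon>"
      using calm_invariant[OF pseudo_star_groupD(3)[OF pseudo_star_group_G g(1)]] x(3) by blast
    then show "calm d \<epsilon> \<inter> V \<noteq> {}" using x(1) by blast
  qed
  define R where "R = (\<Inter>n. calm d (1 / real (Suc n)))"
  have "T closure_of R = topspace T"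
    unfolding R_def
  proof (rule Baire_category)
    show "completely_metrizable_space T \<or> locally_compact_space T \<and> regular_space T"
      using locally_compact Hausdorff locally_compact_Hausdorff_imp_regular_space by blast
    show "openin T D \<and> T closure_of D = topspace T" if "D \<in> range (\<lambda>n. calm d (1 / real (Suc n)))" for D
      using that openin_calm dense by auto
  qed simp
  obtain \<Gamma>' where ref: "refinement \<Gamma>'" and unif: "\<And>\<epsilon>. \<epsilon> > 0 \<Longrightarrow> \<exists>\<delta>>0. \<forall>g\<in>\<Gamma>'. inverse_control d \<epsilon> \<delta> g"
    using exists_uniform_refinement[OF inverse_controllable[OF d]] by blast
  note star_transit = star_eq[OF transit_pseudo_star_group[OF ref]]
  have "equicontinuous_point T (transit \<Gamma>') d x" if x: "x \<in> topspace T" "x \<in> R" for x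
    unfolding equicontinuous_point_def star_transit
  proof (intro allI impI)
    fix \<epsilon> :: real assume \<epsilon>: "\<epsilon> > 0"
    obtain \<delta>1 where \<delta>1: "\<delta>1 > 0" "\<forall>g\<in>\<Gamma>'. inverse_control d \<epsilon> \<delta>1 g" using unif[OF \<epsilon>] by blast
    obtain n :: nat where n: "1 / real (Suc n) < \<delta>1"
      using reals_Archimedean[OF \<delta>1(1)] by (auto simp: inverse_eq_divide)
    have "x \<in> calm d (1 / real (Suc n))" using x(2) by (simp add: R_def)
    then have xc: "x \<in> calm d \<delta>1" using calm_mono[of "1 / real (Suc n)" \<delta>1 d] n by auto
    obtain \<gamma> where \<gamma>: "\<gamma> \<in> \<Gamma>'" "x \<in> dom \<gamma>" using refinement_cover[OF ref x(1)] by blast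
    obtain u where u: "\<gamma> x = Some u" using \<gamma>(2) by blast
    obtain N where N: "small d \<delta>1 N" "u \<in> N" using calm_return[OF ref xc \<gamma>(1) u] by blast
    have \<gamma>P: "\<gamma> \<in> Ph T" using \<gamma>(1) refinement_G[OF ref] G_Ph by blast
    have "openin T (preim \<gamma> N)" using N(1) by (intro Ph_preim[OF \<gamma>P]) (simp add: small_def)
    moreover have "x \<in> preim \<gamma> N" using N(2) u by (auto simp: preim_def)
    ultimately obtain \<delta>2 where \<delta>2: "\<delta>2 > 0" "eball T d x \<delta>2 \<subseteq> preim \<gamma> N" using openin_contains_eball[OF d] by blast
    define \<delta> where "\<delta> = min \<epsilon> \<delta>2"
    have "d (the (t x)) (the (t y)) < ennreal \<epsilon>"
      if t: "t \<in> transit \<Gamma>'" "x \<in> dom t" "y \<in> dom t" "d x y < ennreal \<delta>" for t y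
    proof -
      have tP: "t \<in> Ph T" using t(1) transit_Ph by blast
      obtain x' y' where xy: "t x = Some x'" "t y = Some y'" using t by blast
      have "ennreal \<delta> \<le> ennreal \<epsilon>" "ennreal \<delta> \<le> ennreal \<delta>2" by (auto simp: \<delta>_def intro: ennreal_leI)
      then have dd: "d x y < ennreal \<epsilon>" "d x y < ennreal \<delta>2" using t(4) by (auto intro: less_le_trans)
      have "d x' y' < ennreal \<epsilon>" using t(1)
      proof (cases rule: transit_cases)
        case trivial
        then show ?thesis using dd(1) trivial[OF xy(1)] trivial[OF xy(2)] by simp
      next
        case (passage \<gamma>1 \<gamma>2 b)
        have "y \<in> eball T d x \<delta>2" using dd(2) Ph_topspace(1)[OF tP xy(2)] by (simp add: eball_def)
        then obtain v where v: "\<gamma> y = Some v" "v \<in> N" using \<delta>2(2) by (auto simp: preim_def)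
        obtain p p' where p: "\<gamma>1 x = Some p" "b p = Some p'" "\<gamma>2 x' = Some p'" using passage(4)[OF xy(1)] by blast
        obtain q q' where q: "\<gamma>1 y = Some q" "b q = Some q'" "\<gamma>2 y' = Some q'" using passage(4)[OF xy(2)] by blast
        obtain a where a: "a \<in> words T L" "\<And>x y y'. \<gamma> x = Some y \<Longrightarrow> \<gamma>1 x = Some y' \<Longrightarrow> a y = Some y'"
          by (rule refinement_change[OF ref ref \<gamma>(1) passage(1)]) (rule that; blast)
        obtain e where e: "e \<in> words T L" "\<And>x y z. a x = Some y \<Longrightarrow> b y = Some z \<Longrightarrow> e x = Some z"
          by (rule words_comp[OF L_Ph a(1) passage(3)]) (rule that; blast)
        have "e u = Some p'" "e v = Some q'"
          using e(2)[OF a(2)[OF u p(1)] p(2)] e(2)[OF a(2)[OF v(1) q(1)] q(2)] .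
        then have "d p' q' < ennreal \<delta>1" using smallD[OF N(1) e(1) N(2) v(2)] by blast
        moreover have "inverse_control d \<epsilon> \<delta>1 \<gamma>2" using \<delta>1(2) passage(2) by blast
        ultimately show ?thesis using p(3) q(3) unfolding inverse_control_def by blast
      qed
      then show ?thesis using xy by simp
    qed
    moreover have "\<delta> > 0" using \<epsilon> \<delta>2(1) by (simp add: \<delta>_def)
    ultimately show "\<exists>\<delta>>0. \<forall>s\<in>transit \<Gamma>'. \<forall>y. x \<in> dom s \<and> y \<in> dom s \<and> d x y < ennreal \<delta> \<longrightarrow>
        d (the (s x)) (the (s y)) < ennreal \<epsilon>" by blast
  qed
  then have "topspace T \<inter> R \<subseteq> {x \<in> topspace T. equicontinuous_point T (transit \<Gamma>') d x}" by blast
  then have "T closure_of (topspace T \<inter> R) \<subseteq> T closure_of {x \<in> topspace T. equicontinuous_point T (transit \<Gamma>') d x}"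
    by (rule closure_of_mono)
  then have "T closure_of {x \<in> topspace T. equicontinuous_point T (transit \<Gamma>') d x} = topspace T"
    using \<open>T closure_of R = topspace T\<close> closure_of_restrict[of T R] closure_of_subset_topspace
    by (metis subset_antisym)
  then show ?thesis unfolding almost_equicontinuous_def using transit_generates[OF ref] d by blast
qed

text \<open>Minimality makes the calm sets the whole space, which allows control of all words along the
return maps, uniformly over the pieces. The modulus is found backwards: first the one for the last
leg \<open>\<gamma>\<^sub>2\<^sup>-\<^sup>1\<close>, then the one for \<open>b \<gamma>\<^sub>1\<close> with that target.\<close>

theorem sensitive_or_equicontinuous:
  assumes minimal: "\<And>D. openin T D \<Longrightarrow> D \<noteq> {} \<Longrightarrow>
      (\<And>g x y. g \<in> G \<Longrightarrow> g x = Some y \<Longrightarrow> x \<in> D \<Longrightarrow> y \<in> D) \<Longrightarrow> D = topspace T"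
    and ns: "\<not> sensitive T G"
  shows "equicontinuous T G"
proof -
  obtain d where d: "compatible_metric T d" and ne: "\<And>\<epsilon>. \<epsilon> > 0 \<Longrightarrow> calm d \<epsilon> \<noteq> {}"
    using not_sensitive_imp_calm[OF ns] by blast
  have all_calm: "calm d \<epsilon> = topspace T" if "\<epsilon> > 0" for \<epsilon>
    using minimal[OF openin_calm ne[OF that]] calm_invariant by blast
  obtain \<Gamma>' where ref: "refinement \<Gamma>'"
    and unif: "\<forall>\<epsilon>>0. \<exists>\<delta>>0. \<forall>g\<in>\<Gamma>'. inverse_control d \<epsilon> \<delta> g \<and> word_control d \<epsilon> \<delta> g"
    using exists_uniform_refinement[OF controllable_conj[OF inverse_controllable[OF d] word_controllable[OF d all_calm]]]
    by blast
  have ex: "\<exists>\<delta>>0. \<forall>t\<in>transit \<Gamma>'. \<forall>x\<in>dom t. \<forall>y\<in>dom t.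
           d x y < ennreal \<delta> \<longrightarrow> d (the (t x)) (the (t y)) < ennreal \<epsilon>" if \<epsilon>: "\<epsilon> > 0" for \<epsilon> :: real
  proof -
    obtain \<delta>1 where \<delta>1: "\<delta>1 > 0" "\<forall>g\<in>\<Gamma>'. inverse_control d \<epsilon> \<delta>1 g \<and> word_control d \<epsilon> \<delta>1 g" using unif \<epsilon> by blast
    obtain \<delta>2 where \<delta>2: "\<delta>2 > 0" "\<forall>g\<in>\<Gamma>'. inverse_control d \<delta>1 \<delta>2 g \<and> word_control d \<delta>1 \<delta>2 g" using unif \<delta>1(1) by blast
    define \<delta> where "\<delta> = min \<epsilon> \<delta>2"
    have "d (the (t x)) (the (t y)) < ennreal \<epsilon>"
      if t: "t \<in> transit \<Gamma>'" "x \<in> dom t" "y \<in> dom t" "d x y < ennreal \<delta>" for t x y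
    proof -
      obtain x' y' where xy: "t x = Some x'" "t y = Some y'" using t by blast
      have "ennreal \<delta> \<le> ennreal \<epsilon>" "ennreal \<delta> \<le> ennreal \<delta>2" by (auto simp: \<delta>_def intro: ennreal_leI)
      then have dd: "d x y < ennreal \<epsilon>" "d x y < ennreal \<delta>2" using t(4) by (auto intro: less_le_trans)
      have "d x' y' < ennreal \<epsilon>" using t(1)
      proof (cases rule: transit_cases)
        case trivial
        then show ?thesis using dd(1) trivial[OF xy(1)] trivial[OF xy(2)] by simp
      next
        case (passage \<gamma>1 \<gamma>2 b)
        obtain p p' where p: "\<gamma>1 x = Some p" "b p = Some p'" "\<gamma>2 x' = Some p'" using passage(4)[OF xy(1)] by blast
        obtain q q' where q: "\<gamma>1 y = Some q" "b q = Some q'" "\<gamma>2 y' = Some q'" using passage(4)[OF xy(2)] by blast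
        have "word_control d \<delta>1 \<delta>2 \<gamma>1" using \<delta>2(2) passage(1) by blast
        then have "d p' q' < ennreal \<delta>1" using p(1,2) q(1,2) dd(2) passage(3) unfolding word_control_def by blast
        moreover have "inverse_control d \<epsilon> \<delta>1 \<gamma>2" using \<delta>1(2) passage(2) by blast
        ultimately show ?thesis using p(3) q(3) unfolding inverse_control_def by blast
      qed
      then show ?thesis using xy by simp
    qed
    moreover have "\<delta> > 0" using \<epsilon> \<delta>2(1) by (simp add: \<delta>_def)
    ultimately show ?thesis by blast
  qed
  then obtain \<delta> :: "real \<Rightarrow> real" where \<delta>: "\<forall>\<epsilon>>0. \<delta> \<epsilon> > 0 \<and> (\<forall>t\<in>transit \<Gamma>'. \<forall>x\<in>dom t. \<forall>y\<in>dom t.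
           d x y < ennreal (\<delta> \<epsilon>) \<longrightarrow> d (the (t x)) (the (t y)) < ennreal \<epsilon>)"
    by metis
  show ?thesis unfolding equicontinuous_def
    by (rule exI[of _ "transit \<Gamma>'"], rule exI[of _ d], rule exI[of _ \<delta>])
       (use \<delta> d transit_generates[OF ref] transit_pseudo_star_group[OF ref] in blast)
qed

end

section \<open>Charts of a foliated space and their holonomy\<close>

lemma polish_imp_Hausdorff: "polish Y \<Longrightarrow> Hausdorff_space Y"
  unfolding polish_def
  by (elim conjE, rule metrizable_imp_Hausdorff_space, rule completely_metrizable_imp_metrizable_space)

locale foliated_atlas =
  fixes n :: nat and k :: enat
    and X :: "'a topology" and F :: "'a set set"
    and I :: "'i set" and U :: "'i \<Rightarrow> 'a set"
    and \<phi> :: "'i \<Rightarrow> 'a \<Rightarrow> (nat \<Rightarrow> real) \<times> 'z" and Z :: "'i \<Rightarrow> 'z topology"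
  assumes atlas: "foliated_space_atlas n k X F I U \<phi> Z"
begin

abbreviation "T \<equiv> sum_topology Z I"
abbreviation "E \<equiv> Euclidean_space n"
text \<open>The transverse projection of the chart \<open>i\<close>, whose fibres are the plaques.\<close>

definition "p i u = snd (\<phi> i u)"

lemma openin_U: "i \<in> I \<Longrightarrow> openin X (U i)"
  using atlas by (simp add: foliated_space_atlas_def)

lemma U_subset: "i \<in> I \<Longrightarrow> U i \<subseteq> topspace X"
  by (rule openin_subset[OF openin_U])

lemma U_cover: "u \<in> topspace X \<Longrightarrow> \<exists>i\<in>I. u \<in> U i"
proof -
  assume u: "u \<in> topspace X"
  have "(\<Union>i\<in>I. U i) = topspace X" using atlas by (simp add: foliated_space_atlas_def)
  then show ?thesis using u by blast
qed

lemma chart: "i \<in> I \<Longrightarrow> homeomorphic_map (subtopology X (U i)) (prod_topology E (Z i)) (\<phi> i)"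
  using atlas by (simp add: foliated_space_atlas_def)

lemma topspace_U: "i \<in> I \<Longrightarrow> topspace (subtopology X (U i)) = U i"
  by (rule topspace_subtopology_subset[OF U_subset])

text \<open>The inverse of the chart \<open>i\<close> on the whole product, chosen to be continuous there.\<close>

definition "lift i = (SOME g. homeomorphic_maps (subtopology X (U i)) (prod_topology E (Z i)) (\<phi> i) g)"

lemma lift: "i \<in> I \<Longrightarrow> homeomorphic_maps (subtopology X (U i)) (prod_topology E (Z i)) (\<phi> i) (lift i)"
  unfolding lift_def using chart[unfolded homeomorphic_map_maps] by (rule someI_ex)

lemma \<phi>_mem: "i \<in> I \<Longrightarrow> u \<in> U i \<Longrightarrow> \<phi> i u \<in> topspace E \<times> topspace (Z i)"
proof -
  assume i: "i \<in> I" and u: "u \<in> U i"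
  have "\<phi> i ` topspace (subtopology X (U i)) \<subseteq> topspace (prod_topology E (Z i))"
    by (rule continuous_map_image_subset_topspace[OF homeomorphic_imp_continuous_map[OF chart[OF i]]])
  then show ?thesis unfolding topspace_U[OF i] topspace_prod_topology using u by blast
qed

lemma p_mem: "i \<in> I \<Longrightarrow> u \<in> U i \<Longrightarrow> p i u \<in> topspace (Z i)"
  using \<phi>_mem[of i u] by (auto simp: p_def)

lemma lift_\<phi>: "i \<in> I \<Longrightarrow> u \<in> U i \<Longrightarrow> lift i (\<phi> i u) = u"
  using lift[of i] topspace_U[of i] by (simp add: homeomorphic_maps_def)

lemma \<phi>_lift: "i \<in> I \<Longrightarrow> v \<in> topspace E \<Longrightarrow> z \<in> topspace (Z i) \<Longrightarrow> \<phi> i (lift i (v, z)) = (v, z)"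
  using lift[of i] by (simp add: homeomorphic_maps_def)

lemma continuous_lift: "i \<in> I \<Longrightarrow> continuous_map (prod_topology E (Z i)) X (lift i)"
  using lift[of i] by (simp add: homeomorphic_maps_def continuous_map_in_subtopology)

lemma lift_mem: "i \<in> I \<Longrightarrow> v \<in> topspace E \<Longrightarrow> z \<in> topspace (Z i) \<Longrightarrow> lift i (v, z) \<in> U i"
proof -
  assume i: "i \<in> I" and v: "v \<in> topspace E" "z \<in> topspace (Z i)"
  have "continuous_map (prod_topology E (Z i)) (subtopology X (U i)) (lift i)"
    using lift[OF i] by (simp add: homeomorphic_maps_def)
  from continuous_map_image_subset_topspace[OF this]
  show ?thesis unfolding topspace_U[OF i] topspace_prod_topology using v by blast
qed

lemma p_lift: "i \<in> I \<Longrightarrow> v \<in> topspace E \<Longrightarrow> z \<in> topspace (Z i) \<Longrightarrow> p i (lift i (v, z)) = z"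
  by (simp add: p_def \<phi>_lift)

text \<open>A continuous section of the transverse projection. It picks in each plaque one point of \<open>X\<close>, so that
far points of the transversal can be located in \<open>X\<close>, which is compact in the application.\<close>

definition "centre i z = lift i ((\<lambda>_. 0), z)"

lemma zero_in_E: "(\<lambda>_. 0) \<in> topspace E"
  by (simp add: topspace_Euclidean_space)

lemma centre_mem: "i \<in> I \<Longrightarrow> z \<in> topspace (Z i) \<Longrightarrow> centre i z \<in> U i"
  unfolding centre_def by (rule lift_mem[OF _ zero_in_E])

lemma p_centre: "i \<in> I \<Longrightarrow> z \<in> topspace (Z i) \<Longrightarrow> p i (centre i z) = z"
  unfolding centre_def by (rule p_lift[OF _ zero_in_E])

lemma continuous_centre:
  assumes "i \<in> I" shows "continuous_map (Z i) X (centre i)"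
proof -
  have "continuous_map (Z i) (prod_topology E (Z i)) (\<lambda>z. ((\<lambda>_. 0), z))"
    using zero_in_E by (simp add: continuous_map_pairwise o_def)
  from continuous_map_compose[OF this continuous_lift[OF assms]]
  show ?thesis by (simp add: o_def centre_def[abs_def])
qed

lemma continuous_p:
  assumes "i \<in> I" shows "continuous_map (subtopology X (U i)) (Z i) (p i)"
proof -
  have "continuous_map (subtopology X (U i)) (Z i) (snd \<circ> \<phi> i)"
    by (rule continuous_map_compose[OF homeomorphic_imp_continuous_map[OF chart[OF assms]] continuous_map_snd])
  then show ?thesis by (simp add: o_def p_def[abs_def])
qed

lemma openin_p_vimage:
  assumes i: "i \<in> I" and V: "openin (Z i) V" shows "openin X {u \<in> U i. p i u \<in> V}"
proof -
  have "openin (subtopology X (U i)) {u \<in> U i. p i u \<in> V}"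
    using openin_continuous_map_preimage[OF continuous_p[OF i] V] by (simp only: topspace_U[OF i])
  then show ?thesis using openin_U[OF i] openin_trans_full by blast
qed

lemma openin_p_image:
  assumes i: "i \<in> I" and N: "openin X N" "N \<subseteq> U i" shows "openin (Z i) (p i ` N)"
proof -
  have "open_map (subtopology X (U i)) (Z i) (snd \<circ> \<phi> i)"
    by (rule open_map_compose[OF homeomorphic_imp_open_map[OF chart[OF i]] open_map_snd])
  moreover have "openin (subtopology X (U i)) N" using N openin_subset_topspace_eq
    by (metis inf.absorb_iff2 openin_subtopology_Int2)
  ultimately have "openin (Z i) ((snd \<circ> \<phi> i) ` N)" by (simp add: open_map_def)
  then show ?thesis by (simp add: o_def p_def[abs_def])
qed

lemma transverse_coordinate_unique:
  assumes "i \<in> I" "j \<in> I" "u \<in> U i \<inter> U j" "u' \<in> U i \<inter> U j" "p j u = p j u'"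
  shows "p i u = p i u'"
proof -
  have "foliated_coordinate_change n k U \<phi> Z i j"
    using atlas assms(1,2) by (simp add: foliated_space_atlas_def)
  then obtain \<xi> \<zeta> where "\<forall>u \<in> U i \<inter> U j. \<phi> i u = (\<xi> (\<phi> j u), \<zeta> (snd (\<phi> j u)))"
    unfolding foliated_coordinate_change_def by blast
  then have "p i v = \<zeta> (p j v)" if "v \<in> U i \<inter> U j" for v using that by (simp add: p_def)
  then show ?thesis using assms by simp
qed

text \<open>In this relational form the holonomy maps are symmetric in their two charts, so that statements
about inverses and images come for free.\<close>

lemma holonomy_map_iff:
  assumes "i \<in> I" "j \<in> I"
  shows "holonomy_map U \<phi> i j x = Some y \<longleftrightarrow> (\<exists>u\<in>U i \<inter> U j. x = (j, p j u) \<and> y = (i, p i u))"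
proof -
  have the: "(THE w. \<exists>u \<in> U i \<inter> U j. p j u = p j v \<and> p i u = w) = p i v" if v: "v \<in> U i \<inter> U j" for v
  proof (rule the_equality)
    show "\<exists>u \<in> U i \<inter> U j. p j u = p j v \<and> p i u = p i v" using v by blast
    fix w assume "\<exists>u \<in> U i \<inter> U j. p j u = p j v \<and> p i u = w"
    then show "w = p i v" using transverse_coordinate_unique[OF assms _ v] by blast
  qed
  have p_eq: "p l = snd \<circ> \<phi> l" for l by (simp add: p_def fun_eq_iff)
  obtain j' z where x: "x = (j', z)" by (cases x)
  have hm: "holonomy_map U \<phi> i j x = (if j' = j \<and> z \<in> p j ` (U i \<inter> U j)
     then Some (i, THE w. \<exists>u \<in> U i \<inter> U j. p j u = z \<and> p i u = w) else None)"
    unfolding holonomy_map_def x p_eq by simp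
  show ?thesis
  proof (cases "j' = j \<and> z \<in> p j ` (U i \<inter> U j)")
    case True
    then obtain v where v: "v \<in> U i \<inter> U j" "z = p j v" "j' = j" by blast
    have "holonomy_map U \<phi> i j x = Some (i, p i v)"
      unfolding hm using True by (simp add: v(2) the[OF v(1)])
    moreover have "(\<exists>u\<in>U i \<inter> U j. x = (j, p j u) \<and> y = (i, p i u)) \<longleftrightarrow> y = (i, p i v)"
    proof
      assume "\<exists>u\<in>U i \<inter> U j. x = (j, p j u) \<and> y = (i, p i u)"
      then obtain u where u: "u \<in> U i \<inter> U j" "p j u = p j v" "y = (i, p i u)" unfolding x v(2) by auto
      then show "y = (i, p i v)" using transverse_coordinate_unique[OF assms u(1) v(1) u(2)] by simp
    next
      assume "y = (i, p i v)"
      then show "\<exists>u\<in>U i \<inter> U j. x = (j, p j u) \<and> y = (i, p i u)" using v x by blast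
    qed
    ultimately show ?thesis by auto
  next
    case False
    then have "holonomy_map U \<phi> i j x = None" unfolding hm by simp
    moreover have "\<not> (\<exists>u\<in>U i \<inter> U j. x = (j, p j u) \<and> y = (i, p i u))" using False x by blast
    ultimately show ?thesis by simp
  qed
qed

text \<open>The holonomy map restricted to the transverse projection of an open subset of \<open>U i \<inter> U j\<close>. All
letters and return maps have this form.\<close>

definition hol :: "'i \<Rightarrow> 'i \<Rightarrow> 'a set \<Rightarrow> ('i \<times> 'z \<rightharpoonup> 'i \<times> 'z)" where
  "hol i j N = holonomy_map U \<phi> i j |` ({j} \<times> p j ` N)"

lemma hol_iff:
  assumes ij: "i \<in> I" "j \<in> I" and N: "N \<subseteq> U i \<inter> U j"
  shows "hol i j N x = Some y \<longleftrightarrow> (\<exists>u\<in>N. x = (j, p j u) \<and> y = (i, p i u))"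
  unfolding hol_def restrict_map_Some_iff holonomy_map_iff[OF ij]
proof
  assume "x \<in> {j} \<times> p j ` N \<and> (\<exists>u\<in>U i \<inter> U j. x = (j, p j u) \<and> y = (i, p i u))"
  then obtain v u where "v \<in> N" "x = (j, p j v)" "u \<in> U i \<inter> U j" "x = (j, p j u)" "y = (i, p i u)" by blast
  then show "\<exists>u\<in>N. x = (j, p j u) \<and> y = (i, p i u)"
    using transverse_coordinate_unique[OF ij, of u v] N by (intro bexI[of _ v]) auto
qed (use N in blast)

lemma hol_full: "i \<in> I \<Longrightarrow> j \<in> I \<Longrightarrow> hol i j (U i \<inter> U j) = holonomy_map U \<phi> i j"
proof
  fix x assume ij: "i \<in> I" "j \<in> I"
  have "hol i j (U i \<inter> U j) x = Some y \<longleftrightarrow> holonomy_map U \<phi> i j x = Some y" for y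
    unfolding hol_iff[OF ij subset_refl] holonomy_map_iff[OF ij] ..
  then show "hol i j (U i \<inter> U j) x = holonomy_map U \<phi> i j x" by (metis not_None_eq)
qed

lemma openin_slice:
  assumes "i \<in> I" "openin (Z i) A" shows "openin T ({i} \<times> A)"
proof -
  have "{z. (j, z) \<in> {i} \<times> A} = (if j = i then A else {})" for j by auto
  then show ?thesis using assms openin_subset[OF assms(2)] by (auto simp: openin_sum_topology)
qed

lemma openin_slice_vimage: "openin T V \<Longrightarrow> i \<in> I \<Longrightarrow> openin (Z i) {z. (i, z) \<in> V}"
  by (simp add: openin_sum_topology)

lemma openin_pair_vimage:
  assumes i: "i \<in> I" and V: "openin T V" shows "openin X {u \<in> U i. (i, p i u) \<in> V}"
  using openin_p_vimage[OF i openin_slice_vimage[OF V i]] by simp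

text \<open>Images and preimages of open sets are transverse projections of open subsets of \<open>X\<close>, and transverse
projections are open maps.\<close>

lemma hol_Ph:
  assumes ij: "i \<in> I" "j \<in> I" and N: "openin X N" "N \<subseteq> U i \<inter> U j"
  shows "hol i j N \<in> Ph T"
proof -
  note iff = hol_iff[OF ij N(2)]
  have image: "openin T ({l} \<times> p l ` {u \<in> N. (m, p m u) \<in> V})"
    if lm: "l \<in> I" "m \<in> I" "N \<subseteq> U l" "N \<subseteq> U m" and V: "openin T V" for l m V
  proof -
    have "{u \<in> N. (m, p m u) \<in> V} = N \<inter> {u \<in> U m. (m, p m u) \<in> V}" using lm(4) by blast
    then have "openin X {u \<in> N. (m, p m u) \<in> V}"
      using openin_Int[OF N(1) openin_pair_vimage[OF lm(2) V]] by (simp only:)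
    moreover have "{u \<in> N. (m, p m u) \<in> V} \<subseteq> U l" using lm(3) by blast
    ultimately show ?thesis using lm(1) by (intro openin_slice openin_p_image)
  qed
  have "preim (hol i j N) V = {j} \<times> p j ` {u \<in> N. (i, p i u) \<in> V}" for V
    unfolding preim_def iff by blast
  then have 1: "openin T (preim (hol i j N) V)" if "openin T V" for V
    using image[of j i V] ij N(2) that by simp
  have "img (hol i j N) V = {i} \<times> p i ` {u \<in> N. (j, p j u) \<in> V}" for V
    unfolding img_def iff by blast
  then have 2: "openin T (img (hol i j N) V)" if "openin T V" for V
    using image[of i j V] ij N(2) that by simp
  have 3: "dom (hol i j N) \<subseteq> topspace T" "ran (hol i j N) \<subseteq> topspace T"
    using ij N(2) p_mem by (auto simp: dom_def ran_def iff)
  have 4: "x = x'" if xy: "hol i j N x = Some y" "hol i j N x' = Some y" for x x' y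
  proof -
    obtain u u' where u: "u \<in> N" "u' \<in> N" "x = (j, p j u)" "x' = (j, p j u')" "p i u = p i u'"
      using xy unfolding iff by auto
    then show ?thesis using transverse_coordinate_unique[OF ij(2,1), of u u'] N(2) by auto
  qed
  show ?thesis unfolding Ph_iff
  proof (intro conjI allI impI 3)
    show "x = x'" if "hol i j N x = Some y \<and> hol i j N x' = Some y" for x x' y
      using that by (elim conjE) (rule 4)
  qed (rule 1 2, assumption)+
qed

lemma inv_hol:
  assumes ij: "i \<in> I" "j \<in> I" and N: "openin X N" "N \<subseteq> U i \<inter> U j"
  shows "inv_Ph (hol i j N) = hol j i N"
proof
  fix y
  have N': "N \<subseteq> U j \<inter> U i" using N(2) by blast
  have "inv_Ph (hol i j N) y = Some x \<longleftrightarrow> hol j i N y = Some x" for x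
    unfolding inv_Ph_iff[OF hol_Ph[OF ij N]] hol_iff[OF ij N(2)] hol_iff[OF ij(2,1) N'] by blast
  then show "inv_Ph (hol i j N) y = hol j i N y" by (metis not_None_eq)
qed

lemma continuous_pair:
  assumes i: "i \<in> I" shows "continuous_map (subtopology X (U i)) T (\<lambda>u. (i, p i u))"
  unfolding continuous_map
proof (intro conjI allI impI)
  show "(\<lambda>u. (i, p i u)) ` topspace (subtopology X (U i)) \<subseteq> topspace T"
    using topspace_U[OF i] p_mem[OF i] i by auto
  fix V assume "openin T V"
  then have "openin X {u \<in> U i. (i, p i u) \<in> V}" by (rule openin_pair_vimage[OF i])
  then show "openin (subtopology X (U i)) {x \<in> topspace (subtopology X (U i)). (i, p i x) \<in> V}"
    unfolding topspace_U[OF i] openin_open_subtopology[OF openin_U[OF i]] by blast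
qed

lemma compactin_pair:
  assumes "i \<in> I" "compactin X C" "C \<subseteq> U i" shows "compactin T ({i} \<times> p i ` C)"
proof -
  have "compactin (subtopology X (U i)) C" using assms by (simp add: compactin_subtopology)
  then have "compactin T ((\<lambda>u. (i, p i u)) ` C)" using image_compactin continuous_pair[OF assms(1)] by blast
  moreover have "(\<lambda>u. (i, p i u)) ` C = {i} \<times> p i ` C" by auto
  ultimately show ?thesis by simp
qed

lemma topspace_T_cases:
  assumes "x \<in> topspace T" obtains i u where "i \<in> I" "u \<in> U i" "x = (i, p i u)" "u = centre i (p i u)"
proof -
  obtain i z where x: "x = (i, z)" by (cases x)
  then have "i \<in> I" "z \<in> topspace (Z i)" using assms by auto
  then show thesis using that[of i "centre i z"] x by (simp add: centre_mem p_centre)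
qed

lemma Hausdorff_X: "Hausdorff_space X"
  by (rule polish_imp_Hausdorff) (use atlas in \<open>simp add: foliated_space_atlas_def\<close>)

lemma Hausdorff_T: "Hausdorff_space T"
  unfolding Hausdorff_space_def
proof (intro allI impI)
  fix x y assume xy: "x \<in> topspace T \<and> y \<in> topspace T \<and> x \<noteq> y"
  obtain i a j b where ab: "x = (i, a)" "y = (j, b)" by (cases x, cases y)
  have ij: "i \<in> I" "a \<in> topspace (Z i)" "j \<in> I" "b \<in> topspace (Z j)" using xy ab by auto
  show "\<exists>U V. openin T U \<and> openin T V \<and> x \<in> U \<and> y \<in> V \<and> disjnt U V"
  proof (cases "i = j")
    case True
    have "Hausdorff_space (Z i)"
      by (rule polish_imp_Hausdorff) (use atlas ij(1) in \<open>simp add: foliated_space_atlas_def\<close>)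
    moreover have "a \<noteq> b" using xy ab True by simp
    ultimately obtain A B where AB: "openin (Z i) A" "openin (Z i) B" "a \<in> A" "b \<in> B" "disjnt A B"
      using ij True unfolding Hausdorff_space_def by metis
    have "disjnt ({i} \<times> A) ({i} \<times> B)" using AB(5) by (auto simp: disjnt_def)
    then show ?thesis
      using AB ij ab True by (intro exI[of _ "{i} \<times> A"] exI[of _ "{i} \<times> B"]) (auto intro: openin_slice)
  next
    case False
    then have "disjnt ({i} \<times> topspace (Z i)) ({j} \<times> topspace (Z j))" by (auto simp: disjnt_def)
    then show ?thesis using ij ab
      by (intro exI[of _ "{i} \<times> topspace (Z i)"] exI[of _ "{j} \<times> topspace (Z j)"]) (auto intro: openin_slice)
  qed
qed

end

section \<open>The holonomy pseudogroup of a compact foliated space\<close>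

locale shrunk_foliated_atlas = foliated_atlas n k X F I U \<phi> Z
  for n :: nat and k :: enat
    and X :: "'a topology" and F :: "'a set set"
    and I :: "'i set" and U :: "'i \<Rightarrow> 'a set"
    and \<phi> :: "'i \<Rightarrow> 'a \<Rightarrow> (nat \<Rightarrow> real) \<times> 'z" and Z :: "'i \<Rightarrow> 'z topology" +
  fixes W K :: "'i \<Rightarrow> 'a set"
  assumes locally_compact_X: "locally_compact_space X"
    and finite_charts: "finite {i \<in> I. U i \<noteq> {}}"
    and openin_W: "i \<in> I \<Longrightarrow> openin X (W i)"
    and compactin_K: "i \<in> I \<Longrightarrow> compactin X (K i)"
    and W_K: "i \<in> I \<Longrightarrow> W i \<subseteq> K i"
    and K_U: "i \<in> I \<Longrightarrow> K i \<subseteq> U i"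
    and W_cover: "u \<in> topspace X \<Longrightarrow> \<exists>i\<in>I. u \<in> W i"
begin

lemma W_U: "i \<in> I \<Longrightarrow> W i \<subseteq> U i"
  using W_K K_U by blast

lemma locally_compact_T: "locally_compact_space T"
  unfolding locally_compact_space_def
proof
  fix x assume "x \<in> topspace T"
  then obtain i u where u: "i \<in> I" "u \<in> U i" "x = (i, p i u)" by (rule topspace_T_cases)
  obtain Y C where Y: "openin X Y" "compactin X C" "u \<in> Y" "Y \<subseteq> C" "C \<subseteq> U i"
    using compact_neighbourhood[OF locally_compact_X Hausdorff_X openin_U[OF u(1)] u(2)] .
  have "openin T ({i} \<times> p i ` Y)" using Y u(1) by (intro openin_slice openin_p_image) auto
  moreover have "compactin T ({i} \<times> p i ` C)" using Y u(1) by (intro compactin_pair) auto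
  moreover have "x \<in> {i} \<times> p i ` Y" "{i} \<times> p i ` Y \<subseteq> {i} \<times> p i ` C" using u(3) Y by auto
  ultimately show "\<exists>U K. openin T U \<and> compactin T K \<and> x \<in> U \<and> U \<subseteq> K" by blast
qed

text \<open>Each of the finitely many nonempty charts is Lindelof and locally compact, hence a countable
union of compact sets; their transverse projections cover the transversal.\<close>

lemma sigma_compact_T: "\<exists>K::nat \<Rightarrow> ('i \<times> 'z) set. (\<forall>m. compactin T (K m)) \<and> topspace T \<subseteq> (\<Union>m. K m)"
proof -
  define Q where "Q i = {C. compactin X C \<and> C \<subseteq> U i}" for i
  have "\<exists>\<C>. countable \<C> \<and> \<C> \<subseteq> Q i \<and> U i \<subseteq> \<Union>\<C>" if i: "i \<in> I" for i
  proof -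
    have "second_countable X" using atlas by (simp add: foliated_space_atlas_def polish_def)
    then have "Lindelof_space (subtopology X (U i))"
      using second_countable_subtopology second_countable_imp_Lindelof_space by blast
    moreover define \<Y> where "\<Y> = {Y. openin X Y \<and> (\<exists>C\<in>Q i. Y \<subseteq> C)}"
    have oY: "openin (subtopology X (U i)) Y" if "Y \<in> \<Y>" for Y
      using that openin_open_subtopology[OF openin_U[OF i]] unfolding \<Y>_def Q_def by blast
    moreover have "\<Union>\<Y> = topspace (subtopology X (U i))"
    proof
      show "\<Union>\<Y> \<subseteq> topspace (subtopology X (U i))" using oY openin_subset by blast
      show "topspace (subtopology X (U i)) \<subseteq> \<Union>\<Y>"
      proof
        fix u assume "u \<in> topspace (subtopology X (U i))"
        then have "u \<in> U i" using topspace_U[OF i] by simp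
        then obtain Y C where "openin X Y" "compactin X C" "u \<in> Y" "Y \<subseteq> C" "C \<subseteq> U i"
          using compact_neighbourhood[OF locally_compact_X Hausdorff_X openin_U[OF i]] by blast
        then show "u \<in> \<Union>\<Y>" unfolding \<Y>_def Q_def by blast
      qed
    qed
    ultimately obtain \<V> where V: "countable \<V>" "\<V> \<subseteq> \<Y>" "\<Union>\<V> = U i"
      using Lindelof_spaceD[of "subtopology X (U i)" \<Y>] topspace_U[OF i] by metis
    have "\<forall>Y\<in>\<V>. \<exists>C. C \<in> Q i \<and> Y \<subseteq> C" using V(2) unfolding \<Y>_def by blast
    then obtain c where c: "\<And>Y. Y \<in> \<V> \<Longrightarrow> c Y \<in> Q i" "\<And>Y. Y \<in> \<V> \<Longrightarrow> Y \<subseteq> c Y" by metis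
    show ?thesis
    proof (intro exI conjI)
      show "countable (c ` \<V>)" using V(1) by simp
      show "c ` \<V> \<subseteq> Q i" using c(1) by blast
      show "U i \<subseteq> \<Union>(c ` \<V>)" using c(2) V(3) by blast
    qed
  qed
  then obtain \<C> where C: "\<And>i. i \<in> I \<Longrightarrow> countable (\<C> i)" "\<And>i. i \<in> I \<Longrightarrow> \<C> i \<subseteq> Q i"
    "\<And>i. i \<in> I \<Longrightarrow> U i \<subseteq> \<Union>(\<C> i)" by metis
  \<comment> \<open>The empty set makes the countable family nonempty, so that it can be enumerated.\<close>
  define \<K> where "\<K> = insert {} (\<Union>i\<in>{i \<in> I. U i \<noteq> {}}. (\<lambda>C. {i} \<times> p i ` C) ` \<C> i)"
  have "countable (\<Union>i\<in>{i \<in> I. U i \<noteq> {}}. (\<lambda>C. {i} \<times> p i ` C) ` \<C> i)"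
    using C(1) by (intro countable_UN countable_finite[OF finite_charts]) auto
  then have "countable \<K>" by (simp add: \<K>_def)
  have comp: "compactin T A" if A: "A \<in> \<K>" for A
  proof (cases "A = {}")
    case False
    then obtain i C where "i \<in> I" "C \<in> \<C> i" "A = {i} \<times> p i ` C" using A unfolding \<K>_def by blast
    then show ?thesis using C(2)[of i] by (auto simp: Q_def intro!: compactin_pair)
  qed simp
  have cov: "topspace T \<subseteq> \<Union>\<K>"
  proof
    fix x assume "x \<in> topspace T"
    then obtain i u where u: "i \<in> I" "u \<in> U i" "x = (i, p i u)" by (rule topspace_T_cases)
    then obtain C' where C': "C' \<in> \<C> i" "u \<in> C'" using C(3) by blast
    then have "{i} \<times> p i ` C' \<in> \<K>" using u unfolding \<K>_def by blast
    moreover have "x \<in> {i} \<times> p i ` C'" using u(3) C'(2) by blast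
    ultimately show "x \<in> \<Union>\<K>" by blast
  qed
  have "\<K> \<noteq> {}" by (simp add: \<K>_def)
  then have r: "range (from_nat_into \<K>) = \<K>" using \<open>countable \<K>\<close> by (simp add: range_from_nat_into)
  show ?thesis
  proof (intro exI[of _ "from_nat_into \<K>"] conjI allI)
    show "compactin T (from_nat_into \<K> m)" for m using comp from_nat_into[OF \<open>\<K> \<noteq> {}\<close>] by blast
    show "topspace T \<subseteq> (\<Union>m. from_nat_into \<K> m)" using cov r by simp
  qed
qed

definition "H = {holonomy_map U \<phi> i j | i j. i \<in> I \<and> j \<in> I}"
definition "G = holonomy_pseudogroup I U \<phi> Z"
text \<open>Charts with empty domain are left out because there may be infinitely many of them.\<close>

definition "letters = {hol i j (W i \<inter> W j) | i j. i \<in> I \<and> j \<in> I \<and> U i \<noteq> {} \<and> U j \<noteq> {}}"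
text \<open>The point \<open>z\<close> of the transversal \<open>Z i\<close> is sent to the transverse coordinate in chart \<open>j\<close> of \<open>centre i z\<close>,
provided that this point lies in \<open>W j\<close>; see \<open>return_iff\<close>. The set below consists of all points of the
overlap that lie on the same plaque as such a centre. It is open, while the centres alone may not form an open
set.\<close>

definition "return i j = hol j i {u \<in> U i \<inter> U j. centre i (p i u) \<in> W j}"
definition "returns = {return i j | i j. i \<in> I \<and> j \<in> I}"

lemma return_set_open:
  assumes "i \<in> I" "j \<in> I"
  shows "openin X {u \<in> U i \<inter> U j. centre i (p i u) \<in> W j}"
proof -
  have "openin (Z i) {z \<in> topspace (Z i). centre i z \<in> W j}"
    using openin_continuous_map_preimage[OF continuous_centre[OF assms(1)] openin_W[OF assms(2)]] .
  from openin_p_vimage[OF assms(1) this]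
  have o: "openin X {u \<in> U i. p i u \<in> {z \<in> topspace (Z i). centre i z \<in> W j}}" .
  have "{u \<in> U i \<inter> U j. centre i (p i u) \<in> W j} =
      U j \<inter> {u \<in> U i. p i u \<in> {z \<in> topspace (Z i). centre i z \<in> W j}}"
    using p_mem[OF assms(1)] by blast
  then show ?thesis using openin_Int[OF openin_U[OF assms(2)] o] by (simp only:)
qed

lemma return_set_subset: "{u \<in> U i \<inter> U j. centre i (p i u) \<in> W j} \<subseteq> U j \<inter> U i"
  by blast

lemma return_Ph: "i \<in> I \<Longrightarrow> j \<in> I \<Longrightarrow> return i j \<in> Ph T"
  unfolding return_def by (rule hol_Ph[OF _ _ return_set_open return_set_subset])

lemma return_iff:
  assumes ij: "i \<in> I" "j \<in> I"
  shows "return i j x = Some y \<longleftrightarrow>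
    (\<exists>z\<in>topspace (Z i). centre i z \<in> W j \<and> x = (i, z) \<and> y = (j, p j (centre i z)))"
proof -
  have 1: "return i j x = Some y \<longleftrightarrow>
     (\<exists>u\<in>{u \<in> U i \<inter> U j. centre i (p i u) \<in> W j}. x = (i, p i u) \<and> y = (j, p j u))"
    unfolding return_def by (rule hol_iff[OF ij(2,1) return_set_subset])
  show ?thesis unfolding 1
  proof
    assume "\<exists>u\<in>{u \<in> U i \<inter> U j. centre i (p i u) \<in> W j}. x = (i, p i u) \<and> y = (j, p j u)"
    then obtain u where u: "u \<in> U i" "u \<in> U j" "centre i (p i u) \<in> W j" "x = (i, p i u)" "y = (j, p j u)" by blast
    have z: "p i u \<in> topspace (Z i)" using p_mem ij u by blast
    have "centre i (p i u) \<in> U i \<inter> U j" using centre_mem[OF ij(1) z] W_U[OF ij(2)] u(3) by blast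
    then have "p j u = p j (centre i (p i u))"
      using transverse_coordinate_unique[OF ij(2,1), of u "centre i (p i u)"] p_centre[OF ij(1) z] u by simp
    then show "\<exists>z\<in>topspace (Z i). centre i z \<in> W j \<and> x = (i, z) \<and> y = (j, p j (centre i z))"
      using u z by auto
  next
    assume "\<exists>z\<in>topspace (Z i). centre i z \<in> W j \<and> x = (i, z) \<and> y = (j, p j (centre i z))"
    then obtain z where z: "z \<in> topspace (Z i)" "centre i z \<in> W j" "x = (i, z)" "y = (j, p j (centre i z))" by blast
    then show "\<exists>u\<in>{u \<in> U i \<inter> U j. centre i (p i u) \<in> W j}. x = (i, p i u) \<and> y = (j, p j u)"
      using centre_mem[OF ij(1) z(1)] W_U[OF ij(2)] p_centre[OF ij(1) z(1)]
      by (intro bexI[of _ "centre i z"]) auto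
  qed
qed

lemma holonomy_Ph: "i \<in> I \<Longrightarrow> j \<in> I \<Longrightarrow> holonomy_map U \<phi> i j \<in> Ph T"
  using hol_Ph[OF _ _ openin_Int[OF openin_U openin_U] subset_refl] by (simp add: hol_full)

lemma H_holonomy_Ph: "H \<subseteq> Ph T"
  unfolding H_def using holonomy_Ph by blast

lemma G_H: "G = generated_pseudogroup T H"
  by (simp add: G_def H_def holonomy_pseudogroup_def)

lemma pseudo_star_group_holonomy: "pseudo_star_group T G"
  using pseudogroup_hull[OF H_holonomy_Ph] by (simp add: G_H pseudogroup_def)

lemma holonomy_G: "i \<in> I \<Longrightarrow> j \<in> I \<Longrightarrow> holonomy_map U \<phi> i j \<in> G"
  unfolding G_H generated_pseudogroup_def H_def by (rule hull_inc) blast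

lemma letter_open: "i \<in> I \<Longrightarrow> j \<in> I \<Longrightarrow> openin X (W i \<inter> W j)"
  using openin_W by blast

lemma letter_subset: "i \<in> I \<Longrightarrow> j \<in> I \<Longrightarrow> W i \<inter> W j \<subseteq> U i \<inter> U j"
  using W_U by blast

lemma letters_Ph: "letters \<subseteq> Ph T"
proof
  fix c assume "c \<in> letters"
  then obtain i j where "c = hol i j (W i \<inter> W j)" "i \<in> I" "j \<in> I" unfolding letters_def by blast
  then show "c \<in> Ph T" using hol_Ph[OF _ _ letter_open letter_subset] by simp
qed

lemma letters_inverse:
  assumes "c \<in> letters" shows "inv_Ph c \<in> letters"
proof -
  obtain i j where c: "c = hol i j (W i \<inter> W j)" "i \<in> I" "j \<in> I" "U i \<noteq> {}" "U j \<noteq> {}"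
    using assms unfolding letters_def by blast
  have "inv_Ph c = hol j i (W j \<inter> W i)"
    using inv_hol[OF c(2,3) letter_open[OF c(2,3)] letter_subset[OF c(2,3)]] c(1) by (simp add: Int_commute)
  then show ?thesis using c unfolding letters_def by blast
qed

lemma letter_word_at:
  assumes ij: "i \<in> I" "j \<in> I" and u: "u \<in> W i \<inter> W j"
  shows "\<exists>b\<in>words T letters. \<forall>v\<in>W i \<inter> W j. b (j, p j v) = Some (i, p i v)"
proof -
  have "U i \<noteq> {}" "U j \<noteq> {}" using letter_subset[OF ij] u by blast+
  then have "hol i j (W i \<inter> W j) \<in> letters" using ij unfolding letters_def by blast
  then obtain b where b: "b \<in> words T letters" "\<And>x y. hol i j (W i \<inter> W j) x = Some y \<Longrightarrow> b x = Some y"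
    by (rule letter_in_words[OF letters_Ph]) (rule that, assumption, simp)
  have "b (j, p j v) = Some (i, p i v)" if "v \<in> W i \<inter> W j" for v
    using that by (intro b(2)) (auto simp: hol_iff[OF ij letter_subset[OF ij]])
  then show ?thesis using b(1) by blast
qed

text \<open>A plaque is a copy of \<open>\<real>\<^sup>n\<close>, hence connected, and the sets \<open>W l\<close> cover it. If a property does not
change within any \<open>W l\<close>, the points with the property and those without it form two open sets.\<close>

lemma plaque_induct:
  assumes i: "i \<in> I" and z: "z \<in> topspace (Z i)"
    and step: "\<And>l u u'. l \<in> I \<Longrightarrow> u \<in> U i \<inter> W l \<Longrightarrow> u' \<in> U i \<inter> W l \<Longrightarrow> p i u = z \<Longrightarrow> p i u' = z \<Longrightarrow> A u \<Longrightarrow> A u'"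
    and u: "u \<in> U i" "p i u = z" "A u" and u': "u' \<in> U i" "p i u' = z"
  shows "A u'"
proof -
  define f where "f v = lift i (v, z)" for v
  have "continuous_map E (prod_topology E (Z i)) (\<lambda>v. (v, z))"
    using z by (simp add: continuous_map_pairwise o_def)
  from continuous_map_compose[OF this continuous_lift[OF i]]
  have cont: "continuous_map E X f" by (simp add: o_def f_def[abs_def])
  have f: "f v \<in> U i" "p i (f v) = z" if "v \<in> topspace E" for v
    using that lift_mem[OF i _ z] p_lift[OF i _ z] by (auto simp: f_def)
  have onto: "\<exists>v\<in>topspace E. f v = a" if "a \<in> U i" "p i a = z" for a
  proof
    show "fst (\<phi> i a) \<in> topspace E" using \<phi>_mem[OF i that(1)] by auto
    have "(fst (\<phi> i a), z) = \<phi> i a" using that(2) by (simp add: p_def prod_eq_iff)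
    then show "f (fst (\<phi> i a)) = a" using lift_\<phi>[OF i that(1)] by (simp add: f_def)
  qed
  have op: "openin E {v \<in> topspace E. B (f v)}"
    if B: "\<And>l u u'. l \<in> I \<Longrightarrow> u \<in> U i \<inter> W l \<Longrightarrow> u' \<in> U i \<inter> W l \<Longrightarrow> p i u = z \<Longrightarrow> p i u' = z \<Longrightarrow> B u \<Longrightarrow> B u'" for B
  proof (subst openin_subopen, intro ballI)
    fix v assume "v \<in> {v \<in> topspace E. B (f v)}"
    then have v: "v \<in> topspace E" "B (f v)" by auto
    have "f v \<in> topspace X" using f(1)[OF v(1)] U_subset[OF i] by blast
    then obtain l where l: "l \<in> I" "f v \<in> W l" using W_cover by blast
    have "openin E {w \<in> topspace E. f w \<in> W l}"
      using openin_continuous_map_preimage[OF cont openin_W[OF l(1)]] .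
    moreover have "{w \<in> topspace E. f w \<in> W l} \<subseteq> {v \<in> topspace E. B (f v)}"
      using B[OF l(1), of "f v"] l(2) f v by auto
    ultimately show "\<exists>V. openin E V \<and> v \<in> V \<and> V \<subseteq> {v \<in> topspace E. B (f v)}" using v(1) l(2) by blast
  qed
  have compl: "topspace E - {v \<in> topspace E. A (f v)} = {v \<in> topspace E. \<not> A (f v)}" by blast
  have "openin E {v \<in> topspace E. A (f v)}" by (rule op[OF step])
  moreover have "openin E {v \<in> topspace E. \<not> A (f v)}" by (rule op) (use step in blast)
  then have "closedin E {v \<in> topspace E. A (f v)}"
    unfolding closedin_def by (simp add: compl)
  ultimately have "{v \<in> topspace E. A (f v)} = {} \<or> {v \<in> topspace E. A (f v)} = topspace E"
    using connected_Euclidean_space[of n] unfolding connected_space_clopen_in by blast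
  moreover obtain v where "v \<in> topspace E" "f v = u" using onto u by blast
  moreover obtain v' where "v' \<in> topspace E" "f v' = u'" using onto u' by blast
  ultimately show ?thesis using u(3) by blast
qed

section \<open>Following holonomy along plaques\<close>

text \<open>Near \<open>x\<close> the holonomy from chart \<open>j\<close> to chart \<open>l\<close> is a return map followed by a word.\<close>

definition factored where
  "factored l j x \<longleftrightarrow> (\<exists>\<gamma>\<in>returns. \<exists>b\<in>words T letters. \<exists>V. openin T V \<and> x \<in> V \<and>
     (\<forall>x'\<in>V. \<exists>w w'. \<gamma> x' = Some w \<and> b w = Some w' \<and> holonomy_map U \<phi> l j x' = Some w'))"

text \<open>At the centre of the plaque the holonomy into \<open>W l\<close> is itself a return map. Passing from one \<open>W m\<close>
to an overlapping \<open>W l\<close> along the plaque composes the holonomy with the letter from \<open>m\<close> to \<open>l\<close>, by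
the cocycle identity at transverse points near the plaque.\<close>

lemma holonomy_into_W_factored:
  assumes j: "j \<in> I" and l: "l \<in> I" and u: "u \<in> U j \<inter> W l"
  shows "factored l j (j, p j u)"
proof -
  let ?z = "p j u"
  have z: "?z \<in> topspace (Z j)" using p_mem[OF j] u by blast
  let ?A = "\<lambda>u. \<forall>l\<in>I. u \<in> W l \<longrightarrow> factored l j (j, ?z)"
  have start: "?A (centre j ?z)"
  proof (intro ballI impI)
    fix l assume l: "l \<in> I" and c: "centre j ?z \<in> W l"
    let ?V = "dom (return j l)"
    have 1: "openin T ?V" using Ph_dom[OF return_Ph[OF j l]] .
    have "return j l (j, ?z) = Some (l, p l (centre j ?z))" unfolding return_iff[OF j l] using z c by blast
    then have 2: "(j, ?z) \<in> ?V" by blast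
    have 3: "return j l \<in> returns" using j l unfolding returns_def by blast
    have "\<exists>w w'. return j l x' = Some w \<and> id_Ph T w = Some w' \<and> holonomy_map U \<phi> l j x' = Some w'"
      if x': "x' \<in> ?V" for x'
    proof -
      obtain y where y: "return j l x' = Some y" using x' by blast
      then obtain a where a: "a \<in> topspace (Z j)" "centre j a \<in> W l" "x' = (j, a)" "y = (l, p l (centre j a))"
        unfolding return_iff[OF j l] by blast
      have "y \<in> topspace T" using Ph_topspace(2)[OF return_Ph[OF j l] y] .
      then have "id_Ph T y = Some y" by (simp add: id_Ph_iff)
      moreover have "holonomy_map U \<phi> l j x' = Some y"
        unfolding holonomy_map_iff[OF l j]
        using a centre_mem[OF j a(1)] p_centre[OF j a(1)] W_U[OF l] by (intro bexI[of _ "centre j a"]) auto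
      ultimately show ?thesis using y by blast
    qed
    then show "factored l j (j, ?z)" unfolding factored_def using 1 2 3 words.empty_word by blast
  qed
  have step: "?A v'" if m: "m \<in> I" and v: "v \<in> U j \<inter> W m" "v' \<in> U j \<inter> W m" "p j v = ?z" "p j v' = ?z" "?A v" for m v v'
  proof (intro ballI impI)
    fix l assume l: "l \<in> I" and vl: "v' \<in> W l"
    have "factored m j (j, ?z)" using v(1,5) m by blast
    then obtain \<gamma> b V where V: "\<gamma> \<in> returns" "b \<in> words T letters" "openin T V" "(j, ?z) \<in> V"
      "\<forall>x'\<in>V. \<exists>w w'. \<gamma> x' = Some w \<and> b w = Some w' \<and> holonomy_map U \<phi> m j x' = Some w'"
      unfolding factored_def by blast
    obtain a where a: "a \<in> words T letters" "\<forall>v\<in>W l \<inter> W m. a (m, p m v) = Some (l, p l v)"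
      using letter_word_at[OF l m, of v'] v(2) vl by blast
    obtain e where e: "e \<in> words T letters" "\<And>x y z. b x = Some y \<Longrightarrow> a y = Some z \<Longrightarrow> e x = Some z"
      by (rule words_comp[OF letters_Ph V(2) a(1)]) (rule that; blast)
    let ?N = "W m \<inter> W l \<inter> U j"
    have "openin (Z j) (p j ` ?N)" using openin_W m l j openin_U by (intro openin_p_image) auto
    then have "openin T ({j} \<times> p j ` ?N)" using j by (intro openin_slice)
    then have "openin T (V \<inter> {j} \<times> p j ` ?N)" using V(3) by blast
    moreover have "v' \<in> ?N" using v(2) vl by blast
    then have "p j v' \<in> p j ` ?N" by (rule imageI)
    then have "(j, ?z) \<in> V \<inter> {j} \<times> p j ` ?N" using V(4) v(4) by simp
    moreover have "\<exists>w w'. \<gamma> x' = Some w \<and> e w = Some w' \<and> holonomy_map U \<phi> l j x' = Some w'"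
      if x': "x' \<in> V \<inter> {j} \<times> p j ` ?N" for x'
    proof -
      obtain t where t: "t \<in> W m" "t \<in> W l" "t \<in> U j" "x' = (j, p j t)" using x' by blast
      obtain w w' where w: "\<gamma> x' = Some w" "b w = Some w'" "holonomy_map U \<phi> m j x' = Some w'" using V(5) x' by blast
      have tU: "t \<in> U m" "t \<in> U l" using t W_U m l by blast+
      have "holonomy_map U \<phi> m j x' = Some (m, p m t)" unfolding holonomy_map_iff[OF m j] using t tU by blast
      then have "w' = (m, p m t)" using w(3) by simp
      then have "a w' = Some (l, p l t)" using a(2) t by blast
      then have "e w = Some (l, p l t)" by (rule e(2)[OF w(2)])
      moreover have "holonomy_map U \<phi> l j x' = Some (l, p l t)" unfolding holonomy_map_iff[OF l j] using t tU by blast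
      ultimately show ?thesis using w(1) by blast
    qed
    ultimately show "factored l j (j, ?z)" unfolding factored_def using V(1) e(1) by blast
  qed
  have "?A u"
    by (rule plaque_induct[OF j z, of ?A, OF step])
       (use start centre_mem[OF j z] p_centre[OF j z] u in auto)
  then show ?thesis using l u by blast
qed

text \<open>Choose \<open>l\<close> with \<open>u\<close> in \<open>W l\<close>. Then \<open>h\<^sub>i\<^sub>j\<close> is locally \<open>h\<^sub>l\<^sub>i\<^sup>-\<^sup>1 h\<^sub>l\<^sub>j\<close>, and both factors are return maps
followed by words.\<close>

lemma holonomy_factorisation:
  assumes h: "h \<in> H" and x: "x \<in> dom h"
  shows "\<exists>\<gamma>\<in>returns. \<exists>\<gamma>'\<in>returns. \<exists>b\<in>words T letters. \<exists>V. openin T V \<and> x \<in> V \<and>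
         (\<forall>x'\<in>V. \<exists>y w w'. h x' = Some y \<and> \<gamma> x' = Some w \<and> b w = Some w' \<and> \<gamma>' y = Some w')"
proof -
  obtain i j where ij: "i \<in> I" "j \<in> I" and hh: "h = holonomy_map U \<phi> i j" using h unfolding H_def by blast
  note h_iff = holonomy_map_iff[OF ij]
  obtain u where u: "u \<in> U i \<inter> U j" "x = (j, p j u)" using x unfolding hh dom_def by (auto simp: h_iff)
  have hx: "h x = Some (i, p i u)" unfolding hh h_iff using u by blast
  obtain l where l: "l \<in> I" "u \<in> W l" using W_cover u(1) U_subset[OF ij(1)] by blast
  have "factored l j x" "factored l i (i, p i u)"
    using holonomy_into_W_factored[OF ij(2) l(1)] holonomy_into_W_factored[OF ij(1) l(1)] u l by auto
  then obtain \<gamma>1 b1 V1 \<gamma>2 b2 V2 where 1: "\<gamma>1 \<in> returns" "b1 \<in> words T letters" "openin T V1" "x \<in> V1"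
      "\<forall>x'\<in>V1. \<exists>w w'. \<gamma>1 x' = Some w \<and> b1 w = Some w' \<and> holonomy_map U \<phi> l j x' = Some w'"
    and 2: "\<gamma>2 \<in> returns" "b2 \<in> words T letters" "openin T V2" "(i, p i u) \<in> V2"
      "\<forall>x'\<in>V2. \<exists>w w'. \<gamma>2 x' = Some w \<and> b2 w = Some w' \<and> holonomy_map U \<phi> l i x' = Some w'"
    unfolding factored_def by blast
  obtain b2' where b2': "b2' \<in> words T letters" "\<And>x y. b2 x = Some y \<Longrightarrow> b2' y = Some x"
    by (rule words_inverse[OF letters_Ph _ 2(2)], erule letters_inverse) (rule that, assumption, simp)
  obtain b where b: "b \<in> words T letters" "\<And>x y z. b1 x = Some y \<Longrightarrow> b2' y = Some z \<Longrightarrow> b x = Some z"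
    by (rule words_comp[OF letters_Ph 1(2) b2'(1)]) (rule that; blast)
  let ?N = "U i \<inter> U j \<inter> W l"
  let ?V = "V1 \<inter> preim h V2 \<inter> {j} \<times> p j ` ?N"
  have "openin T ({j} \<times> p j ` ?N)" using openin_W openin_U l ij by (intro openin_slice openin_p_image) auto
  moreover have "openin T (preim h V2)" unfolding hh by (rule Ph_preim[OF holonomy_Ph[OF ij] 2(3)])
  ultimately have "openin T ?V" using 1(3) by blast
  moreover have "x \<in> ?V" using 1(4) 2(4) hx u l by (auto simp: preim_def)
  moreover have "\<exists>y w w'. h x' = Some y \<and> \<gamma>1 x' = Some w \<and> b w = Some w' \<and> \<gamma>2 y = Some w'" if x': "x' \<in> ?V" for x'
  proof -
    obtain t where t: "t \<in> U i" "t \<in> U j" "t \<in> W l" "x' = (j, p j t)" using x' by blast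
    have tl: "t \<in> U l" using t W_U l by blast
    have ht: "h x' = Some (i, p i t)" unfolding hh h_iff using t by blast
    then have V2: "(i, p i t) \<in> V2" using x' by (auto simp: preim_def)
    obtain w w' where w: "\<gamma>1 x' = Some w" "b1 w = Some w'" "holonomy_map U \<phi> l j x' = Some w'" using 1(5) x' by blast
    obtain q q' where q: "\<gamma>2 (i, p i t) = Some q" "b2 q = Some q'" "holonomy_map U \<phi> l i (i, p i t) = Some q'" using 2(5) V2 by blast
    have "holonomy_map U \<phi> l j x' = Some (l, p l t)" unfolding holonomy_map_iff[OF l(1) ij(2)] using t tl by blast
    moreover have "holonomy_map U \<phi> l i (i, p i t) = Some (l, p l t)" unfolding holonomy_map_iff[OF l(1) ij(1)] using t tl by blast
    ultimately have "w' = q'" using w(3) q(3) by simp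
    then have "b w = Some q" using b(2)[OF w(2)] b2'(2)[OF q(2)] by simp
    then show ?thesis using ht w(1) q(1) by blast
  qed
  ultimately show ?thesis using 1(1) 2(1) b(1) by blast
qed

sublocale transversal_system T G H letters returns
proof
  show "locally_compact_space T" by (rule locally_compact_T)
  show "Hausdorff_space T" by (rule Hausdorff_T)
  show "\<exists>K::nat \<Rightarrow> ('i \<times> 'z) set. (\<forall>m. compactin T (K m)) \<and> topspace T \<subseteq> (\<Union>m. K m)" by (rule sigma_compact_T)
  show "H \<subseteq> Ph T" by (rule H_holonomy_Ph)
  show "G = generated_pseudogroup T H" by (rule G_H)
  show "letters \<subseteq> Ph T" by (rule letters_Ph)
  let ?I = "{i \<in> I. U i \<noteq> {}}"
  have "letters \<subseteq> (\<lambda>(i, j). hol i j (W i \<inter> W j)) ` (?I \<times> ?I)" by (auto simp: letters_def)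
  then show "finite letters" using finite_charts finite_subset by blast
next
  fix c assume "c \<in> letters"
  then obtain i j where c: "c = hol i j (W i \<inter> W j)" "i \<in> I" "j \<in> I" "U i \<noteq> {}" "U j \<noteq> {}"
    unfolding letters_def by blast
  show "inv_Ph c \<in> letters" using \<open>c \<in> letters\<close> by (rule letters_inverse)
  let ?h = "holonomy_map U \<phi> i j" and ?K = "{j} \<times> p j ` (K i \<inter> K j)"
  have "compactin X (K i \<inter> K j)"
    using compact_Int_closedin[OF compactin_K[OF c(2)]] compactin_imp_closedin[OF Hausdorff_X compactin_K[OF c(3)]] by blast
  then have "compactin T ?K" using K_U[OF c(3)] c(3) by (intro compactin_pair) auto
  moreover have "dom c \<subseteq> ?K"
    using W_K[OF c(2)] W_K[OF c(3)] unfolding c(1) dom_def by (auto simp: hol_iff[OF c(2,3) letter_subset[OF c(2,3)]])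
  moreover have "?K \<subseteq> dom ?h"
  proof
    fix x assume "x \<in> ?K"
    then obtain u where "u \<in> K i" "u \<in> K j" "x = (j, p j u)" by blast
    then have "?h x = Some (i, p i u)"
      unfolding holonomy_map_iff[OF c(2,3)] using K_U[OF c(2)] K_U[OF c(3)] by blast
    then show "x \<in> dom ?h" by blast
  qed
  moreover have "c \<subseteq>\<^sub>m ?h" unfolding c(1) hol_def by (simp add: map_le_def)
  ultimately show "\<exists>g\<in>G. \<exists>K. compactin T K \<and> dom c \<subseteq> K \<and> K \<subseteq> dom g \<and> c \<subseteq>\<^sub>m g"
    using holonomy_G[OF c(2,3)] by blast
next
  show "returns \<subseteq> G"
  proof
    fix \<gamma> assume "\<gamma> \<in> returns"
    then obtain i j where ij: "i \<in> I" "j \<in> I" "\<gamma> = return i j" unfolding returns_def by blast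
    let ?N = "{u \<in> U i \<inter> U j. centre i (p i u) \<in> W j}"
    have "openin T ({i} \<times> p i ` ?N)" using return_set_open[OF ij(1,2)] ij by (intro openin_slice openin_p_image) auto
    then show "\<gamma> \<in> G" unfolding ij(3) return_def hol_def
      by (intro pseudo_star_group_restrict[OF pseudo_star_group_holonomy] holonomy_G ij)
  qed
next
  fix x assume "x \<in> topspace T"
  then obtain i u where u: "i \<in> I" "u \<in> U i" "x = (i, p i u)" "u = centre i (p i u)" by (rule topspace_T_cases)
  obtain l where l: "l \<in> I" "u \<in> W l" using W_cover u(1,2) U_subset by blast
  have "return i l x = Some (l, p l u)"
    unfolding return_iff[OF u(1) l(1)] using u l p_mem[OF u(1,2)] by (intro bexI[of _ "p i u"]) auto
  then show "\<exists>\<gamma>\<in>returns. x \<in> dom \<gamma>" using u l unfolding returns_def by blast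
next
  fix \<gamma> \<gamma>' assume g: "\<gamma> \<in> returns" "\<gamma>' \<in> returns"
  then obtain i j i' j' where ij: "i \<in> I" "j \<in> I" "\<gamma> = return i j" "i' \<in> I" "j' \<in> I" "\<gamma>' = return i' j'"
    unfolding returns_def by blast
  show "\<exists>b\<in>words T letters. \<forall>x y y'. \<gamma> x = Some y \<longrightarrow> \<gamma>' x = Some y' \<longrightarrow> b y = Some y'"
  proof (cases "\<exists>x y y'. \<gamma> x = Some y \<and> \<gamma>' x = Some y'")
    case False
    then show ?thesis using words.empty_word by blast
  next
    case True
    have common: "\<exists>v\<in>W j' \<inter> W j. y = (j, p j v) \<and> y' = (j', p j' v)" if "\<gamma> x = Some y" "\<gamma>' x = Some y'" for x y y'
      using that unfolding ij(3,6) return_iff[OF ij(1,2)] return_iff[OF ij(4,5)] by auto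
    then obtain v where "v \<in> W j' \<inter> W j" using True by blast
    from letter_word_at[OF ij(5,2) this] show ?thesis using common by blast
  qed
next
  fix h x assume "h \<in> H" "x \<in> dom h"
  then show "\<exists>\<gamma>\<in>returns. \<exists>\<gamma>'\<in>returns. \<exists>b\<in>words T letters. \<exists>V. openin T V \<and> x \<in> V \<and>
         (\<forall>x'\<in>V. \<exists>y w w'. h x' = Some y \<and> \<gamma> x' = Some w \<and> b w = Some w' \<and> \<gamma>' y = Some w')"
    by (rule holonomy_factorisation)
qed

section \<open>Minimality\<close>

text \<open>An invariant open subset of the transversal corresponds to an open union of leaves. It meets every
leaf since leaves are dense, and so it contains every leaf.\<close>

lemma minimal_foliation_imp_invariant_open_trivial:
  assumes min: "minimal_foliation X F" and D: "openin T D" "D \<noteq> {}"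
    and inv: "\<And>g x y. g \<in> G \<Longrightarrow> g x = Some y \<Longrightarrow> x \<in> D \<Longrightarrow> y \<in> D"
  shows "D = topspace T"
proof
  show "D \<subseteq> topspace T" using D(1) by (rule openin_subset)
  have move: "(j, p j u) \<in> D" if "i \<in> I" "j \<in> I" "u \<in> U i" "u \<in> U j" "(i, p i u) \<in> D" for i j u
  proof -
    have "holonomy_map U \<phi> j i (i, p i u) = Some (j, p j u)"
      unfolding holonomy_map_iff[OF that(2,1)] using that by blast
    then show ?thesis using inv[OF holonomy_G[OF that(2,1)]] that(5) by blast
  qed
  define S where "S = {u. \<exists>i\<in>I. u \<in> U i \<and> (i, p i u) \<in> D}"
  have saturated: "v \<in> S" if "(u, v) \<in> (same_plaque I U \<phi>)\<^sup>+" "u \<in> S" for u v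
    using that
  proof (induction rule: trancl_induct)
    case (base v)
    then obtain l where l: "l \<in> I" "u \<in> U l" "v \<in> U l" "p l u = p l v" by (auto simp: same_plaque_def p_def)
    obtain i where "i \<in> I" "u \<in> U i" "(i, p i u) \<in> D" using base(2) by (auto simp: S_def)
    then have "(l, p l v) \<in> D" using move[of i l u] l by simp
    then show ?case using l by (auto simp: S_def)
  next
    case (step v w)
    then obtain l where l: "l \<in> I" "v \<in> U l" "w \<in> U l" "p l v = p l w" by (auto simp: same_plaque_def p_def)
    obtain i where "i \<in> I" "v \<in> U i" "(i, p i v) \<in> D" using step by (auto simp: S_def)
    then have "(l, p l w) \<in> D" using move[of i l v] l by simp
    then show ?case using l by (auto simp: S_def)
  qed
  show "topspace T \<subseteq> D"
  proof
    fix x assume "x \<in> topspace T"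
    then obtain i u where u: "i \<in> I" "u \<in> U i" "x = (i, p i u)" by (rule topspace_T_cases)
    have uX: "u \<in> topspace X" using u U_subset by blast
    have part: "\<Union>F = topspace X" and leaves: "{(x, y). \<exists>L\<in>F. x \<in> L \<and> y \<in> L} = (same_plaque I U \<phi>)\<^sup>+"
      using atlas by (auto simp: foliated_space_atlas_def partition_on_def)
    obtain L where L: "L \<in> F" "u \<in> L" using part uX by blast
    obtain y where y: "y \<in> D" using D(2) by blast
    then have "y \<in> topspace T" using D(1) openin_subset by blast
    then obtain j v0 where v0: "j \<in> I" "v0 \<in> U j" "y = (j, p j v0)" by (rule topspace_T_cases)
    let ?N = "{v \<in> U j. (j, p j v) \<in> D}"
    have "openin X ?N" using openin_pair_vimage[OF v0(1) D(1)] .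
    moreover have "?N \<noteq> {}" using v0 y by blast
    moreover have "X closure_of L = topspace X" using min L by (simp add: minimal_foliation_def)
    ultimately obtain v where v: "v \<in> L" "v \<in> U j" "(j, p j v) \<in> D" unfolding dense_intersects_open by blast
    have "(v, u) \<in> (same_plaque I U \<phi>)\<^sup>+" unfolding leaves[symmetric] using L v by blast
    moreover have "v \<in> S" using v v0(1) by (auto simp: S_def)
    ultimately have "u \<in> S" by (rule saturated)
    then obtain i' where "i' \<in> I" "u \<in> U i'" "(i', p i' u) \<in> D" by (auto simp: S_def)
    then show "x \<in> D" using move u by blast
  qed
qed

end

section \<open>Compact foliated spaces\<close>

lemma locally_finite_family_compact_finite:
  assumes lf: "locally_finite_family X I U" and c: "compact_space X" and sub: "\<And>i. i \<in> I \<Longrightarrow> U i \<subseteq> topspace X"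
  shows "finite {i \<in> I. U i \<noteq> {}}"
proof -
  let ?\<V> = "{V. openin X V \<and> finite {i \<in> I. U i \<inter> V \<noteq> {}}}"
  have "topspace X \<subseteq> \<Union>?\<V>" using lf unfolding locally_finite_family_def by blast
  then obtain \<F> where F: "finite \<F>" "\<F> \<subseteq> ?\<V>" "topspace X \<subseteq> \<Union>\<F>"
    using c unfolding compact_space_alt by (metis (no_types, lifting) mem_Collect_eq)
  have "{i \<in> I. U i \<noteq> {}} \<subseteq> (\<Union>V\<in>\<F>. {i \<in> I. U i \<inter> V \<noteq> {}})"
  proof
    fix i assume "i \<in> {i \<in> I. U i \<noteq> {}}"
    then obtain u where u: "i \<in> I" "u \<in> U i" by blast
    then have "u \<in> \<Union>\<F>" using F(3) sub by blast
    then show "i \<in> (\<Union>V\<in>\<F>. {i \<in> I. U i \<inter> V \<noteq> {}})" using u by blast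
  qed
  moreover have "finite (\<Union>V\<in>\<F>. {i \<in> I. U i \<inter> V \<noteq> {}})" using F(1,2) by blast
  ultimately show ?thesis by (rule finite_subset)
qed

text \<open>Finitely many open sets \<open>Y\<close>, each with a compact \<open>C\<close> between \<open>Y\<close> and some \<open>U i\<close>, cover the space; the
unions of those belonging to the same \<open>i\<close> are the required sets.\<close>

lemma compact_Hausdorff_cover_shrinking:
  assumes c: "compact_space X" and H: "Hausdorff_space X"
    and o: "\<And>i. i \<in> I \<Longrightarrow> openin X (U i)" and cov: "\<And>u. u \<in> topspace X \<Longrightarrow> \<exists>i\<in>I. u \<in> U i"
  shows "\<exists>W K. (\<forall>i\<in>I. openin X (W i) \<and> compactin X (K i) \<and> W i \<subseteq> K i \<and> K i \<subseteq> U i) \<and>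
     (\<forall>u\<in>topspace X. \<exists>i\<in>I. u \<in> W i)"
proof -
  define P where "P = {(i, Y, C). i \<in> I \<and> openin X Y \<and> compactin X C \<and> Y \<subseteq> C \<and> C \<subseteq> U i}"
  have "topspace X \<subseteq> \<Union>((\<lambda>(i, Y, C). Y) ` P)"
  proof
    fix u assume "u \<in> topspace X"
    then obtain i where i: "i \<in> I" "u \<in> U i" using cov by blast
    obtain Y C where Y: "openin X Y" "compactin X C" "u \<in> Y" "Y \<subseteq> C" "C \<subseteq> U i"
      using compact_neighbourhood[OF compact_imp_locally_compact_space[OF c] H o[OF i(1)] i(2)] .
    then have "(i, Y, C) \<in> P" using i by (simp add: P_def)
    then show "u \<in> \<Union>((\<lambda>(i, Y, C). Y) ` P)" using Y(3) by force
  qed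
  moreover have "\<forall>Y\<in>(\<lambda>(i, Y, C). Y) ` P. openin X Y" by (auto simp: P_def)
  ultimately obtain \<F> where F: "finite \<F>" "\<F> \<subseteq> (\<lambda>(i, Y, C). Y) ` P" "topspace X \<subseteq> \<Union>\<F>"
    using c unfolding compact_space_alt by metis
  then obtain Q where Q: "Q \<subseteq> P" "finite Q" "\<F> = (\<lambda>(i, Y, C). Y) ` Q" by (meson finite_subset_image)
  define W where "W i = \<Union>{Y. \<exists>C. (i, Y, C) \<in> Q}" for i
  define K where "K i = \<Union>{C. \<exists>Y. (i, Y, C) \<in> Q}" for i
  have fin: "finite {C. \<exists>Y. (i, Y, C) \<in> Q}" for i
  proof (rule finite_subset)
    show "{C. \<exists>Y. (i, Y, C) \<in> Q} \<subseteq> (\<lambda>(i, Y, C). C) ` Q" by force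
  qed (use Q in simp)
  have "openin X (W i)" for i unfolding W_def using Q(1) by (intro openin_Union) (auto simp: P_def)
  moreover have "compactin X (K i)" for i
    unfolding K_def using Q(1) by (intro compactin_Union fin) (auto simp: P_def)
  moreover have "W i \<subseteq> K i" "K i \<subseteq> U i" for i
    unfolding W_def K_def using Q(1) by (fastforce simp: P_def)+
  moreover have "\<exists>i\<in>I. u \<in> W i" if u: "u \<in> topspace X" for u
  proof -
    obtain q where q: "q \<in> Q" "u \<in> (\<lambda>(i, Y, C). Y) q" using F(3) u Q(3) by blast
    obtain i Y C where "q = (i, Y, C)" by (cases q)
    then have "(i, Y, C) \<in> Q" "u \<in> Y" using q by auto
    moreover have "i \<in> I" using \<open>(i, Y, C) \<in> Q\<close> Q(1) by (auto simp: P_def)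
    ultimately show ?thesis unfolding W_def by blast
  qed
  ultimately show ?thesis by (intro exI[of _ W] exI[of _ K]) simp
qed

theorem theorem1p15:
  fixes n :: nat and k :: enat
    and X :: "'a topology" and F :: "'a set set"
    and I :: "'i set" and U :: "'i \<Rightarrow> 'a set"
    and \<phi> :: "'i \<Rightarrow> 'a \<Rightarrow> (nat \<Rightarrow> real) \<times> 'z" and Z :: "'i \<Rightarrow> 'z topology"
  assumes "foliated_space_atlas n k X F I U \<phi> Z"
    and "locally_finite_family X I U"
    and "compact_space X"
    and "fol_transitive I U \<phi> Z"
  shows "(fol_sensitive I U \<phi> Z \<or> fol_almost_equicontinuous I U \<phi> Z) \<and>
         (topspace X \<noteq> {} \<longrightarrow>
            \<not> (fol_sensitive I U \<phi> Z \<and> fol_almost_equicontinuous I U \<phi> Z)) \<and>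
         (minimal_foliation X F \<longrightarrow>
            (fol_sensitive I U \<phi> Z \<or> fol_equicontinuous I U \<phi> Z) \<and>
            (topspace X \<noteq> {} \<longrightarrow>
               \<not> (fol_sensitive I U \<phi> Z \<and> fol_equicontinuous I U \<phi> Z)))"
proof -
  interpret foliated_atlas n k X F I U \<phi> Z by unfold_locales (rule assms(1))
  obtain W K where WK: "\<forall>i\<in>I. openin X (W i) \<and> compactin X (K i) \<and> W i \<subseteq> K i \<and> K i \<subseteq> U i"
     "\<forall>u\<in>topspace X. \<exists>i\<in>I. u \<in> W i"
    using compact_Hausdorff_cover_shrinking[OF assms(3) Hausdorff_X openin_U U_cover] by blast
  interpret shrunk_foliated_atlas n k X F I U \<phi> Z W K
    using WK compact_imp_locally_compact_space[OF assms(3)]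
      locally_finite_family_compact_finite[OF assms(2,3) U_subset]
    by unfold_locales auto
  have s: "fol_sensitive I U \<phi> Z \<longleftrightarrow> sensitive T G"
    and a: "fol_almost_equicontinuous I U \<phi> Z \<longleftrightarrow> almost_equicontinuous T G"
    and e: "fol_equicontinuous I U \<phi> Z \<longleftrightarrow> equicontinuous T G"
    by (simp_all add: fol_sensitive_def fol_almost_equicontinuous_def fol_equicontinuous_def G_def)
  have t: "topologically_transitive T G" using assms(4) by (simp add: fol_transitive_def G_def)
  have "sensitive T G \<or> almost_equicontinuous T G"
    using sensitive_or_almost_equicontinuous[OF t] by blast
  moreover have "sensitive T G \<or> equicontinuous T G" if "minimal_foliation X F"
    using sensitive_or_equicontinuous[OF minimal_foliation_imp_invariant_open_trivial[OF that]] by blast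
  moreover have "\<not> (sensitive T G \<and> almost_equicontinuous T G)" if ne: "topspace X \<noteq> {}"
  proof -
    obtain i u where "i \<in> I" "u \<in> U i" using ne U_cover by blast
    then have "(i, p i u) \<in> topspace T" using p_mem by simp
    then have "topspace T \<noteq> {}" by blast
    then show ?thesis using sensitive_not_almost_equicontinuous[OF G_Ph] by blast
  qed
  ultimately show ?thesis unfolding s a e using equicontinuous_imp_almost_equicontinuous by blast
qed

end
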